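(* Let $I\subset S$ be a homogeneous ideal such that $Y=V_X(I)$ is zero-dimensional. If $\beta\in\mathrm{Reg}(I)$, then $(S/I)_\beta\simeq H^0(Y,\mathscr{O}_Y)$ (as $\mathbb{C}$-vector spaces).
   Context: $X=X_\Sigma$ is the normal toric variety over $\mathbb{C}$ of a complete rational polyhedral fan $\Sigma$ in $\mathbb{R}^n$, with rays $\rho_1,\dots,\rho_k$ and corresponding torus-invariant prime divisors $D_1,\dots,D_k$. The Cox ring is $S=\mathbb{C}[x_1,\dots,x_k]$, graded by the class group $\mathrm{Cl}(X)$ via $\deg x_i=[D_i]$, with graded pieces $S_\alpha$; $x^{\hat\sigma}=\prod_{\rho_i\notin\sigma}x_i$ and $B=\langle x^{\hat\sigma}\mid\sigma\in\Sigma\rangle$ is the irrelevant ideal. $\pi:\mathbb{C}^k\setminus\mathrm{Var}_{\mathbb{C}^k}(B)\to X$ is the Cox quotient map; for homogeneous $f$, $\mathrm{Var}_X(f)=\{\zeta\in X\mid f(x)=0\text{ for some }x\in\pi^{-1}(\zeta)\}$. A homogeneous ideal $I\subset S$ defines a closed subscheme $V_X(I)\subset X$, given on the chart $U_\sigma$ by $(I_{x^{\hat\sigma}})_0\subset(S_{x^{\hat\sigma}})_0\simeq\mathbb{C}[U_\sigma]$; $\mathrm{Var}_X(I)$ is its reduced variety. A point $\zeta\in X$ is a basepoint of $\alpha\in\mathrm{Cl}(X)$ if $\zeta\in\mathrm{Var}_X(f)$ for all $f\in S_\alpha$; $\alpha$ is $V_X(I)$-basepoint free if no point of $\mathrm{Var}_X(I)$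 is a basepoint of $\alpha$. For $V_X(I)$ zero-dimensional of degree $\delta^+$ (number of points counted with multiplicity), $\mathrm{Reg}(I)=\{\alpha\in\mathrm{Cl}(X)\mid\dim_{\mathbb C}(S/I)_\alpha=\delta^+,\ I_\alpha=(I:B^\infty)_\alpha,\ \alpha\text{ is }V_X(I)\text{-basepoint free}\}$. *)

theory Defs
  imports
    "HOL-Analysis.Analysis"
    "HOL-Library.Poly_Mapping"
    "HOL-Library.Extended_Real"
    "HOL-Algebra.QuotRing"
    "HOL-Algebra.Ideal_Product"
    "Jordan_Normal_Form.Missing_VectorSpace"
begin

section \<open>Algebraic preliminaries\<close>

definition complex_field :: "complex ring" where
  "complex_field = \<lparr>carrier = UNIV, mult = (*), one = 1, zero = 0, add = (+)\<rparr>"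

text \<open>
  \<open>\<complex>\<close>-algebras are \<open>module\<close> records, which contain a ring record. The underlying vector spaces are
  handled by the locale \<^locale>\<open>vectorspace\<close> over \<^const>\<open>complex_field\<close>.
\<close>

definition has_vdim :: "(complex, 'a, 'r) module_scheme \<Rightarrow> nat \<Rightarrow> bool" where
  "has_vdim V d \<longleftrightarrow>
     vectorspace complex_field V \<and> vectorspace.fin_dim complex_field V \<and>
     vectorspace.dim complex_field V = d"

definition vspace_iso ::
    "(complex, 'a, 'r) module_scheme \<Rightarrow> (complex, 'b, 's) module_scheme \<Rightarrow> bool" where
  "vspace_iso V W \<longleftrightarrow>
     (\<exists>T. linear_map complex_field V W T \<and> bij_betw T (carrier V) (carrier W))"

text \<open>The monoid algebra \<open>\<complex>[A]\<close>, for a submonoid \<open>A\<close> of an additive monoid.\<close>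

definition monoid_alg :: "'e::comm_monoid_add set \<Rightarrow> (complex, 'e \<Rightarrow>\<^sub>0 complex) module" where
  "monoid_alg A =
     \<lparr>carrier = {f. Poly_Mapping.keys f \<subseteq> A}, mult = (*), one = 1, zero = 0, add = (+),
      smult = (\<lambda>c f. Poly_Mapping.single 0 c * f)\<rparr>"

definition push_exponents ::
    "('e \<Rightarrow> 'd) \<Rightarrow> ('e \<Rightarrow>\<^sub>0 complex) \<Rightarrow> ('d \<Rightarrow>\<^sub>0 complex)" where
  "push_exponents \<phi> f =
     (\<Sum>a\<in>Poly_Mapping.keys f. Poly_Mapping.single (\<phi> a) (Poly_Mapping.lookup f a))"

definition quot_alg ::
    "(complex, 'a, 'r) module_scheme \<Rightarrow> 'a set \<Rightarrow> (complex, 'a set) module" where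
  "quot_alg R J =
     ring.extend (R Quot J) (module.fields (\<lambda>c X. \<Union>x\<in>X. J +>\<^bsub>R\<^esub> (c \<odot>\<^bsub>R\<^esub> x)))"

definition frac_rel ::
    "('a, 'r) ring_scheme \<Rightarrow> 'a set \<Rightarrow> (('a \<times> 'a) \<times> ('a \<times> 'a)) set" where
  "frac_rel R U =
     {((r, s), (r', s')). r \<in> carrier R \<and> r' \<in> carrier R \<and> s \<in> U \<and> s' \<in> U \<and>
        (\<exists>t\<in>U. t \<otimes>\<^bsub>R\<^esub> ((r \<otimes>\<^bsub>R\<^esub> s') \<ominus>\<^bsub>R\<^esub> (r' \<otimes>\<^bsub>R\<^esub> s)) = \<zero>\<^bsub>R\<^esub>)}"

definition frac :: "('a, 'r) ring_scheme \<Rightarrow> 'a set \<Rightarrow> 'a \<Rightarrow> 'a \<Rightarrow> ('a \<times> 'a) set" where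
  "frac R U r s = frac_rel R U `` {(r, s)}"

text \<open>The localization \<open>U\<^sup>-\<^sup>1R\<close> at a multiplicative subset \<open>U\<close>.\<close>

definition localization ::
    "(complex, 'a, 'r) module_scheme \<Rightarrow> 'a set \<Rightarrow> (complex, ('a \<times> 'a) set) module" where
  "localization R U =
     \<lparr>carrier = (carrier R \<times> U) // frac_rel R U,
      mult = (\<lambda>X Y. \<Union>(r, s)\<in>X. \<Union>(r', s')\<in>Y. frac R U (r \<otimes>\<^bsub>R\<^esub> r') (s \<otimes>\<^bsub>R\<^esub> s')),
      one = frac R U \<one>\<^bsub>R\<^esub> \<one>\<^bsub>R\<^esub>,
      zero = frac R U \<zero>\<^bsub>R\<^esub> \<one>\<^bsub>R\<^esub>,
      add = (\<lambda>X Y. \<Union>(r, s)\<in>X. \<Union>(r', s')\<in>Y.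
               frac R U ((r \<otimes>\<^bsub>R\<^esub> s') \<oplus>\<^bsub>R\<^esub> (r' \<otimes>\<^bsub>R\<^esub> s)) (s \<otimes>\<^bsub>R\<^esub> s')),
      smult = (\<lambda>c X. \<Union>(r, s)\<in>X. frac R U (c \<odot>\<^bsub>R\<^esub> r) s)\<rparr>"

definition prime_chain :: "('a, 'r) ring_scheme \<Rightarrow> nat \<Rightarrow> (nat \<Rightarrow> 'a set) \<Rightarrow> bool" where
  "prime_chain R n P \<longleftrightarrow> (\<forall>i\<le>n. primeideal (P i) R) \<and> (\<forall>i<n. P i \<subset> P (Suc i))"

text \<open>As usual for suprema in \<^typ>\<open>ereal\<close>, the zero ring has dimension \<open>-\<infinity>\<close>.\<close>

definition krull_dim :: "('a, 'r) ring_scheme \<Rightarrow> ereal" where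
  "krull_dim R = (SUP n\<in>{n. \<exists>P. prime_chain R n P}. ereal (real n))"

section \<open>Complete rational polyhedral fans\<close>

text \<open>The lattice is \<open>\<int>\<^sup>n\<close>, and the dual lattice of characters is identified with \<open>\<int>\<^sup>n\<close> by the inner
  product.\<close>

definition rvec :: "int ^ 'n \<Rightarrow> real ^ 'n" where
  "rvec m = (\<chi> i. of_int (m $ i))"

definition rational_cone :: "(real ^ 'n) set \<Rightarrow> bool" where
  "rational_cone \<sigma> \<longleftrightarrow> (\<exists>V. finite V \<and> \<sigma> = convex_cone hull (rvec ` V))"

definition strongly_convex :: "(real ^ 'n) set \<Rightarrow> bool" where
  "strongly_convex \<sigma> \<longleftrightarrow> \<sigma> \<inter> uminus ` \<sigma> = {0}"

text \<open>In the library the empty set is a face of every convex set; it is not a face of a cone.\<close>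

definition complete_fan :: "(real ^ 'n) set set \<Rightarrow> bool" where
  "complete_fan \<Sigma> \<longleftrightarrow>
     finite \<Sigma> \<and>
     (\<forall>\<sigma>\<in>\<Sigma>. rational_cone \<sigma> \<and> strongly_convex \<sigma>) \<and>
     (\<forall>\<sigma>\<in>\<Sigma>. \<forall>\<tau>. \<tau> face_of \<sigma> \<and> \<tau> \<noteq> {} \<longrightarrow> \<tau> \<in> \<Sigma>) \<and>
     (\<forall>\<sigma>\<in>\<Sigma>. \<forall>\<tau>\<in>\<Sigma>. (\<sigma> \<inter> \<tau>) face_of \<sigma> \<and> (\<sigma> \<inter> \<tau>) face_of \<tau>) \<and>
     \<Union>\<Sigma> = UNIV"

text \<open>The rays \<open>\<rho>\<^sub>1, \<dots>, \<rho>\<^sub>k\<close> are indexed by a finite type \<open>'k\<close>.\<close>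

definition enumerates_rays :: "(real ^ 'n) set set \<Rightarrow> ('k \<Rightarrow> (real ^ 'n) set) \<Rightarrow> bool" where
  "enumerates_rays \<Sigma> \<rho> \<longleftrightarrow> bij_betw \<rho> UNIV {\<sigma> \<in> \<Sigma>. dim \<sigma> = 1}"

text \<open>The primitive generator of a ray \<open>r\<close>: the generator of the monoid \<open>r \<inter> \<int>\<^sup>n\<close>.\<close>

definition ray_generator :: "(real ^ 'n) set \<Rightarrow> int ^ 'n" where
  "ray_generator r = (THE u. {m. rvec m \<in> r} = range (\<lambda>j::nat. \<chi> i. int j * u $ i))"

section \<open>Class group and Cox ring\<close>

text \<open>
  Torus-invariant divisors \<open>\<Sum>\<^sub>i a\<^sub>i D\<^sub>i\<close> are elements \<open>a\<close> of \<open>\<int>\<^sup>k\<close>. The divisor of the character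
  \<open>\<chi>\<^sup>m\<close> is \<open>\<Sum>\<^sub>i \<langle>m, u\<^sub>i\<rangle> D\<^sub>i\<close>, with \<open>u\<^sub>i\<close> the primitive generator of \<open>\<rho>\<^sub>i\<close>, and \<open>Cl(X)\<close> is the group of
  torus-invariant divisors modulo divisors of characters; its elements are cosets.
\<close>

definition char_div :: "('k \<Rightarrow> (real ^ 'n) set) \<Rightarrow> int ^ 'n \<Rightarrow> int ^ 'k" where
  "char_div \<rho> m = (\<chi> i. \<Sum>j\<in>UNIV. m $ j * ray_generator (\<rho> i) $ j)"

definition div_class :: "('k \<Rightarrow> (real ^ 'n) set) \<Rightarrow> int ^ 'k \<Rightarrow> (int ^ 'k) set" where
  "div_class \<rho> a = {a + char_div \<rho> m | m. True}"

definition class_group :: "('k \<Rightarrow> (real ^ 'n) set) \<Rightarrow> (int ^ 'k) set set" where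
  "class_group \<rho> = range (div_class \<rho>)"

type_synonym 'k cox = "(nat ^ 'k) \<Rightarrow>\<^sub>0 complex"

definition cox_ring :: "(complex, 'k::finite cox) module" where
  "cox_ring = monoid_alg UNIV"

definition ivec :: "nat ^ 'k \<Rightarrow> int ^ 'k" where
  "ivec a = (\<chi> i. int (a $ i))"

definition mono_degree :: "('k \<Rightarrow> (real ^ 'n) set) \<Rightarrow> nat ^ 'k \<Rightarrow> (int ^ 'k) set" where
  "mono_degree \<rho> a = div_class \<rho> (ivec a)"

definition cox_piece ::
    "('k \<Rightarrow> (real ^ 'n) set) \<Rightarrow> (int ^ 'k) set \<Rightarrow> ('k::finite) cox set" where
  "cox_piece \<rho> \<alpha> = {f. \<forall>a\<in>Poly_Mapping.keys f. mono_degree \<rho> a = \<alpha>}"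

definition hom_component ::
    "('k \<Rightarrow> (real ^ 'n) set) \<Rightarrow> (int ^ 'k) set \<Rightarrow> ('k::finite) cox \<Rightarrow> 'k cox" where
  "hom_component \<rho> \<alpha> f =
     (\<Sum>a\<in>{a \<in> Poly_Mapping.keys f. mono_degree \<rho> a = \<alpha>}.
        Poly_Mapping.single a (Poly_Mapping.lookup f a))"

definition homogeneous_ideal ::
    "('k \<Rightarrow> (real ^ 'n) set) \<Rightarrow> ('k::finite) cox set \<Rightarrow> bool" where
  "homogeneous_ideal \<rho> I \<longleftrightarrow>
     ideal I cox_ring \<and> (\<forall>f\<in>I. \<forall>\<alpha>\<in>class_group \<rho>. hom_component \<rho> \<alpha> f \<in> I)"

text \<open>The monomial \<open>x\<^sup>\<sigma>\<^sup>^ = \<Prod> x\<^sub>i\<close>, over the \<open>i\<close> for which \<open>\<rho>\<^sub>i\<close> is not a ray of \<open>\<sigma>\<close>; for cones of a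
  fan, \<open>\<rho>\<^sub>i\<close> is a ray of \<open>\<sigma>\<close> iff \<open>\<rho>\<^sub>i \<subseteq> \<sigma>\<close>.\<close>

definition xhat :: "('k \<Rightarrow> (real ^ 'n) set) \<Rightarrow> (real ^ 'n) set \<Rightarrow> ('k::finite) cox" where
  "xhat \<rho> \<sigma> = Poly_Mapping.single (\<chi> i. if \<rho> i \<subseteq> \<sigma> then 0 else 1) 1"

definition irrelevant_ideal ::
    "(real ^ 'n) set set \<Rightarrow> ('k \<Rightarrow> (real ^ 'n) set) \<Rightarrow> ('k::finite) cox set" where
  "irrelevant_ideal \<Sigma> \<rho> = genideal cox_ring (xhat \<rho> ` \<Sigma>)"

primrec ideal_power :: "('a, 'r) ring_scheme \<Rightarrow> 'a set \<Rightarrow> nat \<Rightarrow> 'a set" where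
  "ideal_power R J 0 = carrier R"
| "ideal_power R J (Suc l) = ideal_prod R (ideal_power R J l) J"

definition saturation :: "('a, 'r) ring_scheme \<Rightarrow> 'a set \<Rightarrow> 'a set \<Rightarrow> 'a set" where
  "saturation R I J =
     {f \<in> carrier R. \<exists>l. \<forall>g\<in>ideal_power R J l. f \<otimes>\<^bsub>R\<^esub> g \<in> I}"

definition quot_piece ::
    "('k \<Rightarrow> (real ^ 'n) set) \<Rightarrow> ('k::finite) cox set \<Rightarrow> (int ^ 'k) set \<Rightarrow>
     (complex, 'k cox set) module" where
  "quot_piece \<rho> I \<alpha> =
     (quot_alg cox_ring I)\<lparr>carrier := (\<lambda>f. I +>\<^bsub>cox_ring\<^esub> f) ` cox_piece \<rho> \<alpha>\<rparr>"

section \<open>Points of the toric variety and the Cox quotient map\<close>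

definition dual_monoid :: "(real ^ 'n) set \<Rightarrow> (int ^ 'n) set" where
  "dual_monoid \<sigma> = {m. \<forall>v\<in>\<sigma>. 0 \<le> rvec m \<bullet> v}"

text \<open>
  Closed points of the chart \<open>U\<^sub>\<sigma> = Spec \<complex>[\<sigma>\<^sup>\<or> \<inter> \<int>\<^sup>n]\<close>, as monoid homomorphisms to \<open>(\<complex>, *)\<close>;
  they are extensional, so that equal homomorphisms are equal functions.
\<close>

definition chart_points :: "(real ^ 'n) set \<Rightarrow> (int ^ 'n \<Rightarrow> complex) set" where
  "chart_points \<sigma> =
     {\<gamma> \<in> extensional (dual_monoid \<sigma>). \<gamma> 0 = 1 \<and>
        (\<forall>m\<in>dual_monoid \<sigma>. \<forall>m'\<in>dual_monoid \<sigma>. \<gamma> (m + m') = \<gamma> m * \<gamma> m')}"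

type_synonym 'n chart_point = "(real ^ 'n) set \<times> (int ^ 'n \<Rightarrow> complex)"

text \<open>\<open>U\<^sub>\<sigma>\<close> and \<open>U\<^sub>\<tau>\<close> are glued along \<open>U\<^bsub>\<sigma> \<inter> \<tau>\<^esub>\<close>.\<close>

definition glue :: "(real ^ 'n) set set \<Rightarrow> ('n chart_point \<times> 'n chart_point) set" where
  "glue \<Sigma> =
     {((\<sigma>, \<gamma>), (\<tau>, \<delta>)). \<sigma> \<in> \<Sigma> \<and> \<tau> \<in> \<Sigma> \<and>
        (\<exists>\<epsilon>\<in>chart_points (\<sigma> \<inter> \<tau>).
           \<gamma> = restrict \<epsilon> (dual_monoid \<sigma>) \<and> \<delta> = restrict \<epsilon> (dual_monoid \<tau>))}"

definition toric_variety :: "(real ^ 'n) set set \<Rightarrow> 'n chart_point set set" where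
  "toric_variety \<Sigma> = Sigma \<Sigma> chart_points // glue \<Sigma>"

definition cox_eval :: "('k::finite) cox \<Rightarrow> complex ^ 'k \<Rightarrow> complex" where
  "cox_eval f x =
     (\<Sum>a\<in>Poly_Mapping.keys f. Poly_Mapping.lookup f a * (\<Prod>i\<in>UNIV. x $ i ^ (a $ i)))"

definition affine_zeros :: "('k::finite) cox set \<Rightarrow> (complex ^ 'k) set" where
  "affine_zeros J = {x. \<forall>f\<in>J. cox_eval f x = 0}"

definition chart_coords ::
    "('k \<Rightarrow> (real ^ 'n) set) \<Rightarrow> (real ^ 'n) set \<Rightarrow> complex ^ ('k::finite) \<Rightarrow>
     int ^ 'n \<Rightarrow> complex" where
  "chart_coords \<rho> \<sigma> x =
     restrict (\<lambda>m. \<Prod>i\<in>UNIV. x $ i powi (char_div \<rho> m $ i)) (dual_monoid \<sigma>)"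

text \<open>
  Where \<open>x\<^sup>\<sigma>\<^sup>^\<close> does not vanish, \<open>\<pi>\<close> is the map to \<open>U\<^sub>\<sigma>\<close> dual to
  \<open>\<chi>\<^sup>m \<mapsto> \<Prod> x\<^sub>i\<^bsup>\<langle>m, u\<^sub>i\<rangle>\<^esup>\<close>. All the cones \<open>\<sigma>\<close> that qualify give the same glueing class.
\<close>

definition cox_map ::
    "(real ^ 'n) set set \<Rightarrow> ('k \<Rightarrow> (real ^ 'n) set) \<Rightarrow> complex ^ ('k::finite) \<Rightarrow>
     'n chart_point set" where
  "cox_map \<Sigma> \<rho> x =
     glue \<Sigma> `` {(\<sigma>, chart_coords \<rho> \<sigma> x) | \<sigma>. \<sigma> \<in> \<Sigma> \<and> cox_eval (xhat \<rho> \<sigma>) x \<noteq> 0}"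

definition toric_zeros ::
    "(real ^ 'n) set set \<Rightarrow> ('k \<Rightarrow> (real ^ 'n) set) \<Rightarrow> ('k::finite) cox \<Rightarrow>
     'n chart_point set set" where
  "toric_zeros \<Sigma> \<rho> f =
     {\<zeta> \<in> toric_variety \<Sigma>.
        \<exists>x. x \<notin> affine_zeros (irrelevant_ideal \<Sigma> \<rho>) \<and> cox_map \<Sigma> \<rho> x = \<zeta> \<and> cox_eval f x = 0}"

section \<open>The closed subscheme defined by a homogeneous ideal\<close>

text \<open>
  The localizations \<open>S\<^bsub>x\<^sup>\<sigma>\<^sup>^\<^esub>\<close> are subrings of the ring of Laurent polynomials, whose elements have
  exponents in \<open>\<int>\<^sup>k\<close>. The ideal \<open>I\<^bsub>x\<^sup>\<sigma>\<^sup>^\<^esub>\<close> consists of the fractions \<open>f / (x\<^sup>\<sigma>\<^sup>^)\<^sup>l\<close> with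
  \<open>f \<in> I\<close>.
\<close>

definition local_ideal ::
    "('k \<Rightarrow> (real ^ 'n) set) \<Rightarrow> ('k::finite) cox set \<Rightarrow> (real ^ 'n) set \<Rightarrow>
     (int ^ 'k \<Rightarrow>\<^sub>0 complex) set" where
  "local_ideal \<rho> I \<sigma> =
     {h. \<exists>f\<in>I. \<exists>l. h * push_exponents ivec (xhat \<rho> \<sigma> ^ l) = push_exponents ivec f}"

text \<open>
  The ideal of \<open>V\<^sub>X(I) \<inter> U\<^sub>\<sigma>\<close> in \<open>\<complex>[U\<^sub>\<sigma>] = \<complex>[\<sigma>\<^sup>\<or> \<inter> \<int>\<^sup>n]\<close>: the preimage of \<open>(I\<^bsub>x\<^sup>\<sigma>\<^sup>^\<^esub>)\<^sub>0\<close> under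
  the isomorphism \<open>\<complex>[U\<^sub>\<sigma>] \<simeq> (S\<^bsub>x\<^sup>\<sigma>\<^sup>^\<^esub>)\<^sub>0\<close>, which maps \<open>\<chi>\<^sup>m\<close> to \<open>\<Prod> x\<^sub>i\<^bsup>\<langle>m, u\<^sub>i\<rangle>\<^esup>\<close>.
\<close>

definition chart_ideal ::
    "('k \<Rightarrow> (real ^ 'n) set) \<Rightarrow> ('k::finite) cox set \<Rightarrow> (real ^ 'n) set \<Rightarrow>
     (int ^ 'n \<Rightarrow>\<^sub>0 complex) set" where
  "chart_ideal \<rho> I \<sigma> =
     {g \<in> carrier (monoid_alg (dual_monoid \<sigma>)).
        push_exponents (char_div \<rho>) g \<in> local_ideal \<rho> I \<sigma>}"

text \<open>The coordinate ring of the affine scheme \<open>V\<^sub>X(I) \<inter> U\<^sub>\<sigma>\<close>.\<close>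

definition chart_alg ::
    "('k \<Rightarrow> (real ^ 'n) set) \<Rightarrow> ('k::finite) cox set \<Rightarrow> (real ^ 'n) set \<Rightarrow>
     (complex, (int ^ 'n \<Rightarrow>\<^sub>0 complex) set) module" where
  "chart_alg \<rho> I \<sigma> = quot_alg (monoid_alg (dual_monoid \<sigma>)) (chart_ideal \<rho> I \<sigma>)"

definition scheme_dim ::
    "(real ^ 'n) set set \<Rightarrow> ('k \<Rightarrow> (real ^ 'n) set) \<Rightarrow> ('k::finite) cox set \<Rightarrow> ereal" where
  "scheme_dim \<Sigma> \<rho> I = (SUP \<sigma>\<in>\<Sigma>. krull_dim (chart_alg \<rho> I \<sigma>))"

definition chart_restrict ::
    "('k \<Rightarrow> (real ^ 'n) set) \<Rightarrow> ('k::finite) cox set \<Rightarrow> (real ^ 'n) set \<Rightarrow>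
     (int ^ 'n \<Rightarrow>\<^sub>0 complex) set \<Rightarrow> (int ^ 'n \<Rightarrow>\<^sub>0 complex) set" where
  "chart_restrict \<rho> I \<tau> X =
     (\<Union>g\<in>X. chart_ideal \<rho> I \<tau> +>\<^bsub>monoid_alg (dual_monoid \<tau>)\<^esub> g)"

text \<open>
  \<open>H\<^sup>0(Y, \<O>\<^sub>Y)\<close> for \<open>Y = V\<^sub>X(I)\<close>. Since \<open>Y\<close> is glued from the affine schemes \<open>Y \<inter> U\<^sub>\<sigma>\<close> along the
  affine schemes \<open>Y \<inter> U\<^bsub>\<sigma> \<inter> \<tau>\<^esub>\<close>, a global section of \<open>\<O>\<^sub>Y\<close> is a family of elements of the
  coordinate rings of the \<open>Y \<inter> U\<^sub>\<sigma>\<close> that agree on the overlaps.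
\<close>

definition global_sections ::
    "(real ^ 'n) set set \<Rightarrow> ('k \<Rightarrow> (real ^ 'n) set) \<Rightarrow> ('k::finite) cox set \<Rightarrow>
     (complex, (real ^ 'n) set \<Rightarrow> (int ^ 'n \<Rightarrow>\<^sub>0 complex) set) module" where
  "global_sections \<Sigma> \<rho> I =
     \<lparr>carrier = {s \<in> (\<Pi>\<^sub>E \<sigma>\<in>\<Sigma>. carrier (chart_alg \<rho> I \<sigma>)).
        \<forall>\<sigma>\<in>\<Sigma>. \<forall>\<tau>\<in>\<Sigma>. chart_restrict \<rho> I (\<sigma> \<inter> \<tau>) (s \<sigma>) = chart_restrict \<rho> I (\<sigma> \<inter> \<tau>) (s \<tau>)},
      mult = (\<lambda>s t. \<lambda>\<sigma>\<in>\<Sigma>. s \<sigma> \<otimes>\<^bsub>chart_alg \<rho> I \<sigma>\<^esub> t \<sigma>),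
      one = (\<lambda>\<sigma>\<in>\<Sigma>. \<one>\<^bsub>chart_alg \<rho> I \<sigma>\<^esub>),
      zero = (\<lambda>\<sigma>\<in>\<Sigma>. \<zero>\<^bsub>chart_alg \<rho> I \<sigma>\<^esub>),
      add = (\<lambda>s t. \<lambda>\<sigma>\<in>\<Sigma>. s \<sigma> \<oplus>\<^bsub>chart_alg \<rho> I \<sigma>\<^esub> t \<sigma>),
      smult = (\<lambda>c s. \<lambda>\<sigma>\<in>\<Sigma>. c \<odot>\<^bsub>chart_alg \<rho> I \<sigma>\<^esub> s \<sigma>)\<rparr>"

definition chart_eval ::
    "(int ^ 'n \<Rightarrow> complex) \<Rightarrow> (int ^ 'n \<Rightarrow>\<^sub>0 complex) \<Rightarrow> complex" where
  "chart_eval \<gamma> g = (\<Sum>m\<in>Poly_Mapping.keys g. Poly_Mapping.lookup g m * \<gamma> m)"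

text \<open>The reduced variety \<open>Var\<^sub>X(I)\<close>, as a set of closed points.\<close>

definition subscheme_points ::
    "(real ^ 'n) set set \<Rightarrow> ('k \<Rightarrow> (real ^ 'n) set) \<Rightarrow> ('k::finite) cox set \<Rightarrow>
     'n chart_point set set" where
  "subscheme_points \<Sigma> \<rho> I =
     {\<zeta> \<in> toric_variety \<Sigma>. \<exists>(\<sigma>, \<gamma>)\<in>\<zeta>. \<forall>g\<in>chart_ideal \<rho> I \<sigma>. chart_eval \<gamma> g = 0}"

text \<open>The local ring \<open>\<O>\<^bsub>Y,\<gamma>\<^esub>\<close>: all representatives of a residue class in \<open>\<complex>[Y \<inter> U\<^sub>\<sigma>]\<close> have the
  same value at a point \<open>\<gamma>\<close> of \<open>Y \<inter> U\<^sub>\<sigma>\<close>.\<close>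

definition local_ring ::
    "('k \<Rightarrow> (real ^ 'n) set) \<Rightarrow> ('k::finite) cox set \<Rightarrow> 'n chart_point \<Rightarrow>
     (complex, ((int ^ 'n \<Rightarrow>\<^sub>0 complex) set \<times> (int ^ 'n \<Rightarrow>\<^sub>0 complex) set) set) module" where
  "local_ring \<rho> I = (\<lambda>(\<sigma>, \<gamma>).
     localization (chart_alg \<rho> I \<sigma>)
       {X \<in> carrier (chart_alg \<rho> I \<sigma>). \<forall>g\<in>X. chart_eval \<gamma> g \<noteq> 0})"

text \<open>The local ring at a point of \<open>X\<close> is computed in any chart that contains the point.\<close>

definition multiplicity_at ::
    "('k \<Rightarrow> (real ^ 'n) set) \<Rightarrow> ('k::finite) cox set \<Rightarrow> 'n chart_point set \<Rightarrow> nat" where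
  "multiplicity_at \<rho> I \<zeta> =
     vectorspace.dim complex_field (local_ring \<rho> I (SOME p. p \<in> \<zeta>))"

text \<open>The degree \<open>\<delta>\<^sup>+\<close>, meaningful for zero-dimensional \<open>V\<^sub>X(I)\<close>: then there are finitely many
  points, and the local rings have finite dimension.\<close>

definition scheme_degree ::
    "(real ^ 'n) set set \<Rightarrow> ('k \<Rightarrow> (real ^ 'n) set) \<Rightarrow> ('k::finite) cox set \<Rightarrow> nat" where
  "scheme_degree \<Sigma> \<rho> I = (\<Sum>\<zeta>\<in>subscheme_points \<Sigma> \<rho> I. multiplicity_at \<rho> I \<zeta>)"

section \<open>Basepoints and regularity\<close>

definition basepoint ::
    "(real ^ 'n) set set \<Rightarrow> ('k \<Rightarrow> (real ^ 'n) set) \<Rightarrow> (int ^ ('k::finite)) set \<Rightarrow>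
     'n chart_point set \<Rightarrow> bool" where
  "basepoint \<Sigma> \<rho> \<alpha> \<zeta> \<longleftrightarrow>
     \<zeta> \<in> toric_variety \<Sigma> \<and> (\<forall>f\<in>cox_piece \<rho> \<alpha>. \<zeta> \<in> toric_zeros \<Sigma> \<rho> f)"

definition regularity ::
    "(real ^ 'n) set set \<Rightarrow> ('k \<Rightarrow> (real ^ 'n) set) \<Rightarrow> ('k::finite) cox set \<Rightarrow>
     (int ^ 'k) set set" where
  "regularity \<Sigma> \<rho> I =
     {\<alpha> \<in> class_group \<rho>.
        has_vdim (quot_piece \<rho> I \<alpha>) (scheme_degree \<Sigma> \<rho> I) \<and>
        I \<inter> cox_piece \<rho> \<alpha> =
          saturation cox_ring I (irrelevant_ideal \<Sigma> \<rho>) \<inter> cox_piece \<rho> \<alpha> \<and>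
        (\<forall>\<zeta>\<in>subscheme_points \<Sigma> \<rho> I. \<not> basepoint \<Sigma> \<rho> \<alpha> \<zeta>)}"

end

theory Submission
  imports Defs "HOL-Computational_Algebra.Fundamental_Theorem_Algebra"
begin

text \<open>
  The coordinate rings \<open>A\<^sub>\<sigma>\<close> of the charts of \<open>Y\<close> are finitely generated (Gordan's lemma) and of Krull
  dimension at most 0. Every element of \<open>A\<^sub>\<sigma>\<close> is algebraic over \<open>\<complex>\<close>, because \<open>\<complex>\<close> is uncountable
  while \<open>A\<^sub>\<sigma>\<close> has countable dimension; hence \<open>A\<^sub>\<sigma>\<close> is finite-dimensional and, by the Chinese remainder
  theorem, the product of its local rings at finitely many points. The local ring of a point does not
  change when a chart is replaced by a smaller one, and each point has a smallest chart. Therefore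
  \<open>H\<^sup>0(Y, \<O>\<^sub>Y)\<close> is the product of all local rings of \<open>Y\<close>, of dimension \<open>\<delta>\<^sup>+\<close>, which is also the
  dimension of \<open>(S/I)\<^sub>\<beta>\<close>.
\<close>

section \<open>Commutative algebras over the complex numbers\<close>

text \<open>Only a linear isomorphism is claimed, so two dimensions are compared and no map from the
  Cox ring to sections is built. The obstacle is bookkeeping: a section is a family of cosets, the
  degree is a sum over glueing classes, and each multiplicity is taken in an arbitrarily picked
  chart. Hence no product of local rings is formed. Every ring is handled as a set \<open>B\<close>
  modulo an ideal; the rings of all charts are subsets of one ambient type, so that restriction to a
  smaller chart is literal inclusion. A function that does not vanish at a point is already
  invertible modulo \<open>germ_ker\<close>, so the local ring is \<open>B\<close> modulo
  \<open>germ_ker\<close>, and fractions disappear once the localization has been unfolded.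
  Dimensions enter as tuples of linear coordinate functions, which can be moved between charts and
  concatenated over the points of Y. Algebraic relations are phrased as products of shifts f - c
  because at a point each such factor is a unit or nilpotent: one relation yields values, inverses
  and nilpotency.\<close>

locale complex_algebra =
  fixes C :: "complex \<Rightarrow> 'a::comm_ring_1" and B :: "'a set"
  assumes C_add: "C (x + y) = C x + C y"
    and C_mult: "C (x * y) = C x * C y"
    and C_1: "C 1 = 1"
    and C_B: "C x \<in> B"
    and add_B: "f \<in> B \<Longrightarrow> g \<in> B \<Longrightarrow> f + g \<in> B"
    and mult_B: "f \<in> B \<Longrightarrow> g \<in> B \<Longrightarrow> f * g \<in> B"
begin

lemma C_0: "C 0 = 0"
  using C_add[of 0 0] by simp

lemma C_uminus: "C (- x) = - C x"
  using C_add[of x "- x"] C_0 by (simp add: add_eq_0_iff)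

lemma C_diff: "C (x - y) = C x - C y"
  using C_add[of x "- y"] by (simp add: C_uminus)

lemma one_B: "1 \<in> B"
  using C_B[of 1] by (simp add: C_1)

lemma zero_B: "0 \<in> B"
  using C_B[of 0] by (simp add: C_0)

lemma uminus_B: "f \<in> B \<Longrightarrow> - f \<in> B"
  using mult_B[OF C_B[of "- 1"], of f] by (simp add: C_uminus C_1)

lemma diff_B: "f \<in> B \<Longrightarrow> g \<in> B \<Longrightarrow> f - g \<in> B"
  using add_B[OF _ uminus_B] by fastforce

lemma power_B: "f \<in> B \<Longrightarrow> f ^ n \<in> B"
  by (induction n) (auto intro: one_B mult_B)

lemma sum_B: "(\<And>x. x \<in> A \<Longrightarrow> f x \<in> B) \<Longrightarrow> sum f A \<in> B"
  by (induction A rule: infinite_finite_induct) (auto intro: zero_B add_B)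

lemma prod_B: "(\<And>x. x \<in> A \<Longrightarrow> f x \<in> B) \<Longrightarrow> prod f A \<in> B"
  by (induction A rule: infinite_finite_induct) (auto intro: one_B mult_B)

lemmas closed_B = C_B add_B mult_B one_B zero_B uminus_B diff_B power_B

section \<open>Ideals and prime ideals of a subalgebra\<close>

definition alg_ideal :: "'a set \<Rightarrow> bool" where
  "alg_ideal J \<longleftrightarrow> J \<subseteq> B \<and> 0 \<in> J \<and> (\<forall>x\<in>J. \<forall>y\<in>J. x + y \<in> J) \<and> (\<forall>x\<in>J. \<forall>b\<in>B. b * x \<in> J)"

lemma alg_ideal_mult2: "alg_ideal J \<Longrightarrow> x \<in> J \<Longrightarrow> b \<in> B \<Longrightarrow> x * b \<in> J"
  by (metis alg_ideal_def mult.commute)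

lemma alg_idealD:
  assumes "alg_ideal J"
  shows "J \<subseteq> B" "0 \<in> J" "x \<in> J \<Longrightarrow> y \<in> J \<Longrightarrow> x + y \<in> J" "x \<in> J \<Longrightarrow> b \<in> B \<Longrightarrow> b * x \<in> J"
    "x \<in> J \<Longrightarrow> b \<in> B \<Longrightarrow> x * b \<in> J"
  using assms alg_ideal_mult2 unfolding alg_ideal_def by auto

lemma alg_ideal_uminus: "alg_ideal J \<Longrightarrow> x \<in> J \<Longrightarrow> - x \<in> J"
  using alg_idealD(4)[of J x "C (- 1)"] C_B[of "- 1"] by (simp add: C_uminus C_1)

lemma alg_ideal_diff: "alg_ideal J \<Longrightarrow> x \<in> J \<Longrightarrow> y \<in> J \<Longrightarrow> x - y \<in> J"
  using alg_idealD(3)[of J x "- y"] alg_ideal_uminus by simp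

lemma alg_ideal_sum: "alg_ideal J \<Longrightarrow> (\<And>x. x \<in> A \<Longrightarrow> f x \<in> J) \<Longrightarrow> sum f A \<in> J"
  by (induction A rule: infinite_finite_induct) (auto intro: alg_idealD)

definition alg_prime :: "'a set \<Rightarrow> bool" where
  "alg_prime P \<longleftrightarrow> alg_ideal P \<and> 1 \<notin> P \<and> (\<forall>a\<in>B. \<forall>b\<in>B. a * b \<in> P \<longrightarrow> a \<in> P \<or> b \<in> P)"

text \<open>Supplies the larger ideals against which maximality is tested.\<close>

lemma alg_ideal_add_principal:
  assumes "alg_ideal P" "a \<in> B"
  shows "alg_ideal {p + b * a | p b. p \<in> P \<and> b \<in> B}"
proof -
  have "0 \<in> {p + b * a | p b. p \<in> P \<and> b \<in> B}"
    using alg_idealD(2)[OF assms(1)] zero_B by force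
  moreover have "{p + b * a | p b. p \<in> P \<and> b \<in> B} \<subseteq> B"
    using assms by (auto intro: closed_B dest: alg_idealD)
  moreover have "x + y \<in> {p + b * a | p b. p \<in> P \<and> b \<in> B}"
    if "x \<in> {p + b * a | p b. p \<in> P \<and> b \<in> B}" "y \<in> {p + b * a | p b. p \<in> P \<and> b \<in> B}" for x y
  proof -
    from that obtain p b p' b' where "x = p + b * a" "y = p' + b' * a" "p \<in> P" "b \<in> B" "p' \<in> P" "b' \<in> B"
      by blast
    then have "x + y = (p + p') + (b + b') * a" "p + p' \<in> P" "b + b' \<in> B"
      using assms(1) by (auto simp: algebra_simps intro: closed_B alg_idealD)
    then show ?thesis by blast
  qed
  moreover have "c * x \<in> {p + b * a | p b. p \<in> P \<and> b \<in> B}"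
    if "x \<in> {p + b * a | p b. p \<in> P \<and> b \<in> B}" "c \<in> B" for x c
  proof -
    from that obtain p b where "x = p + b * a" "p \<in> P" "b \<in> B"
      by blast
    then have "c * x = c * p + (c * b) * a" "c * p \<in> P" "c * b \<in> B"
      using assms(1) that by (auto simp: algebra_simps intro: closed_B alg_idealD)
    then show ?thesis by blast
  qed
  ultimately show ?thesis unfolding alg_ideal_def by (intro conjI ballI)
qed

text \<open>An ideal that is maximal among those disjoint from a multiplicative set is prime. The
  maximality stays in the conclusion because with \<open>W = {1}\<close> it produces maximal
  ideals.\<close>

lemma prime_avoiding:
  assumes J: "alg_ideal J" and W: "W \<subseteq> B" "1 \<in> W" "\<And>a b. a \<in> W \<Longrightarrow> b \<in> W \<Longrightarrow> a * b \<in> W"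
    and JW: "J \<inter> W = {}"
  obtains P where "alg_prime P" "J \<subseteq> P" "P \<inter> W = {}"
    "\<And>Q. alg_ideal Q \<Longrightarrow> P \<subseteq> Q \<Longrightarrow> Q \<inter> W = {} \<Longrightarrow> Q = P"
proof -
  let ?S = "{Q. alg_ideal Q \<and> J \<subseteq> Q \<and> Q \<inter> W = {}}"
  have "\<exists>P\<in>?S. \<forall>Q\<in>?S. P \<subseteq> Q \<longrightarrow> Q = P"
  proof (rule subset_Zorn_nonempty)
    show "?S \<noteq> {}" using J JW by blast
    fix \<C> assume ne: "\<C> \<noteq> {}" and ch: "subset.chain ?S \<C>"
    have sub: "Q \<in> \<C> \<Longrightarrow> alg_ideal Q \<and> J \<subseteq> Q \<and> Q \<inter> W = {}" for Q
      using ch unfolding subset.chain_def by blast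
    have lin: "Q \<in> \<C> \<Longrightarrow> Q' \<in> \<C> \<Longrightarrow> Q \<subseteq> Q' \<or> Q' \<subseteq> Q" for Q Q'
      using ch unfolding subset_chain_def by blast
    have "alg_ideal (\<Union>\<C>)"
      unfolding alg_ideal_def
    proof (intro conjI ballI)
      show "\<Union>\<C> \<subseteq> B" using sub alg_idealD(1) by blast
      show "0 \<in> \<Union>\<C>" using sub ne alg_idealD(2) by blast
      show "x + y \<in> \<Union>\<C>" if xy: "x \<in> \<Union>\<C>" "y \<in> \<Union>\<C>" for x y
      proof -
        obtain Q Q' where Q: "Q \<in> \<C>" "x \<in> Q" "Q' \<in> \<C>" "y \<in> Q'" using xy by blast
        then obtain R where "R \<in> \<C>" "x \<in> R" "y \<in> R" using lin[of Q Q'] by blast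
        then show ?thesis using sub alg_idealD(3) by blast
      qed
      show "b * x \<in> \<Union>\<C>" if "x \<in> \<Union>\<C>" "b \<in> B" for x b
        using that sub alg_idealD(4) by blast
    qed
    then show "\<Union>\<C> \<in> ?S" using sub ne by blast
  qed
  then obtain P where PS: "P \<in> ?S" and mx: "\<forall>Q\<in>?S. P \<subseteq> Q \<longrightarrow> Q = P" ..
  from PS have P: "alg_ideal P" "J \<subseteq> P" "P \<inter> W = {}" by simp_all
  have max: "Q = P" if "alg_ideal Q" "P \<subseteq> Q" "Q \<inter> W = {}" for Q
    using mx that P(2) by simp
  \<comment> \<open>If \<open>a\<close> lies outside \<open>P\<close>, the larger ideal P + B a can
    no longer be disjoint from \<open>W\<close>.\<close>
  have meet: "\<exists>p\<in>P. \<exists>b\<in>B. p + b * a \<in> W" if "a \<in> B" "a \<notin> P" for a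
  proof (rule ccontr)
    assume n: "\<not> ?thesis"
    let ?Q = "{p + b * a | p b. p \<in> P \<and> b \<in> B}"
    have "P \<subseteq> ?Q" using zero_B by force
    moreover have "?Q \<inter> W = {}" using n by blast
    moreover have "alg_ideal ?Q" by (rule alg_ideal_add_principal[OF P(1) that(1)])
    ultimately have "?Q = P" using max by blast
    moreover have "a \<in> ?Q" using alg_idealD(2)[OF P(1)] one_B by force
    ultimately show False using that by blast
  qed
  have "alg_prime P"
    unfolding alg_prime_def
  proof (intro conjI ballI impI)
    show "alg_ideal P" by fact
    show "1 \<notin> P" using P(3) W(2) by blast
    fix a b assume ab: "a \<in> B" "b \<in> B" "a * b \<in> P"
    show "a \<in> P \<or> b \<in> P"
    proof (rule ccontr)
      assume "\<not> (a \<in> P \<or> b \<in> P)"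
      then obtain p c q d where pc: "p \<in> P" "c \<in> B" "p + c * a \<in> W" "q \<in> P" "d \<in> B" "q + d * b \<in> W"
        using meet ab by blast
      \<comment> \<open>Each summand contains \<open>p\<close>, \<open>q\<close> or
        \<open>a * b\<close>, so this product of two elements of \<open>W\<close> falls into
        \<open>P\<close>.\<close>
      have "(p + c * a) * (q + d * b) = (q + d * b) * p + (c * a) * q + (c * d) * (a * b)"
        by (simp add: algebra_simps)
      also have "\<dots> \<in> P"
      proof -
        have "q + d * b \<in> B" "c * a \<in> B" "c * d \<in> B" using pc ab W(1) by (auto intro: mult_B)
        then show ?thesis using alg_idealD(3,4)[OF P(1)] pc ab by meson
      qed
      finally show False using W(3)[OF pc(3,6)] P(3) by blast
    qed
  qed
  then show ?thesis using P(2,3) max by (rule that)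
qed

text \<open>The value at \<open>f\<close> of the monic polynomial with root list \<open>cs\<close>.
  As complex polynomials split, \<open>f\<close> is algebraic modulo an ideal exactly when some such
  value lies in it.\<close>

definition shifts :: "'a \<Rightarrow> complex list \<Rightarrow> 'a" where
  "shifts f cs = prod_list (map (\<lambda>c. f - C c) cs)"

lemma shifts_simps: "shifts f [] = 1" "shifts f (c # cs) = (f - C c) * shifts f cs"
  by (simp_all add: shifts_def)

lemma shifts_append: "shifts f (cs @ ds) = shifts f cs * shifts f ds"
  by (simp add: shifts_def)

lemma shifts_B: "f \<in> B \<Longrightarrow> shifts f cs \<in> B"
  by (induction cs) (auto simp: shifts_simps intro: closed_B)

section \<open>Polynomials evaluated in the algebra\<close>

definition poly_at :: "'a \<Rightarrow> complex poly \<Rightarrow> 'a" where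
  "poly_at f p = poly (map_poly C p) f"

lemma poly_at_pCons: "poly_at f (pCons a p) = C a + f * poly_at f p"
  by (simp add: poly_at_def map_poly_pCons C_0)

lemma poly_at_0: "poly_at f 0 = 0"
  by (simp add: poly_at_def)

lemma poly_at_add: "poly_at f (p + q) = poly_at f p + poly_at f q"
  by (induction p q rule: poly_induct2) (simp_all add: poly_at_pCons poly_at_0 C_add algebra_simps)

lemma poly_at_smult: "poly_at f (Polynomial.smult a p) = C a * poly_at f p"
  by (induction p) (simp_all add: poly_at_pCons poly_at_0 C_mult algebra_simps)

lemma poly_at_mult: "poly_at f (p * q) = poly_at f p * poly_at f q"
  by (induction p)
    (simp_all add: poly_at_pCons poly_at_0 poly_at_add poly_at_smult C_0 algebra_simps)

lemma poly_at_1: "poly_at f 1 = 1"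
  by (simp add: one_pCons poly_at_pCons poly_at_0 C_1)

lemma poly_at_sum: "poly_at f (sum p A) = (\<Sum>x\<in>A. poly_at f (p x))"
  by (induction A rule: infinite_finite_induct) (simp_all add: poly_at_0 poly_at_add)

lemma poly_at_prod: "poly_at f (prod p A) = (\<Prod>x\<in>A. poly_at f (p x))"
  by (induction A rule: infinite_finite_induct) (simp_all add: poly_at_1 poly_at_mult)

lemma poly_at_linear: "poly_at f [:- c, 1:] = f - C c"
  by (simp add: poly_at_pCons poly_at_0 C_1 C_uminus)

text \<open>Roots are split off one at a time by the fundamental theorem of algebra;
  \<open>k\<close> is the leading coefficient.\<close>

lemma poly_at_factored:
  "p \<noteq> 0 \<Longrightarrow> \<exists>k cs. k \<noteq> 0 \<and> poly_at f p = C k * shifts f cs"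
proof (induction "degree p" arbitrary: p)
  case 0
  then obtain k where "p = [:k:]" by (metis degree_eq_zeroE)
  then show ?case using 0(2)
    by (intro exI[of _ k] exI[of _ "[]"]) (simp add: poly_at_pCons poly_at_0 shifts_simps)
next
  case (Suc n)
  then have "\<not> constant (poly p)" by (simp add: constant_degree)
  then obtain c where "poly p c = 0" using fundamental_theorem_of_algebra by blast
  then obtain q where q: "p = [:- c, 1:] * q" by (auto simp: poly_eq_0_iff_dvd dvd_def)
  have "q \<noteq> 0" using q Suc.prems by auto
  moreover from this have "degree p = Suc (degree q)"
    unfolding q by (subst degree_mult_eq) auto
  ultimately have "n = degree q" "q \<noteq> 0" using Suc.hyps(2) by simp_all
  then obtain k cs where "k \<noteq> 0" "poly_at f q = C k * shifts f cs"
    using Suc.hyps(1)[of q] by blast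
  then show ?case
    by (intro exI[of _ k] exI[of _ "c # cs"])
      (simp add: q poly_at_mult poly_at_linear shifts_simps mult.left_commute del: mult_pCons_left)
qed

end

text \<open>Gaussian elimination: each equation is solved for an unknown with nonzero coefficient,
  which costs one unknown, so at least one remains free at the end.\<close>

lemma homogeneous_system_nontrivial:
  fixes a :: "'c \<Rightarrow> 'm \<Rightarrow> 'f::field"
  assumes "finite F" "finite Z" "card Z > card F"
  shows "\<exists>x. (\<exists>c\<in>Z. x c \<noteq> 0) \<and> (\<forall>m\<in>F. (\<Sum>c\<in>Z. x c * a c m) = 0)"
  using assms
proof (induction F arbitrary: Z a rule: finite_induct)
  case empty
  then show ?case by (intro exI[of _ "\<lambda>_. 1"]) (auto simp: card_gt_0_iff)
next
  case (insert m F)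
  show ?case
  proof (cases "\<exists>c\<in>Z. a c m \<noteq> 0")
    case False
    have "card Z > card F" using insert by simp
    then obtain x where "\<exists>c\<in>Z. x c \<noteq> 0" "\<forall>m\<in>F. (\<Sum>c\<in>Z. x c * a c m) = 0"
      using insert.IH[of Z a] insert.prems by blast
    then show ?thesis using False by (intro exI[of _ x]) simp
  next
    case True
    then obtain c0 where c0: "c0 \<in> Z" "a c0 m \<noteq> 0" by blast
    \<comment> \<open>The coefficients left after equation \<open>m\<close>, solved for the unknown
      at \<open>c0\<close>, is substituted into the others.\<close>
    define a' where "a' c j = a c j - a c m / a c0 m * a c0 j" for c j
    have "card (Z - {c0}) > card F" using insert c0 by simp
    then obtain x where x: "\<exists>c\<in>Z - {c0}. x c \<noteq> 0"
      "\<forall>j\<in>F. (\<Sum>c\<in>Z - {c0}. x c * a' c j) = 0"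
      using insert.IH[of "Z - {c0}" a'] insert.prems by auto
    \<comment> \<open>The value at \<open>c0\<close> is the one that equation \<open>m\<close>
      forces.\<close>
    define y where "y = x(c0 := - (\<Sum>c\<in>Z - {c0}. x c * a c m) / a c0 m)"
    have split: "(\<Sum>c\<in>Z. y c * a c j) = y c0 * a c0 j + (\<Sum>c\<in>Z - {c0}. x c * a c j)" for j
      by (subst sum.remove[OF insert.prems(1) c0(1)]) (auto simp: y_def intro!: sum.cong)
    have "(\<Sum>c\<in>Z. y c * a c j) = 0" if "j \<in> F" for j
    proof -
      have "0 = (\<Sum>c\<in>Z - {c0}. x c * a c j - x c * a c m * (a c0 j / a c0 m))"
        using x(2) that unfolding a'_def by (simp add: algebra_simps)
      also have "\<dots> = (\<Sum>c\<in>Z - {c0}. x c * a c j) - (\<Sum>c\<in>Z - {c0}. x c * a c m) * (a c0 j / a c0 m)"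
        by (simp only: sum_subtractf sum_distrib_right)
      finally show ?thesis unfolding split by (simp add: y_def)
    qed
    moreover have "(\<Sum>c\<in>Z. y c * a c m) = 0"
      unfolding split using c0 by (simp add: y_def)
    moreover have "\<exists>c\<in>Z. y c \<noteq> 0" using x(1) by (auto simp: y_def)
    ultimately show ?thesis by (intro exI[of _ y]) simp
  qed
qed

lemma uncountable_UNIV_complex: "uncountable (UNIV :: complex set)"
proof
  assume "countable (UNIV :: complex set)"
  then have "countable (range Re)" by (rule countable_image)
  moreover have "range Re = UNIV" by (metis Re_complex_of_real surj_def)
  ultimately show False using uncountable_UNIV_real by simp
qed

context complex_algebra
begin

lemma C_sum: "C (sum f A) = (\<Sum>x\<in>A. C (f x))"
  by (induction A rule: infinite_finite_induct) (simp_all add: C_0 C_add)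

text \<open>If no product of shifts of \<open>f\<close> lies in \<open>J\<close>, then \<open>f\<close> is transcendental in the residue field
  of some maximal ideal. That field has countable dimension over \<open>\<complex>\<close>, although the uncountably
  many inverses of the \<open>f - c\<close> are linearly independent.\<close>

lemma algebraic_if_zero_dim:
  assumes J: "alg_ideal J" and M: "countable M"
    and span: "\<And>b. b \<in> B \<Longrightarrow> \<exists>F a. finite F \<and> F \<subseteq> M \<and> b = (\<Sum>m\<in>F. C (a m) * m)"
    and dim0: "\<And>P Q. alg_prime P \<Longrightarrow> alg_prime Q \<Longrightarrow> J \<subseteq> P \<Longrightarrow> P \<subseteq> Q \<Longrightarrow> P = Q"
    and f: "f \<in> B"
  shows "\<exists>cs. shifts f cs \<in> J"
proof (rule ccontr)
  assume no: "\<nexists>cs. shifts f cs \<in> J"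
  let ?W = "range (shifts f)"
  have W: "?W \<subseteq> B" "1 \<in> ?W" "J \<inter> ?W = {}"
    using no shifts_B[OF f] shifts_simps(1) by (auto intro: range_eqI[of _ _ "[]"])
  have Wm: "a * b \<in> ?W" if "a \<in> ?W" "b \<in> ?W" for a b
    using that by (auto simp: shifts_append[symmetric])
  obtain P where P: "alg_prime P" "J \<subseteq> P" "P \<inter> ?W = {}"
    by (rule prime_avoiding[OF J W(1,2) Wm W(3)])
  have PI: "alg_ideal P" and P1: "1 \<notin> P" using P(1) by (auto simp: alg_prime_def)
  have inv: "\<exists>g\<in>B. (f - C c) * g - 1 \<in> P" for c
  proof -
    have "shifts f [c] \<notin> P" using P(3) by blast
    then have nP: "f - C c \<notin> P" by (simp add: shifts_simps)
    have fc: "f - C c \<in> B" using f by (intro diff_B C_B)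
    \<comment> \<open>\<open>Q\<close> is a maximal ideal above \<open>P\<close>. Dimension zero
      identifies the two, so that everything outside \<open>P\<close> becomes invertible modulo
      \<open>P\<close>.\<close>
    obtain Q where Q: "alg_prime Q" "P \<subseteq> Q"
      and max: "\<And>R. alg_ideal R \<Longrightarrow> Q \<subseteq> R \<Longrightarrow> R \<inter> {1} = {} \<Longrightarrow> R = Q"
      by (rule prime_avoiding[OF PI, of "{1}"]) (use P1 one_B in auto)
    have PQ: "P = Q" by (rule dim0[OF P(1) Q(1) P(2) Q(2)])
    let ?R = "{p + b * (f - C c) | p b. p \<in> P \<and> b \<in> B}"
    have R: "alg_ideal ?R" by (rule alg_ideal_add_principal[OF PI fc])
    have PR: "P \<subseteq> ?R" using zero_B by force
    have fR: "f - C c \<in> ?R" using alg_idealD(2)[OF PI] one_B by force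
    have "1 \<in> ?R"
    proof (rule ccontr)
      assume "1 \<notin> ?R"
      then have "?R \<inter> {1} = {}" by auto
      then have "?R = Q" using max[OF R] PR unfolding PQ[symmetric] by metis
      then show False using fR nP unfolding PQ[symmetric] by metis
    qed
    then obtain p b where "1 = p + b * (f - C c)" and pb: "p \<in> P" "b \<in> B" by blast
    then have "(f - C c) * b - 1 = - p" by (simp add: algebra_simps)
    then show ?thesis using alg_ideal_uminus[OF PI pb(1)] pb(2) by metis
  qed
  obtain g where g: "\<And>c. g c \<in> B" "\<And>c. (f - C c) * g c - 1 \<in> P" using inv by metis
  obtain F a where Fa: "\<And>c. finite (F c)" "\<And>c. F c \<subseteq> M" "\<And>c. g c = (\<Sum>m\<in>F c. C (a c m) * m)"
    using span[OF g(1)] by metis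
  \<comment> \<open>Pigeonhole: \<open>M\<close> has only countably many finite subsets, but there
    are uncountably many scalars \<open>c\<close>.\<close>
  have "\<exists>F0. infinite {c. F c = F0}"
  proof (rule ccontr)
    assume "\<nexists>F0. infinite {c. F c = F0}"
    moreover have "countable (range F)"
      by (rule countable_subset[OF _ countable_Collect_finite_subset[OF M]]) (use Fa in auto)
    ultimately have "countable (\<Union>F0\<in>range F. {c. F c = F0})"
      by (intro countable_UN) (auto intro: countable_finite)
    moreover have "(\<Union>F0\<in>range F. {c. F c = F0}) = UNIV" by blast
    ultimately show False using uncountable_UNIV_complex by simp
  qed
  then obtain F0 where inf: "infinite {c. F c = F0}" ..
  \<comment> \<open>One index more than \<open>F0\<close> has elements forces a linear relation
    among the inverses \<open>g c\<close>.\<close>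
  obtain Z where Z: "finite Z" "card Z = Suc (card F0)" "Z \<subseteq> {c. F c = F0}"
    using infinite_arbitrarily_large[OF inf] by blast
  have FZ: "F c = F0" if "c \<in> Z" for c using that Z by blast
  have "Z \<noteq> {}" using Z by auto
  then have "finite F0" using FZ Fa(1) by blast
  then obtain x where x: "\<exists>c\<in>Z. x c \<noteq> 0" "\<And>m. m \<in> F0 \<Longrightarrow> (\<Sum>c\<in>Z. x c * a c m) = 0"
    using homogeneous_system_nontrivial[of F0 Z a] Z by auto
  then obtain c0 where c0: "c0 \<in> Z" "x c0 \<noteq> 0" by blast
  have "(\<Sum>c\<in>Z. C (x c) * g c) = (\<Sum>c\<in>Z. \<Sum>m\<in>F0. C (x c * a c m) * m)"
    by (intro sum.cong refl) (simp add: Fa(3) FZ sum_distrib_left C_mult mult.assoc)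
  also have "\<dots> = (\<Sum>m\<in>F0. C (\<Sum>c\<in>Z. x c * a c m) * m)"
    by (subst sum.swap) (simp add: C_sum sum_distrib_right)
  also have "\<dots> = 0" using x(2) by (simp add: C_0)
  finally have lin: "(\<Sum>c\<in>Z. C (x c) * g c) = 0" .
  \<comment> \<open>The numerator of the sum of the fractions x c / (t - c). At t =
    \<open>c0\<close> only the summand of \<open>c0\<close> survives, so this polynomial is not
    zero.\<close>
  define p where "p = (\<Sum>c\<in>Z. Polynomial.smult (x c) (\<Prod>c'\<in>Z - {c}. [:- c', 1:]))"
  have "poly p c0 = (\<Sum>c\<in>Z. x c * (\<Prod>c'\<in>Z - {c}. c0 - c'))"
    by (simp add: p_def poly_sum poly_prod)
  also have "\<dots> = x c0 * (\<Prod>c'\<in>Z - {c0}. c0 - c') + (\<Sum>c\<in>Z - {c0}. x c * (\<Prod>c'\<in>Z - {c}. c0 - c'))"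
    by (rule sum.remove[OF Z(1) c0(1)])
  also have "(\<Sum>c\<in>Z - {c0}. x c * (\<Prod>c'\<in>Z - {c}. c0 - c')) = 0"
    using Z(1) c0(1) by (intro sum.neutral) (auto simp: prod_zero_iff)
  finally have "poly p c0 \<noteq> 0" using c0 Z(1) by auto
  then have "p \<noteq> 0" by auto
  define D where "D c = (\<Prod>c'\<in>Z - {c}. f - C c')" for c
  define E where "E = (\<Prod>c\<in>Z. f - C c)"
  have DB: "D c \<in> B" for c unfolding D_def by (intro prod_B diff_B f C_B)
  have ED: "E = (f - C c) * D c" if "c \<in> Z" for c
    unfolding E_def D_def by (rule prod.remove[OF Z(1) that])
  have "poly_at f p = (\<Sum>c\<in>Z. C (x c) * D c)"
    by (simp add: p_def poly_at_sum poly_at_smult poly_at_prod poly_at_linear D_def)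
  \<comment> \<open>Modulo \<open>P\<close> the product \<open>D c\<close> equals
    \<open>g c * E\<close>, because \<open>g c\<close> inverts the missing factor; the relation
    \<open>lin\<close> then makes the whole sum vanish modulo \<open>P\<close>.\<close>
  also have "\<dots> = (\<Sum>c\<in>Z. C (x c) * D c - C (x c) * g c * E) + (\<Sum>c\<in>Z. C (x c) * g c) * E"
    by (simp add: sum_subtractf sum_distrib_right)
  also have "\<dots> = (\<Sum>c\<in>Z. C (x c) * D c - C (x c) * g c * E)"
    by (simp add: lin)
  also have "\<dots> \<in> P"
  proof (rule alg_ideal_sum[OF PI])
    fix c assume "c \<in> Z"
    then have "C (x c) * D c - C (x c) * g c * E = - (C (x c) * D c) * ((f - C c) * g c - 1)"
      by (simp add: ED algebra_simps)
    then show "C (x c) * D c - C (x c) * g c * E \<in> P"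
      using alg_idealD(4)[OF PI g(2), of "- (C (x c) * D c)" c] DB by (simp add: closed_B)
  qed
  finally have pP: "poly_at f p \<in> P" .
  obtain k cs where k: "k \<noteq> 0" "poly_at f p = C k * shifts f cs"
    using poly_at_factored[OF \<open>p \<noteq> 0\<close>] by blast
  have "shifts f cs = C (1 / k) * poly_at f p"
    using k by (simp add: k(2) mult.assoc[symmetric] C_mult[symmetric] C_1)
  then have "shifts f cs \<in> P" using alg_idealD(4)[OF PI pP C_B] by metis
  then show False using P(3) by blast
qed

section \<open>Characters, and constant terms of split polynomials\<close>

definition alg_character :: "('a \<Rightarrow> complex) \<Rightarrow> bool" where
  "alg_character \<phi> \<longleftrightarrow> (\<forall>x. \<phi> (C x) = x) \<and>
     (\<forall>f\<in>B. \<forall>g\<in>B. \<phi> (f + g) = \<phi> f + \<phi> g \<and> \<phi> (f * g) = \<phi> f * \<phi> g)"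

lemma alg_characterD:
  assumes "alg_character \<phi>"
  shows "\<phi> (C x) = x" "\<phi> 1 = 1" "\<phi> 0 = 0"
    "f \<in> B \<Longrightarrow> g \<in> B \<Longrightarrow> \<phi> (f + g) = \<phi> f + \<phi> g"
    "f \<in> B \<Longrightarrow> g \<in> B \<Longrightarrow> \<phi> (f * g) = \<phi> f * \<phi> g"
    "f \<in> B \<Longrightarrow> \<phi> (f ^ n) = \<phi> f ^ n"
    "f \<in> B \<Longrightarrow> g \<in> B \<Longrightarrow> \<phi> (f - g) = \<phi> f - \<phi> g"
proof -
  show C: "\<phi> (C x) = x" for x using assms by (simp add: alg_character_def)
  show 1: "\<phi> 1 = 1" using C[of 1] by (simp add: C_1)
  show "\<phi> 0 = 0" using C[of 0] by (simp add: C_0)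
  show add: "f \<in> B \<Longrightarrow> g \<in> B \<Longrightarrow> \<phi> (f + g) = \<phi> f + \<phi> g" for f g
    using assms by (simp add: alg_character_def)
  show mult: "f \<in> B \<Longrightarrow> g \<in> B \<Longrightarrow> \<phi> (f * g) = \<phi> f * \<phi> g" for f g
    using assms by (simp add: alg_character_def)
  show "f \<in> B \<Longrightarrow> \<phi> (f ^ n) = \<phi> f ^ n"
    by (induction n) (simp_all add: 1 mult power_B)
  show "\<phi> (f - g) = \<phi> f - \<phi> g" if "f \<in> B" "g \<in> B"
    using add[OF diff_B[OF that] that(2)] by simp
qed

lemma alg_character_sum:
  "alg_character \<phi> \<Longrightarrow> (\<And>x. x \<in> A \<Longrightarrow> f x \<in> B) \<Longrightarrow> \<phi> (sum f A) = (\<Sum>x\<in>A. \<phi> (f x))"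
  by (induction A rule: infinite_finite_induct) (simp_all add: alg_characterD sum_B)

lemma alg_character_shifts:
  "alg_character \<phi> \<Longrightarrow> f \<in> B \<Longrightarrow> \<phi> (shifts f cs) = (\<Prod>c\<leftarrow>cs. \<phi> f - c)"
  by (induction cs) (simp_all add: shifts_simps alg_characterD closed_B shifts_B)

text \<open>A polynomial is its constant term plus a multiple of the variable. When the constant
  term is nonzero, such a relation provides an inverse of \<open>f\<close>.\<close>

lemma shifts_expand:
  assumes "f \<in> B"
  shows "\<exists>r\<in>B. shifts f cs = C (\<Prod>c\<leftarrow>cs. - c) + f * r"
proof (induction cs)
  case Nil
  show ?case using zero_B by (intro bexI[of _ 0]) (simp_all add: shifts_simps C_1)
next
  case (Cons c cs)
  then obtain r where r: "r \<in> B" "shifts f cs = C (\<Prod>c\<leftarrow>cs. - c) + f * r" by blast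
  have "shifts f (c # cs) = C (\<Prod>c\<leftarrow>c # cs. - c) + f * (shifts f cs - C c * r)"
    by (simp add: shifts_simps r(2) C_mult C_uminus algebra_simps)
  then show ?case using r(1) assms by (metis diff_B mult_B C_B shifts_B)
qed

text \<open>Collecting the root 0 leaves a cofactor whose constant term is nonzero.\<close>

lemma shifts_filter_nonzero:
  "\<exists>k. shifts f cs = f ^ k * shifts f (filter (\<lambda>c. c \<noteq> 0) cs)"
proof (induction cs)
  case (Cons c cs)
  then obtain k where "shifts f cs = f ^ k * shifts f (filter (\<lambda>c. c \<noteq> 0) cs)" by blast
  then show ?case
    by (cases "c = 0")
      (auto simp: shifts_simps C_0 mult.left_commute intro: exI[of _ "Suc k"] exI[of _ k])
qed (auto simp: shifts_simps intro: exI[of _ 0])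

end

section \<open>Points and germs of a quotient in which every element is algebraic\<close>

locale algebraic_quotient = complex_algebra +
  fixes J :: "'a set"
  assumes ideal_J: "alg_ideal J"
    and algebraic: "f \<in> B \<Longrightarrow> \<exists>cs. shifts f cs \<in> J"
begin

definition point :: "('a \<Rightarrow> complex) \<Rightarrow> bool" where
  "point \<phi> \<longleftrightarrow> alg_character \<phi> \<and> (\<forall>f\<in>J. \<phi> f = 0)"

lemma point_character: "point \<phi> \<Longrightarrow> alg_character \<phi>"
  by (simp add: point_def)

text \<open>The kernel of the map from \<open>B\<close> to the local ring of \<open>B / J\<close> at the point \<open>\<phi>\<close>.\<close>

definition germ_ker :: "('a \<Rightarrow> complex) \<Rightarrow> 'a set" where
  "germ_ker \<phi> = {f \<in> B. \<exists>u\<in>B. \<phi> u \<noteq> 0 \<and> u * f \<in> J}"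

text \<open>A weak Nullstellensatz. A prime ideal \<open>M\<close> above \<open>Q\<close> contains a
  product of shifts of each \<open>f\<close>, hence one factor f - c, and this c is the value of the
  point at \<open>f\<close>.\<close>

lemma point_exists:
  assumes Q: "alg_ideal Q" "J \<subseteq> Q" "1 \<notin> Q"
  obtains \<phi> where "point \<phi>" "\<And>f. f \<in> Q \<Longrightarrow> \<phi> f = 0"
proof -
  obtain M where M: "alg_prime M" "Q \<subseteq> M"
    by (rule prime_avoiding[OF Q(1), of "{1}"]) (use Q(3) one_B in auto)
  have MI: "alg_ideal M" and M1: "1 \<notin> M"
    and Mp: "\<And>a b. a \<in> B \<Longrightarrow> b \<in> B \<Longrightarrow> a * b \<in> M \<Longrightarrow> a \<in> M \<or> b \<in> M"
    using M(1) by (auto simp: alg_prime_def)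
  have ex: "\<exists>c. f - C c \<in> M" if f: "f \<in> B" for f
  proof -
    have "shifts f cs \<in> M \<Longrightarrow> \<exists>c. f - C c \<in> M" for cs
    proof (induction cs)
      case Nil
      then show ?case using M1 by (simp add: shifts_simps)
    next
      case (Cons c cs)
      then show ?case using Mp[of "f - C c" "shifts f cs"] f
        by (auto simp: shifts_simps closed_B shifts_B)
    qed
    then show ?thesis using algebraic[OF f] Q(2) M(2) by blast
  qed
  \<comment> \<open>Two different values would put a nonzero constant, hence 1, into
    \<open>M\<close>.\<close>
  have uniq: "c = d" if "f - C c \<in> M" "f - C d \<in> M" for f c d
  proof (rule ccontr)
    assume "c \<noteq> d"
    have "C (c - d) \<in> M" using alg_ideal_diff[OF MI that(2,1)] by (simp add: C_diff)
    from alg_idealD(4)[OF MI this C_B[of "1 / (c - d)"]] \<open>c \<noteq> d\<close> M1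
    show False by (simp add: C_mult[symmetric] C_1)
  qed
  define \<phi> where "\<phi> f = (THE c. f - C c \<in> M)" for f
  have \<phi>I: "\<phi> f = c" if "f - C c \<in> M" for f c
    unfolding \<phi>_def using that uniq by blast
  have \<phi>M: "f - C (\<phi> f) \<in> M" if "f \<in> B" for f using ex[OF that] \<phi>I by metis
  have "alg_character \<phi>"
    unfolding alg_character_def
  proof (intro conjI allI ballI)
    show "\<phi> (C x) = x" for x by (rule \<phi>I) (simp add: alg_idealD(2)[OF MI])
    fix f g assume fg: "f \<in> B" "g \<in> B"
    have "(f + g) - C (\<phi> f + \<phi> g) = (f - C (\<phi> f)) + (g - C (\<phi> g))"
      by (simp add: C_add)
    then show "\<phi> (f + g) = \<phi> f + \<phi> g"
      using \<phi>I alg_idealD(3)[OF MI] \<phi>M fg by metis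
    have "f * g - C (\<phi> f * \<phi> g) = g * (f - C (\<phi> f)) + C (\<phi> f) * (g - C (\<phi> g))"
      by (simp add: C_mult algebra_simps)
    then show "\<phi> (f * g) = \<phi> f * \<phi> g"
      using \<phi>I alg_idealD(3,4)[OF MI] \<phi>M fg C_B by metis
  qed
  moreover have "\<phi> f = 0" if "f \<in> Q" for f using that M(2) by (intro \<phi>I) (auto simp: C_0)
  ultimately show ?thesis using that Q(2) unfolding point_def by blast
qed

context
  fixes \<phi> assumes \<phi>: "point \<phi>"
begin

lemmas \<phi>_char = point_character[OF \<phi>]

lemma germ_ker_ideal: "alg_ideal (germ_ker \<phi>)"
  unfolding alg_ideal_def
proof (intro conjI ballI)
  show "germ_ker \<phi> \<subseteq> B" by (auto simp: germ_ker_def)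
  show "0 \<in> germ_ker \<phi>"
    using zero_B one_B alg_idealD(2)[OF ideal_J] alg_characterD(2)[OF \<phi>_char]
    by (auto simp: germ_ker_def intro!: bexI[of _ 1])
  fix f assume "f \<in> germ_ker \<phi>"
  then obtain u where u: "f \<in> B" "u \<in> B" "\<phi> u \<noteq> 0" "u * f \<in> J" by (auto simp: germ_ker_def)
  {
    fix g assume "g \<in> germ_ker \<phi>"
    then obtain v where v: "g \<in> B" "v \<in> B" "\<phi> v \<noteq> 0" "v * g \<in> J" by (auto simp: germ_ker_def)
    have "u * v * (f + g) = v * (u * f) + u * (v * g)" by (simp add: algebra_simps)
    also have "\<dots> \<in> J"
      using alg_idealD(3)[OF ideal_J alg_idealD(4)[OF ideal_J u(4) v(2)] alg_idealD(4)[OF ideal_J v(4) u(2)]] .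
    finally show "f + g \<in> germ_ker \<phi>"
      using u v alg_characterD(5)[OF \<phi>_char u(2) v(2)]
      by (auto simp: germ_ker_def intro!: closed_B bexI[of _ "u * v"])
  next
    fix b assume b: "b \<in> B"
    have "u * (b * f) = b * (u * f)" by (simp add: algebra_simps)
    also have "\<dots> \<in> J" by (rule alg_idealD(4)[OF ideal_J u(4) b])
    finally show "b * f \<in> germ_ker \<phi>"
      using u b by (auto simp: germ_ker_def intro!: closed_B bexI[of _ u])
  }
qed

lemma J_subset_germ_ker: "J \<subseteq> germ_ker \<phi>"
  using alg_idealD(1)[OF ideal_J] one_B alg_characterD(2)[OF \<phi>_char]
  by (auto simp: germ_ker_def intro!: bexI[of _ 1])

lemma germ_ker_cancel:
  assumes "u \<in> B" "\<phi> u \<noteq> 0" "f \<in> B" "u * f \<in> germ_ker \<phi>"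
  shows "f \<in> germ_ker \<phi>"
proof -
  obtain v where v: "v \<in> B" "\<phi> v \<noteq> 0" "v * (u * f) \<in> J"
    using assms(4) by (auto simp: germ_ker_def)
  then have "v * u \<in> B" "\<phi> (v * u) \<noteq> 0" "(v * u) * f \<in> J"
    using assms by (auto simp: alg_characterD(5)[OF \<phi>_char] mult.assoc intro: closed_B)
  then show ?thesis using assms(3) unfolding germ_ker_def by blast
qed

text \<open>After the root 0 is split off, a relation for \<open>w\<close> reads
  \<open>w ^ k * (d + w * r)\<close> in \<open>J\<close> with \<open>d\<close> nonzero. The power of
  \<open>w\<close> does not vanish at \<phi> and cancels in the germ, so -r / d inverts
  \<open>w\<close>. Thus denominators never lead out of \<open>B\<close>.\<close>

lemma germ_unit:
  assumes w: "w \<in> B" "\<phi> w \<noteq> 0"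
  shows "\<exists>s\<in>B. 1 - w * s \<in> germ_ker \<phi>"
proof -
  obtain cs k where J: "w ^ k * shifts w (filter (\<lambda>c. c \<noteq> 0) cs) \<in> J"
    using algebraic[OF w(1)] shifts_filter_nonzero by metis
  obtain r where r: "r \<in> B"
    "shifts w (filter (\<lambda>c. c \<noteq> 0) cs) = C (\<Prod>c\<leftarrow>filter (\<lambda>c. c \<noteq> 0) cs. - c) + w * r"
    using shifts_expand[OF w(1)] by blast
  define d where "d = (\<Prod>c\<leftarrow>filter (\<lambda>c. c \<noteq> 0) cs. - c)"
  have d: "d \<noteq> 0" unfolding d_def by (auto simp: prod_list_zero_iff)
  define s where "s = - (C (1 / d) * r)"
  have sB: "s \<in> B" unfolding s_def using r by (intro closed_B)
  have "C (1 / d) * (w ^ k * (C d + w * r)) \<in> J"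
    using J C_B alg_idealD(4)[OF ideal_J] by (simp add: r(2) d_def)
  also have "C (1 / d) * (w ^ k * (C d + w * r)) = w ^ k * (C (1 / d) * C d - w * s)"
    by (simp add: s_def algebra_simps)
  also have "C (1 / d) * C d = 1" using d by (simp add: C_mult[symmetric] C_1)
  finally have "w ^ k * (1 - w * s) \<in> J" .
  moreover have "\<phi> (w ^ k) \<noteq> 0" using w by (simp add: alg_characterD(6)[OF \<phi>_char])
  ultimately show ?thesis
    using w sB unfolding germ_ker_def by (intro bexI[of _ s]) (auto intro: closed_B)
qed

text \<open>In a relation for \<open>y\<close> the factors belonging to nonzero roots do not vanish
  at \<phi>, so they serve as the multiplier and only the power of \<open>y\<close> remains.\<close>

lemma power_in_germ_ker:
  assumes y: "y \<in> B" "\<phi> y = 0"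
  shows "\<exists>k. y ^ k \<in> germ_ker \<phi>"
proof -
  obtain cs k where J: "y ^ k * shifts y (filter (\<lambda>c. c \<noteq> 0) cs) \<in> J"
    using algebraic[OF y(1)] shifts_filter_nonzero by metis
  have "\<phi> (shifts y (filter (\<lambda>c. c \<noteq> 0) cs)) \<noteq> 0"
    by (auto simp: alg_character_shifts[OF \<phi>_char y(1)] y(2) prod_list_zero_iff)
  then have "y ^ k \<in> germ_ker \<phi>"
    using J y unfolding germ_ker_def
    by (auto simp: mult.commute intro!: closed_B shifts_B bexI[of _ "shifts y (filter (\<lambda>c. c \<noteq> 0) cs)"])
  then show ?thesis ..
qed

end

text \<open>The multipliers \<open>u\<close> with \<open>u * f\<close> in \<open>J\<close> form an
  ideal. If it were proper, some point would kill all of them, contradicting the vanishing of the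
  germ of \<open>f\<close> there.\<close>

lemma Inter_germ_ker:
  assumes f: "f \<in> B" and germs: "\<And>\<phi>. point \<phi> \<Longrightarrow> f \<in> germ_ker \<phi>"
  shows "f \<in> J"
proof (rule ccontr)
  assume nf: "f \<notin> J"
  let ?Q = "{u \<in> B. u * f \<in> J}"
  have "alg_ideal ?Q"
    unfolding alg_ideal_def
    by (auto simp: distrib_right mult.assoc intro: closed_B alg_idealD[OF ideal_J])
  moreover have "J \<subseteq> ?Q" using f alg_idealD[OF ideal_J] by auto
  moreover have "1 \<notin> ?Q" using nf by simp
  ultimately obtain \<phi> where \<phi>: "point \<phi>" "\<And>u. u \<in> ?Q \<Longrightarrow> \<phi> u = 0"
    using point_exists by blast
  then show False using germs[OF \<phi>(1)] by (auto simp: germ_ker_def)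
qed

text \<open>The function \<open>x - C (\<phi> x)\<close> is nilpotent in the germs at \<phi> and a
  unit in the germs at \<psi>.\<close>

lemma germ_ker_comaximal:
  assumes p: "point \<phi>" "point \<psi>" and x: "x \<in> B" "\<phi> x \<noteq> \<psi> x"
  shows "\<exists>a\<in>germ_ker \<phi>. 1 - a \<in> germ_ker \<psi>"
proof -
  define y where "y = x - C (\<phi> x)"
  have yB: "y \<in> B" using x by (simp add: y_def closed_B)
  have y0: "\<phi> y = 0" "\<psi> y \<noteq> 0"
    using x p[THEN point_character] C_B by (simp_all add: y_def alg_characterD)
  obtain k where k: "y ^ k \<in> germ_ker \<phi>" using power_in_germ_ker[OF p(1) yB y0(1)] by blast
  have "\<psi> (y ^ k) \<noteq> 0" using y0 by (simp add: alg_characterD(6)[OF point_character[OF p(2)] yB])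
  then obtain s where "s \<in> B" "1 - y ^ k * s \<in> germ_ker \<psi>"
    using germ_unit[OF p(2) power_B[OF yB]] by blast
  then show ?thesis using alg_idealD(5)[OF germ_ker_ideal[OF p(1)] k] by blast
qed

text \<open>The Chinese remainder idempotent at \<phi>: a product with one factor for each other
  point, the factor being 1 near \<phi> and 0 near that point.\<close>

lemma germ_idempotent:
  assumes "finite Z" "point \<phi>" "\<And>z. z \<in> Z \<Longrightarrow> point (\<psi> z)" "\<And>z. z \<in> Z \<Longrightarrow> \<exists>x\<in>B. \<psi> z x \<noteq> \<phi> x"
  shows "\<exists>e\<in>B. 1 - e \<in> germ_ker \<phi> \<and> (\<forall>z\<in>Z. e \<in> germ_ker (\<psi> z))"
  using assms
proof (induction Z rule: finite_induct)
  case empty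
  then show ?case
    using one_B alg_idealD(2)[OF germ_ker_ideal[OF assms(2)]] by (intro bexI[of _ 1]) auto
next
  case (insert z Z)
  then obtain e where e: "e \<in> B" "1 - e \<in> germ_ker \<phi>" "\<And>z. z \<in> Z \<Longrightarrow> e \<in> germ_ker (\<psi> z)"
    by auto
  obtain a where a: "a \<in> germ_ker (\<psi> z)" "1 - a \<in> germ_ker \<phi>"
  proof -
    obtain x where "x \<in> B" "\<psi> z x \<noteq> \<phi> x" using insert.prems(3) by blast
    then show ?thesis
      using germ_ker_comaximal[of "\<psi> z" \<phi> x] insert.prems(1,2) that by blast
  qed
  have aB: "a \<in> B" using a by (simp add: germ_ker_def)
  have "1 - e * a = (1 - e) + e * (1 - a)" by (simp add: algebra_simps)
  also have "\<dots> \<in> germ_ker \<phi>"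
    using e a by (intro alg_idealD(3,4)[OF germ_ker_ideal[OF assms(2)]])
  finally have "1 - e * a \<in> germ_ker \<phi>" .
  moreover have "e * a \<in> germ_ker (\<psi> z')" if "z' \<in> insert z Z" for z'
  proof (cases "z' = z")
    case True
    then show ?thesis using alg_idealD(4)[OF germ_ker_ideal a(1) e(1)] insert.prems(2) by auto
  next
    case False
    then show ?thesis
      using that alg_idealD(5)[OF germ_ker_ideal e(3) aB] insert.prems(2) by auto
  qed
  ultimately show ?case using e(1) aB mult_B by blast
qed

text \<open>The surjectivity half of the Chinese remainder theorem: the prescribed elements are
  weighted by these idempotents and added.\<close>

lemma germs_realized:
  assumes fin: "finite Z" and pt: "\<And>z. z \<in> Z \<Longrightarrow> point (\<psi> z)"
    and ne: "\<And>z z'. z \<in> Z \<Longrightarrow> z' \<in> Z \<Longrightarrow> z \<noteq> z' \<Longrightarrow> \<exists>x\<in>B. \<psi> z x \<noteq> \<psi> z' x"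
    and b: "\<And>z. z \<in> Z \<Longrightarrow> b z \<in> B"
  shows "\<exists>f\<in>B. \<forall>z\<in>Z. f - b z \<in> germ_ker (\<psi> z)"
proof -
  have "\<exists>e\<in>B. 1 - e \<in> germ_ker (\<psi> z) \<and> (\<forall>z'\<in>Z - {z}. e \<in> germ_ker (\<psi> z'))" if "z \<in> Z" for z
    by (rule germ_idempotent) (use that fin pt ne in auto)
  then obtain e where e: "\<And>z. z \<in> Z \<Longrightarrow> e z \<in> B" "\<And>z. z \<in> Z \<Longrightarrow> 1 - e z \<in> germ_ker (\<psi> z)"
    "\<And>z z'. z \<in> Z \<Longrightarrow> z' \<in> Z - {z} \<Longrightarrow> e z \<in> germ_ker (\<psi> z')"
    by metis
  define f where "f = (\<Sum>z\<in>Z. b z * e z)"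
  have "f - b z \<in> germ_ker (\<psi> z)" if z: "z \<in> Z" for z
  proof -
    note I = germ_ker_ideal[OF pt[OF z]]
    have "f - b z = (\<Sum>z'\<in>Z - {z}. b z' * e z') - b z * (1 - e z)"
      unfolding f_def by (subst sum.remove[OF fin z]) (simp add: algebra_simps)
    also have "\<dots> \<in> germ_ker (\<psi> z)"
    proof (rule alg_ideal_diff[OF I])
      show "b z * (1 - e z) \<in> germ_ker (\<psi> z)" using z e b by (intro alg_idealD(4)[OF I])
      show "(\<Sum>z'\<in>Z - {z}. b z' * e z') \<in> germ_ker (\<psi> z)"
        using z e b by (intro alg_ideal_sum[OF I] alg_idealD(4)[OF I]) auto
    qed
    finally show ?thesis .
  qed
  moreover have "f \<in> B" unfolding f_def by (intro sum_B mult_B b e)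
  ultimately show ?thesis by blast
qed

section \<open>Finite linear spans modulo the ideal\<close>

definition mspan :: "'a set \<Rightarrow> 'a set" where
  "mspan F = {f. \<exists>a. f - (\<Sum>m\<in>F. C (a m) * m) \<in> J}"

lemma mspan_J: "f \<in> J \<Longrightarrow> f \<in> mspan F"
  by (auto simp: mspan_def C_0 intro!: exI[of _ "\<lambda>_. 0"])

lemma mspan_add: "f \<in> mspan F \<Longrightarrow> g \<in> mspan F \<Longrightarrow> f + g \<in> mspan F"
proof -
  assume "f \<in> mspan F" "g \<in> mspan F"
  then obtain a b where "f - (\<Sum>m\<in>F. C (a m) * m) \<in> J" "g - (\<Sum>m\<in>F. C (b m) * m) \<in> J"
    by (auto simp: mspan_def)
  from alg_idealD(3)[OF ideal_J this]
  have "f + g - (\<Sum>m\<in>F. C (a m + b m) * m) \<in> J"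
    by (simp add: C_add distrib_right sum.distrib algebra_simps)
  then show ?thesis unfolding mspan_def by (intro CollectI exI)
qed

lemma mspan_scale: "f \<in> mspan F \<Longrightarrow> C c * f \<in> mspan F"
proof -
  assume "f \<in> mspan F"
  then obtain a where "f - (\<Sum>m\<in>F. C (a m) * m) \<in> J"
    by (auto simp: mspan_def)
  from alg_idealD(4)[OF ideal_J this C_B[of c]]
  have "C c * f - (\<Sum>m\<in>F. C (c * a m) * m) \<in> J"
    by (simp add: C_mult right_diff_distrib sum_distrib_left mult.assoc)
  then show ?thesis unfolding mspan_def by (intro CollectI exI)
qed

lemma mspan_base: "finite F \<Longrightarrow> m \<in> F \<Longrightarrow> m \<in> mspan F"
proof -
  assume "finite F" "m \<in> F"
  then have "(\<Sum>x\<in>F. C (if x = m then 1 else 0) * x) = m"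
    by (subst sum.remove[of _ m]) (auto simp: C_1 C_0 intro: sum.neutral)
  then show ?thesis
    using alg_idealD(2)[OF ideal_J]
    by (auto simp: mspan_def intro!: exI[of _ "\<lambda>x. if x = m then 1 else 0"])
qed

lemma mspan_sum: "(\<And>x. x \<in> A \<Longrightarrow> f x \<in> mspan F) \<Longrightarrow> sum f A \<in> mspan F"
  by (induction A rule: infinite_finite_induct)
    (auto intro: mspan_add mspan_J alg_idealD(2)[OF ideal_J])

lemma mspan_diff: "f \<in> mspan F \<Longrightarrow> g \<in> mspan F \<Longrightarrow> f - g \<in> mspan F"
  using mspan_add[of f F "C (- 1) * g"] mspan_scale[of g F "- 1"] by (simp add: C_uminus C_1)

lemma mspanE:
  assumes "f \<in> mspan F"
  obtains j a where "j \<in> J" "f = j + (\<Sum>m\<in>F. C (a m) * m)"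
proof -
  obtain a where "f - (\<Sum>m\<in>F. C (a m) * m) \<in> J" using assms by (auto simp: mspan_def)
  then show ?thesis by (rule that) simp
qed

lemma mspan_mult:
  assumes f: "f \<in> mspan F" and g: "g \<in> mspan G" and FG: "F \<subseteq> B" "G \<subseteq> B"
    and H: "\<And>x y. x \<in> F \<Longrightarrow> y \<in> G \<Longrightarrow> x * y \<in> mspan H"
  shows "f * g \<in> mspan H"
proof -
  obtain j a where ja: "j \<in> J" "f = j + (\<Sum>m\<in>F. C (a m) * m)" using f by (rule mspanE)
  obtain k b where kb: "k \<in> J" "g = k + (\<Sum>m\<in>G. C (b m) * m)" using g by (rule mspanE)
  have fB: "(\<Sum>m\<in>F. C (a m) * m) \<in> B" and gB: "(\<Sum>m\<in>G. C (b m) * m) \<in> B"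
    using FG by (auto intro!: sum_B mult_B C_B)
  have "k \<in> B" using kb alg_idealD(1)[OF ideal_J] by blast
  then have "j * g \<in> J" unfolding kb(2) using ja gB by (intro alg_idealD(5)[OF ideal_J] add_B)
  moreover have "(\<Sum>m\<in>F. C (a m) * m) * k \<in> J" using kb fB by (intro alg_idealD(4)[OF ideal_J])
  moreover have "(\<Sum>m\<in>F. C (a m) * m) * (\<Sum>m\<in>G. C (b m) * m) \<in> mspan H"
    unfolding sum_product
  proof (intro mspan_sum)
    fix x y assume xy: "x \<in> F" "y \<in> G"
    have "C (a x) * x * (C (b y) * y) = C (a x) * (C (b y) * (x * y))" by (simp add: mult_ac)
    then show "C (a x) * x * (C (b y) * y) \<in> mspan H"
      using mspan_scale[OF mspan_scale[OF H[OF xy]]] by metis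
  qed
  moreover have "f * g = j * g + (\<Sum>m\<in>F. C (a m) * m) * k
      + (\<Sum>m\<in>F. C (a m) * m) * (\<Sum>m\<in>G. C (b m) * m)"
    unfolding ja(2) kb(2) by (simp add: algebra_simps)
  ultimately show ?thesis by (auto intro: mspan_add mspan_J)
qed

lemma mspan_trans:
  assumes f: "f \<in> mspan F" and FG: "F \<subseteq> mspan G"
  shows "f \<in> mspan G"
proof -
  obtain j a where ja: "j \<in> J" "f = j + (\<Sum>m\<in>F. C (a m) * m)" using f by (rule mspanE)
  have "(\<Sum>m\<in>F. C (a m) * m) \<in> mspan G" using FG by (intro mspan_sum mspan_scale) auto
  then show ?thesis unfolding ja(2) by (rule mspan_add[OF mspan_J[OF ja(1)]])
qed

text \<open>A monic polynomial without its leading term has lower degree; a relation therefore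
  rewrites the leading power in lower ones.\<close>

lemma shifts_leading:
  assumes f: "f \<in> B"
  shows "shifts f cs - f ^ length cs \<in> mspan ((\<lambda>i. f ^ i) ` {..<length cs})"
proof (induction cs)
  case Nil
  then show ?case by (simp add: shifts_simps mspan_J alg_idealD(2)[OF ideal_J])
next
  case (Cons c cs)
  let ?n = "length cs"
  let ?G = "(\<lambda>i. f ^ i) ` {..<Suc ?n}"
  define g where "g = shifts f cs - f ^ ?n"
  have pow: "f ^ i \<in> mspan ?G" if "i \<le> ?n" for i using that by (intro mspan_base) auto
  have gG: "g \<in> mspan ?G"
    by (rule mspan_trans[OF Cons.IH[folded g_def]]) (auto intro!: pow)
  have fg: "g * f \<in> mspan ?G"
  proof (rule mspan_mult[OF Cons.IH[folded g_def]])
    show "f \<in> mspan {f}" by (intro mspan_base) auto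
    show "x * y \<in> mspan ?G" if "x \<in> (\<lambda>i. f ^ i) ` {..<?n}" "y \<in> {f}" for x y
    proof -
      from that obtain i where "i < ?n" "x * y = f ^ Suc i" by (auto simp: mult.commute)
      then show ?thesis using pow[of "Suc i"] by simp
    qed
  qed (use f in \<open>auto intro: power_B\<close>)
  have "shifts f (c # cs) - f ^ length (c # cs) = g * f - C c * f ^ ?n - C c * g"
    by (simp add: shifts_simps g_def algebra_simps)
  also have "\<dots> \<in> mspan ?G" by (intro mspan_diff mspan_scale fg gG pow) simp
  finally show ?case by simp
qed

text \<open>The bound \<open>d\<close> is the degree of a monic relation of \<open>f\<close>; higher
  powers are reduced one multiplication at a time.\<close>

lemma powers_mspan:
  assumes f: "f \<in> B"
  obtains d where "\<And>n. f ^ n \<in> mspan ((\<lambda>i. f ^ i) ` {..<d})"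
proof -
  obtain cs where cs: "shifts f cs \<in> J" using algebraic[OF f] by blast
  let ?G = "(\<lambda>i. f ^ i) ` {..<length cs}"
  have "f ^ length cs = shifts f cs - (shifts f cs - f ^ length cs)" by simp
  also have "\<dots> \<in> mspan ?G" by (intro mspan_diff mspan_J[OF cs] shifts_leading[OF f])
  finally have top: "f ^ length cs \<in> mspan ?G" .
  have low: "f ^ i \<in> mspan ?G" if "i \<le> length cs" for i
    using that top by (cases "i = length cs") (auto intro!: mspan_base)
  have "f ^ n \<in> mspan ?G" for n
  proof (induction n)
    case 0
    then show ?case using low[of 0] by simp
  next
    case (Suc n)
    have "f ^ n * f \<in> mspan ?G"
    proof (rule mspan_mult[OF Suc.IH])
      show "f \<in> mspan {f}" by (intro mspan_base) auto
      show "x * y \<in> mspan ?G" if "x \<in> ?G" "y \<in> {f}" for x y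
      proof -
        from that obtain i where "i < length cs" "x * y = f ^ Suc i" by (auto simp: mult.commute)
        then show ?thesis using low[of "Suc i"] by simp
      qed
    qed (use f in \<open>auto intro: power_B\<close>)
    then show ?case by (simp add: mult.commute)
  qed
  then show ?thesis by (rule that)
qed

text \<open>Products of finitely many powers, one per variable, suffice, since each variable
  satisfies a monic relation. Together with finite generation this bounds the dimension.\<close>

lemma monomials_mspan:
  assumes "finite X" "X \<subseteq> B"
  shows "\<exists>F. finite F \<and> F \<subseteq> B \<and> (\<forall>k. (\<Prod>x\<in>X. x ^ k x) \<in> mspan F)"
  using assms
proof (induction X rule: finite_induct)
  case empty
  have "1 \<in> mspan {1}" by (intro mspan_base) auto
  then show ?case using one_B by (intro exI[of _ "{1}"]) auto
next
  case (insert x X)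
  then obtain F where F: "finite F" "F \<subseteq> B" "\<And>k. (\<Prod>x\<in>X. x ^ k x) \<in> mspan F" by auto
  have xB: "x \<in> B" using insert by simp
  obtain d where d: "\<And>n. x ^ n \<in> mspan ((\<lambda>i. x ^ i) ` {..<d})" using powers_mspan[OF xB] by blast
  let ?P = "(\<lambda>i. x ^ i) ` {..<d}"
  let ?H = "(\<lambda>(a, b). a * b) ` (?P \<times> F)"
  have fin: "finite ?H" using F by auto
  have "(\<Prod>y\<in>insert x X. y ^ k y) \<in> mspan ?H" for k
  proof -
    have "x ^ k x * (\<Prod>y\<in>X. y ^ k y) \<in> mspan ?H"
      by (rule mspan_mult[OF d F(3)]) (use xB F(2) fin in \<open>auto intro!: power_B mspan_base\<close>)
    then show ?thesis using insert.hyps by simp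
  qed
  moreover have "?H \<subseteq> B" using F(2) xB by (auto intro!: mult_B power_B)
  ultimately show ?case using fin by blast
qed

text \<open>A point is determined on \<open>B\<close> by its values on the spanning set, and each
  value is a root of a fixed relation. Points are restricted to \<open>B\<close> because their
  values elsewhere are arbitrary.\<close>

lemma finite_points:
  assumes F: "finite F" "F \<subseteq> B" "B \<subseteq> mspan F"
  shows "finite ((\<lambda>\<phi>. restrict \<phi> B) ` Collect point)"
proof -
  obtain cs where cs: "\<And>f. f \<in> B \<Longrightarrow> shifts f (cs f) \<in> J" using algebraic by metis
  have val: "\<phi> f \<in> set (cs f)" if "point \<phi>" "f \<in> B" for \<phi> f
  proof -
    have "\<phi> (shifts f (cs f)) = 0" using cs that by (simp add: point_def)
    then show ?thesis
      by (auto simp: alg_character_shifts[OF point_character[OF that(1)] that(2)] prod_list_zero_iff)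
  qed
  have det: "\<phi> f = \<psi> f" if p: "point \<phi>" "point \<psi>" and eq: "restrict \<phi> F = restrict \<psi> F" and f: "f \<in> B"
    for \<phi> \<psi> f
  proof -
    obtain j a where ja: "j \<in> J" "f = j + (\<Sum>m\<in>F. C (a m) * m)"
      using mspanE[OF subsetD[OF F(3) f]] .
    have ev: "\<theta> f = (\<Sum>m\<in>F. a m * \<theta> m)" if "point \<theta>" for \<theta>
    proof -
      have "j \<in> B" using ja alg_idealD(1)[OF ideal_J] by blast
      moreover have "(\<Sum>m\<in>F. C (a m) * m) \<in> B" using F(2) by (auto intro!: sum_B mult_B C_B)
      moreover have "\<theta> j = 0" using that ja by (simp add: point_def)
      moreover have "\<theta> (\<Sum>m\<in>F. C (a m) * m) = (\<Sum>m\<in>F. \<theta> (C (a m) * m))"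
        using F(2) by (intro alg_character_sum[OF point_character[OF that]]) (auto intro!: mult_B C_B)
      moreover have "\<theta> (C (a m) * m) = a m * \<theta> m" if "m \<in> F" for m
        using F(2) that C_B point_character[OF \<open>point \<theta>\<close>] by (auto simp: alg_characterD)
      ultimately show ?thesis
        using point_character[OF that] by (simp add: ja(2) alg_characterD)
    qed
    have "\<phi> m = \<psi> m" if "m \<in> F" for m using fun_cong[OF eq, of m] that by simp
    then show ?thesis using ev[OF p(1)] ev[OF p(2)] by (simp cong: sum.cong)
  qed
  have "finite (PiE F (\<lambda>f. set (cs f)))" using F(1) by (intro finite_PiE) auto
  moreover have "(\<lambda>\<phi>. restrict \<phi> F) ` Collect point \<subseteq> PiE F (\<lambda>f. set (cs f))"
    using val F(2) by auto
  ultimately have "finite ((\<lambda>\<phi>. restrict \<phi> F) ` Collect point)" using finite_subset by blast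
  \<comment> \<open>Each pattern of values on \<open>F\<close> is sent to some point with this
    pattern; by \<open>det\<close> the image exhausts all points on \<open>B\<close>.\<close>
  then have "finite ((\<lambda>\<eta>. restrict (SOME \<phi>. point \<phi> \<and> restrict \<phi> F = \<eta>) B) `
      (\<lambda>\<phi>. restrict \<phi> F) ` Collect point)"
    by (rule finite_imageI)
  moreover have "restrict \<phi> B = restrict (SOME \<psi>. point \<psi> \<and> restrict \<psi> F = restrict \<phi> F) B"
    if "point \<phi>" for \<phi>
  proof -
    have "point (SOME \<psi>. point \<psi> \<and> restrict \<psi> F = restrict \<phi> F) \<and>
        restrict (SOME \<psi>. point \<psi> \<and> restrict \<psi> F = restrict \<phi> F) F = restrict \<phi> F"
      by (rule someI[of _ \<phi>]) (use that in simp)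
    then show ?thesis using det[OF that] by (intro restrict_ext) metis
  qed
  ultimately show ?thesis by (auto simp: image_image elim!: finite_subset[rotated] intro!: image_eqI)
qed

end

section \<open>Quotients and localizations of monoid algebras\<close>

lemma field_complex_field: "field complex_field"
proof -
  have "cring complex_field"
  proof (rule cringI)
    show "abelian_group complex_field"
    proof (rule abelian_groupI)
      show "\<exists>y\<in>carrier complex_field. y \<oplus>\<^bsub>complex_field\<^esub> x = \<zero>\<^bsub>complex_field\<^esub>" for x
        by (rule bexI[of _ "- x"]) (simp_all add: complex_field_def)
    qed (simp_all add: complex_field_def)
    show "comm_monoid complex_field"
      by (rule comm_monoidI) (simp_all add: complex_field_def)
  qed (simp_all add: complex_field_def distrib_right)
  moreover have "Units complex_field = carrier complex_field - {\<zero>\<^bsub>complex_field\<^esub>}"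
  proof -
    have "\<exists>y. y * x = 1 \<and> x * y = 1" if "x \<noteq> 0" for x :: complex
      using that by (intro exI[of _ "1 / x"]) simp
    then show ?thesis by (auto simp: Units_def complex_field_def)
  qed
  ultimately show ?thesis by (rule cring.cring_fieldI)
qed

lemma complex_field_simps [simp]:
  "carrier complex_field = UNIV" "x \<otimes>\<^bsub>complex_field\<^esub> y = x * y" "x \<oplus>\<^bsub>complex_field\<^esub> y = x + y"
  "\<one>\<^bsub>complex_field\<^esub> = 1" "\<zero>\<^bsub>complex_field\<^esub> = 0"
  by (simp_all add: complex_field_def)

lemma linear_map_complexI:
  assumes "vectorspace complex_field V" "vectorspace complex_field W"
    and "\<And>x. x \<in> carrier V \<Longrightarrow> T x \<in> carrier W"
    and "\<And>x y. x \<in> carrier V \<Longrightarrow> y \<in> carrier V \<Longrightarrow> T (x \<oplus>\<^bsub>V\<^esub> y) = T x \<oplus>\<^bsub>W\<^esub> T y"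
    and "\<And>c x. x \<in> carrier V \<Longrightarrow> T (c \<odot>\<^bsub>V\<^esub> x) = c \<odot>\<^bsub>W\<^esub> T x"
  shows "linear_map complex_field V W T"
  using assms
  by (auto simp: linear_map_def mod_hom_def mod_hom_axioms_def module_hom_def vectorspace_def)

text \<open>The axioms are carried along a surjection that respects the operations. This covers
  quotients and localizations, whose operations are awkward to verify directly.\<close>

lemma vectorspace_image:
  assumes V: "vectorspace complex_field V" and surj: "T ` carrier V = carrier W"
    and add: "\<And>x y. x \<in> carrier V \<Longrightarrow> y \<in> carrier V \<Longrightarrow> T (x \<oplus>\<^bsub>V\<^esub> y) = T x \<oplus>\<^bsub>W\<^esub> T y"
    and smult: "\<And>c x. x \<in> carrier V \<Longrightarrow> T (c \<odot>\<^bsub>V\<^esub> x) = c \<odot>\<^bsub>W\<^esub> T x"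
    and zero: "T \<zero>\<^bsub>V\<^esub> = \<zero>\<^bsub>W\<^esub>"
  shows "vectorspace complex_field W" "linear_map complex_field V W T"
proof -
  interpret V: vectorspace complex_field V by fact
  have ex: "\<exists>v\<in>carrier V. w = T v" if "w \<in> carrier W" for w using that surj by blast
  have TW: "T v \<in> carrier W" if "v \<in> carrier V" for v using that surj by blast
  note rules = add[symmetric] smult[symmetric] zero[symmetric] TW
  show "vectorspace complex_field W"
  proof (rule vs_criteria)
    show "field complex_field" by (rule field_complex_field)
    show "\<zero>\<^bsub>W\<^esub> \<in> carrier W" by (simp add: rules)
    show "\<forall>v\<in>carrier W. \<exists>w\<in>carrier W. v \<oplus>\<^bsub>W\<^esub> w = \<zero>\<^bsub>W\<^esub>"
    proof
      fix w assume "w \<in> carrier W"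
      then obtain v where v: "v \<in> carrier V" "w = T v" using ex by blast
      have "w \<oplus>\<^bsub>W\<^esub> T (\<ominus>\<^bsub>V\<^esub> v) = T (v \<oplus>\<^bsub>V\<^esub> \<ominus>\<^bsub>V\<^esub> v)" using v by (simp add: add)
      also have "v \<oplus>\<^bsub>V\<^esub> \<ominus>\<^bsub>V\<^esub> v = \<zero>\<^bsub>V\<^esub>" using v by (rule_tac V.module.M.r_neg)
      finally show "\<exists>w'\<in>carrier W. w \<oplus>\<^bsub>W\<^esub> w' = \<zero>\<^bsub>W\<^esub>" using v by (metis zero TW V.module.M.a_inv_closed)
    qed
  qed (auto dest!: ex simp: rules V.module.M.a_assoc V.module.M.a_lcomm V.smult_assoc1
      V.smult_l_distr V.smult_r_distr V.module.M.a_comm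
      V.smult_l_distr[simplified] V.smult_assoc1[simplified] V.smult_one[simplified])
  then show "linear_map complex_field V W T"
    by (rule linear_map_complexI[OF V]) (use TW add smult in auto)
qed

text \<open>An identification with d-tuples of complex numbers that does not presuppose that
  \<open>V\<close> is a vector space. Coordinates at indices from \<open>d\<close> on are left
  unspecified.\<close>

definition linear_coordinates ::
    "(complex, 'v, 'r) module_scheme \<Rightarrow> nat \<Rightarrow> ('v \<Rightarrow> nat \<Rightarrow> complex) \<Rightarrow> bool" where
  "linear_coordinates V d \<phi> \<longleftrightarrow>
     (\<forall>v\<in>carrier V. \<forall>w\<in>carrier V. \<forall>i<d. \<phi> (v \<oplus>\<^bsub>V\<^esub> w) i = \<phi> v i + \<phi> w i) \<and>
     (\<forall>c. \<forall>v\<in>carrier V. \<forall>i<d. \<phi> (c \<odot>\<^bsub>V\<^esub> v) i = c * \<phi> v i) \<and>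
     (\<forall>v\<in>carrier V. \<forall>w\<in>carrier V. (\<forall>i<d. \<phi> v i = \<phi> w i) \<longrightarrow> v = w) \<and>
     (\<forall>c. \<exists>v\<in>carrier V. \<forall>i<d. \<phi> v i = c i)"

lemma linear_coordinatesD:
  assumes "linear_coordinates V d \<phi>"
  shows "v \<in> carrier V \<Longrightarrow> w \<in> carrier V \<Longrightarrow> i < d \<Longrightarrow> \<phi> (v \<oplus>\<^bsub>V\<^esub> w) i = \<phi> v i + \<phi> w i"
    and "v \<in> carrier V \<Longrightarrow> i < d \<Longrightarrow> \<phi> (c \<odot>\<^bsub>V\<^esub> v) i = c * \<phi> v i"
    and "v \<in> carrier V \<Longrightarrow> w \<in> carrier V \<Longrightarrow> \<forall>i<d. \<phi> v i = \<phi> w i \<Longrightarrow> v = w"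
    and "\<exists>v\<in>carrier V. \<forall>i<d. \<phi> v i = a i"
  using assms unfolding linear_coordinates_def by blast+

lemma has_vdim_coordinates:
  assumes "has_vdim V d"
  shows "\<exists>\<phi>. linear_coordinates V d \<phi>"
proof -
  interpret V: vectorspace complex_field V using assms by (simp add: has_vdim_def)
  obtain b where b: "finite b" "V.basis b" using V.finite_basis_exists assms by (auto simp: has_vdim_def)
  have bV: "b \<subseteq> carrier V" using b(2) by (simp add: V.basis_def)
  have "card b = d" using V.dim_basis[OF b] assms by (simp add: has_vdim_def)
  then obtain h where h: "bij_betw h {..<d} b"
    using ex_bij_betw_nat_finite[OF b(1)] by (auto simp: atLeast0LessThan)
  have uniq: "\<exists>!a. a \<in> b \<rightarrow>\<^sub>E UNIV \<and> V.module.lincomb a b = v" if "v \<in> carrier V" for v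
    using V.basis_criterion[OF b(1) bV] b(2) that by simp
  \<comment> \<open>Coefficient functions are unique only if they are made extensional on the
    basis.\<close>
  define co where "co v = (THE a. a \<in> b \<rightarrow>\<^sub>E UNIV \<and> V.module.lincomb a b = v)" for v
  have co: "V.module.lincomb (co v) b = v" if "v \<in> carrier V" for v
    using theI'[OF uniq[OF that]] by (simp add: co_def)
  have coI: "co v x = a x" if "V.module.lincomb a b = v" "x \<in> b" for a v x
  proof -
    have eq: "V.module.lincomb (restrict a b) b = v"
      using that(1) by (subst V.lincomb_cong[OF refl bV, where b=a]) auto
    have "v \<in> carrier V" using that(1) bV by auto
    then have "co v = restrict a b"
      unfolding co_def by (intro the1_equality[OF uniq]) (use eq in auto)
    then show ?thesis using that(2) by simp
  qed
  have hb: "h i \<in> b" if "i < d" for i using h that by (auto simp: bij_betw_def)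
  have "linear_coordinates V d (\<lambda>v i. co v (h i))"
    unfolding linear_coordinates_def
  proof (intro conjI allI ballI impI)
    fix v w i assume vw: "v \<in> carrier V" "w \<in> carrier V" and i: "i < d"
    have "V.module.lincomb (\<lambda>x. co v x \<oplus>\<^bsub>complex_field\<^esub> co w x) b = v \<oplus>\<^bsub>V\<^esub> w"
      by (subst V.lincomb_sum[OF b(1) bV]) (use vw in \<open>auto simp: co\<close>)
    from coI[OF this hb[OF i]] show "co (v \<oplus>\<^bsub>V\<^esub> w) (h i) = co v (h i) + co w (h i)" by simp
  next
    fix c v i assume v: "v \<in> carrier V" and i: "i < d"
    have "V.module.lincomb (\<lambda>x. c \<otimes>\<^bsub>complex_field\<^esub> co v x) b = c \<odot>\<^bsub>V\<^esub> v"
      by (subst V.lincomb_smult[OF bV]) (use v in \<open>auto simp: co\<close>)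
    from coI[OF this hb[OF i]] show "co (c \<odot>\<^bsub>V\<^esub> v) (h i) = c * co v (h i)" by simp
  next
    fix v w assume vw: "v \<in> carrier V" "w \<in> carrier V"
      and eq: "\<forall>i<d. co v (h i) = co w (h i)"
    have "co v x = co w x" if "x \<in> b" for x
    proof -
      have "x \<in> h ` {..<d}" using h that by (simp add: bij_betw_def)
      then show ?thesis using eq by auto
    qed
    then have "V.module.lincomb (co v) b = V.module.lincomb (co w) b"
      by (intro V.lincomb_cong[OF refl bV]) auto
    then show "v = w" using vw by (simp add: co)
  next
    fix c :: "nat \<Rightarrow> complex"
    define a where "a x = c (the_inv_into {..<d} h x)" for x
    have "V.module.lincomb a b \<in> carrier V" using bV by auto
    moreover have "co (V.module.lincomb a b) (h i) = c i" if "i < d" for i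
      using coI[OF refl hb[OF that], of a] h that
      by (simp add: a_def the_inv_into_f_f bij_betw_def)
    ultimately show "\<exists>v\<in>carrier V. \<forall>i<d. co v (h i) = c i" by blast
  qed
  then show ?thesis by blast
qed

lemma poly_mapping_sum_single:
  assumes "finite S" "Poly_Mapping.keys f \<subseteq> S"
  shows "f = (\<Sum>a\<in>S. Poly_Mapping.single a (Poly_Mapping.lookup f a))"
proof (rule poly_mapping_eqI)
  fix k
  show "Poly_Mapping.lookup f k =
      Poly_Mapping.lookup (\<Sum>a\<in>S. Poly_Mapping.single a (Poly_Mapping.lookup f a)) k"
    using assms by (auto simp: lookup_sum lookup_single when_def in_keys_iff subset_iff)
qed

text \<open>The operations of a localization are unions over all representatives; such a union
  collapses once every representative gives the same class.\<close>

lemma UN_pairs_const: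
  assumes "X \<noteq> {}" "\<And>r s. (r, s) \<in> X \<Longrightarrow> F r s = c"
  shows "(\<Union>(r, s)\<in>X. F r s) = c"
proof -
  have "(\<Union>p\<in>X. case p of (r, s) \<Rightarrow> F r s) = (\<Union>p\<in>X. c)"
    using assms(2) by (intro SUP_cong) auto
  then show ?thesis using assms(1) by simp
qed

section \<open>Monoid algebras\<close>

locale monoid_algebra =
  fixes A :: "'e::comm_monoid_add set"
  assumes zero_A: "0 \<in> A" and add_A: "a \<in> A \<Longrightarrow> b \<in> A \<Longrightarrow> a + b \<in> A"
begin

abbreviation C :: "complex \<Rightarrow> 'e \<Rightarrow>\<^sub>0 complex" where "C \<equiv> Poly_Mapping.single 0"

definition B :: "('e \<Rightarrow>\<^sub>0 complex) set" where "B = {f. Poly_Mapping.keys f \<subseteq> A}"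

lemma mem_B: "f \<in> B \<longleftrightarrow> Poly_Mapping.keys f \<subseteq> A"
  by (simp add: B_def)

sublocale complex_algebra C B
proof
  show "C (x + y) = C x + C y" "C (x * y) = C x * C y" "C 1 = 1" for x y
    by (simp_all add: single_add mult_single)
  show "C x \<in> B" for x using zero_A by (simp add: mem_B)
  show "f + g \<in> B" if "f \<in> B" "g \<in> B" for f g
    using that keys_add[of f g] by (auto simp: mem_B)
  show "f * g \<in> B" if fg: "f \<in> B" "g \<in> B" for f g
  proof -
    have "Poly_Mapping.keys (f * g) \<subseteq> {a + b | a b. a \<in> Poly_Mapping.keys f \<and> b \<in> Poly_Mapping.keys g}"
      by (rule keys_mult)
    also have "\<dots> \<subseteq> A" using fg add_A by (auto simp: mem_B)
    finally show ?thesis by (simp add: mem_B)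
  qed
qed

lemma monoid_alg_simps [simp]:
  "carrier (monoid_alg A) = B" "f \<otimes>\<^bsub>monoid_alg A\<^esub> g = f * g" "\<one>\<^bsub>monoid_alg A\<^esub> = 1"
  "\<zero>\<^bsub>monoid_alg A\<^esub> = 0" "f \<oplus>\<^bsub>monoid_alg A\<^esub> g = f + g" "c \<odot>\<^bsub>monoid_alg A\<^esub> f = C c * f"
  by (simp_all add: monoid_alg_def B_def)

lemma vectorspace_monoid_alg: "vectorspace complex_field (monoid_alg A)"
proof (rule vs_criteria)
  show "field complex_field" by (rule field_complex_field)
  show "\<forall>v\<in>carrier (monoid_alg A). \<exists>w\<in>carrier (monoid_alg A).
      v \<oplus>\<^bsub>monoid_alg A\<^esub> w = \<zero>\<^bsub>monoid_alg A\<^esub>"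
    using uminus_B by (metis monoid_alg_simps(1,4,5) add.right_inverse)
qed (use closed_B in \<open>auto simp: C_mult C_add C_1 algebra_simps\<close>)

text \<open>The sum runs over the monomials themselves, the form that
  \<open>algebraic_if_zero_dim\<close> asks for; the exponent of a monomial is recovered as its only
  key.\<close>

lemma expansion_C:
  "f = (\<Sum>m\<in>(\<lambda>a. Poly_Mapping.single a 1) ` Poly_Mapping.keys f.
      C (Poly_Mapping.lookup f (the_elem (Poly_Mapping.keys m))) * m)"
  by (subst sum.reindex) (auto simp: mult_single inj_on_def poly_mapping_sum_single[OF finite_keys order_refl, symmetric]
      dest!: arg_cong[of _ _ Poly_Mapping.keys])

text \<open>Linear coordinates on the quotient of \<open>B\<close> by \<open>N\<close>, expressed by
  functions on \<open>B\<close>, so that changing charts requires no maps between quotients.\<close>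

definition coordinates_mod ::
    "('e \<Rightarrow>\<^sub>0 complex) set \<Rightarrow> nat \<Rightarrow> (('e \<Rightarrow>\<^sub>0 complex) \<Rightarrow> nat \<Rightarrow> complex) \<Rightarrow> bool" where
  "coordinates_mod N d \<theta> \<longleftrightarrow>
     (\<forall>f\<in>B. \<forall>g\<in>B. \<forall>i<d. \<theta> (f + g) i = \<theta> f i + \<theta> g i) \<and>
     (\<forall>c. \<forall>f\<in>B. \<forall>i<d. \<theta> (C c * f) i = c * \<theta> f i) \<and>
     (\<forall>f\<in>B. \<forall>g\<in>B. (\<forall>i<d. \<theta> f i = \<theta> g i) \<longleftrightarrow> f - g \<in> N) \<and>
     (\<forall>c. \<exists>f\<in>B. \<forall>i<d. \<theta> f i = c i)"

lemma coordinates_modD: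
  assumes "coordinates_mod N d \<theta>"
  shows "f \<in> B \<Longrightarrow> g \<in> B \<Longrightarrow> i < d \<Longrightarrow> \<theta> (f + g) i = \<theta> f i + \<theta> g i"
    and "f \<in> B \<Longrightarrow> i < d \<Longrightarrow> \<theta> (C c * f) i = c * \<theta> f i"
    and "f \<in> B \<Longrightarrow> g \<in> B \<Longrightarrow> (\<forall>i<d. \<theta> f i = \<theta> g i) \<longleftrightarrow> f - g \<in> N"
    and "\<exists>f\<in>B. \<forall>i<d. \<theta> f i = a i"
  using assms unfolding coordinates_mod_def by blast+

end

section \<open>The quotient of a monoid algebra by an ideal\<close>

locale monoid_algebra_ideal = monoid_algebra +
  fixes J
  assumes ideal_J: "alg_ideal J"
begin

abbreviation Q :: "(complex, ('a \<Rightarrow>\<^sub>0 complex) set) module" where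
  "Q \<equiv> quot_alg (monoid_alg A) J"

definition cls :: "('a \<Rightarrow>\<^sub>0 complex) \<Rightarrow> ('a \<Rightarrow>\<^sub>0 complex) set" where
  "cls f = {j + f | j. j \<in> J}"

lemma coset_eq_cls: "J +>\<^bsub>monoid_alg A\<^esub> f = cls f"
  by (auto simp: a_r_coset_def' cls_def)

lemma mem_cls: "g \<in> cls f \<longleftrightarrow> g - f \<in> J"
  by (auto simp: cls_def algebra_simps intro!: exI[of _ "g - f"])

lemma cls_eq_iff: "cls f = cls g \<longleftrightarrow> f - g \<in> J"
proof
  assume "cls f = cls g"
  moreover have "f \<in> cls f" using alg_idealD(2)[OF ideal_J] by (simp add: mem_cls)
  ultimately show "f - g \<in> J" by (simp add: mem_cls)
next
  assume fg: "f - g \<in> J"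
  have "h - f \<in> J \<longleftrightarrow> h - g \<in> J" for h
    using alg_idealD(3)[OF ideal_J _ fg, of "h - f"] alg_ideal_diff[OF ideal_J _ fg, of "h - g"] by auto
  then show "cls f = cls g" by (auto simp: mem_cls)
qed

lemma self_in_cls: "f \<in> cls f"
  using alg_idealD(2)[OF ideal_J] by (simp add: mem_cls)

lemma cls_subset_B: "f \<in> B \<Longrightarrow> cls f \<subseteq> B"
  using alg_idealD(1)[OF ideal_J] add_B by (auto simp: cls_def)

lemma Q_carrier: "carrier Q = cls ` B"
  by (auto simp: quot_alg_def ring.defs module.defs FactRing_def A_RCOSETS_def' coset_eq_cls)

lemma Q_zero: "\<zero>\<^bsub>Q\<^esub> = cls 0"
  by (auto simp: quot_alg_def ring.defs module.defs FactRing_def cls_def)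

lemma Q_one: "\<one>\<^bsub>Q\<^esub> = cls 1"
  by (auto simp: quot_alg_def ring.defs module.defs FactRing_def coset_eq_cls)

lemma Q_add: "cls f \<oplus>\<^bsub>Q\<^esub> cls g = cls (f + g)"
proof -
  have "cls f \<oplus>\<^bsub>Q\<^esub> cls g = {x + y | x y. x \<in> cls f \<and> y \<in> cls g}"
    by (auto simp: quot_alg_def ring.defs module.defs FactRing_def set_add_def')
  also have "\<dots> = cls (f + g)"
  proof
    show "{x + y | x y. x \<in> cls f \<and> y \<in> cls g} \<subseteq> cls (f + g)"
      using alg_idealD(3)[OF ideal_J] by (fastforce simp: mem_cls add_diff_add)
    show "cls (f + g) \<subseteq> {x + y | x y. x \<in> cls f \<and> y \<in> cls g}"
      using self_in_cls by (fastforce simp: cls_def add.assoc[symmetric])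
  qed
  finally show ?thesis .
qed

lemma Q_mult:
  assumes "f \<in> B" "g \<in> B"
  shows "cls f \<otimes>\<^bsub>Q\<^esub> cls g = cls (f * g)"
proof -
  have "cls (x * y) = cls (f * g)" if "x \<in> cls f" "y \<in> cls g" for x y
  proof -
    have "x * y - f * g = x * (y - g) + (x - f) * g" by (simp add: algebra_simps)
    also have "\<dots> \<in> J"
      using that assms cls_subset_B[OF assms(1)] alg_idealD(3)[OF ideal_J]
        alg_idealD(4)[OF ideal_J] alg_idealD(5)[OF ideal_J]
      by (metis mem_cls subsetD)
    finally show ?thesis by (simp add: cls_eq_iff)
  qed
  then have "(\<Union>x\<in>cls f. \<Union>y\<in>cls g. cls (x * y)) = cls (f * g)"
    using self_in_cls by blast
  then show ?thesis
    by (simp add: quot_alg_def ring.defs module.defs FactRing_def rcoset_mult_def coset_eq_cls)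
qed

lemma Q_smult:
  assumes "f \<in> B"
  shows "c \<odot>\<^bsub>Q\<^esub> cls f = cls (C c * f)"
proof -
  have "cls (C c * x) = cls (C c * f)" if "x \<in> cls f" for x
  proof -
    have "C c * x - C c * f = C c * (x - f)" by (simp add: algebra_simps)
    then show ?thesis
      using that C_B alg_idealD(4)[OF ideal_J] unfolding mem_cls cls_eq_iff by simp
  qed
  then have "(\<Union>x\<in>cls f. cls (C c * x)) = cls (C c * f)"
    using self_in_cls by blast
  then show ?thesis
    by (simp add: quot_alg_def ring.defs module.defs FactRing_def coset_eq_cls)
qed

lemma vectorspace_Q: "vectorspace complex_field Q"
  by (rule vectorspace_image(1)[OF vectorspace_monoid_alg, of cls])
    (simp_all add: Q_carrier Q_add Q_smult Q_zero)

lemma abelian_group_Q: "abelian_group Q"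
  using vectorspace_Q by (simp add: vectorspace_def module_def)

lemma Q_minus: "f \<in> B \<Longrightarrow> g \<in> B \<Longrightarrow> cls f \<ominus>\<^bsub>Q\<^esub> cls g = cls (f - g)"
proof -
  assume fg: "f \<in> B" "g \<in> B"
  have "\<ominus>\<^bsub>Q\<^esub> cls g = cls (- g)"
    by (rule abelian_group.minus_equality[OF abelian_group_Q])
      (use fg uminus_B[OF fg(2)] in \<open>auto simp: Q_add Q_zero Q_carrier\<close>)
  then show ?thesis by (simp add: a_minus_def Q_add)
qed

lemma cring_Q: "cring Q"
proof (rule cringI)
  show "abelian_group Q" by (rule abelian_group_Q)
  show "comm_monoid Q"
  proof (rule comm_monoidI)
    show "x \<otimes>\<^bsub>Q\<^esub> y \<in> carrier Q" if "x \<in> carrier Q" "y \<in> carrier Q" for x y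
      using that mult_B unfolding Q_carrier by (auto simp: Q_mult)
    show "\<one>\<^bsub>Q\<^esub> \<in> carrier Q" using one_B by (auto simp: Q_one Q_carrier)
    show "x \<otimes>\<^bsub>Q\<^esub> y \<otimes>\<^bsub>Q\<^esub> z = x \<otimes>\<^bsub>Q\<^esub> (y \<otimes>\<^bsub>Q\<^esub> z)"
      if "x \<in> carrier Q" "y \<in> carrier Q" "z \<in> carrier Q" for x y z
      using that mult_B unfolding Q_carrier by (auto simp: Q_mult mult.assoc)
    show "\<one>\<^bsub>Q\<^esub> \<otimes>\<^bsub>Q\<^esub> x = x" if "x \<in> carrier Q" for x
      using that one_B unfolding Q_carrier by (auto simp: Q_mult Q_one)
    show "x \<otimes>\<^bsub>Q\<^esub> y = y \<otimes>\<^bsub>Q\<^esub> x" if "x \<in> carrier Q" "y \<in> carrier Q" for x y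
      using that unfolding Q_carrier by (auto simp: Q_mult mult.commute)
  qed
  show "(x \<oplus>\<^bsub>Q\<^esub> y) \<otimes>\<^bsub>Q\<^esub> z = x \<otimes>\<^bsub>Q\<^esub> z \<oplus>\<^bsub>Q\<^esub> y \<otimes>\<^bsub>Q\<^esub> z"
    if "x \<in> carrier Q" "y \<in> carrier Q" "z \<in> carrier Q" for x y z
    using that add_B unfolding Q_carrier
    by (auto simp: Q_mult Q_add distrib_right)
qed

text \<open>As \<open>J\<close> is contained in \<open>P\<close>, whether a coset belongs to the
  image does not depend on its representative.\<close>

lemma primeideal_image:
  assumes P: "alg_prime P" "J \<subseteq> P"
  shows "primeideal (cls ` P) Q"
proof -
  have PI: "alg_ideal P" using P(1) by (simp add: alg_prime_def)
  have mem: "cls f \<in> cls ` P \<longleftrightarrow> f \<in> P" for f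
  proof
    assume "cls f \<in> cls ` P"
    then obtain p where "p \<in> P" "f - p \<in> J" by (auto simp: cls_eq_iff)
    then show "f \<in> P" using alg_idealD(3)[OF PI, of "f - p" p] P(2) by auto
  qed simp
  have PB: "P \<subseteq> B" by (rule alg_idealD(1)[OF PI])
  have Qsub: "cls ` P \<subseteq> carrier Q" unfolding Q_carrier using PB by (rule image_mono)
  have sub: "subgroup (cls ` P) (add_monoid Q)"
  proof
    show "cls ` P \<subseteq> carrier (add_monoid Q)" using Qsub by simp
    show "x \<otimes>\<^bsub>add_monoid Q\<^esub> y \<in> cls ` P" if "x \<in> cls ` P" "y \<in> cls ` P" for x y
      using that alg_idealD(3)[OF PI] by (auto simp: Q_add)
    show "\<one>\<^bsub>add_monoid Q\<^esub> \<in> cls ` P" using alg_idealD(2)[OF PI] by (auto simp: Q_zero)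
    show "inv\<^bsub>add_monoid Q\<^esub> x \<in> cls ` P" if "x \<in> cls ` P" for x
    proof -
      obtain p where p: "p \<in> P" "x = cls p" using \<open>x \<in> cls ` P\<close> by blast
      have "\<ominus>\<^bsub>Q\<^esub> x = cls 0 \<ominus>\<^bsub>Q\<^esub> cls p"
        using p Qsub abelian_group_Q
        by (simp add: a_minus_def Q_zero[symmetric] abelian_group.a_inv_closed
            abelian_monoid.l_zero[OF abelian_group.axioms(1)] subset_iff)
      also have "\<dots> = cls (0 - p)" using p PB zero_B by (intro Q_minus) auto
      finally show ?thesis using alg_ideal_uminus[OF PI p(1)] by (simp add: a_inv_def)
    qed
  qed
  show ?thesis
  proof (rule primeidealI)
    show "ideal (cls ` P) Q"
    proof (rule idealI)
      show "ring Q" using cring_Q by (simp add: cring_def)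
      show "x \<otimes>\<^bsub>Q\<^esub> a \<in> cls ` P" "a \<otimes>\<^bsub>Q\<^esub> x \<in> cls ` P" if "a \<in> cls ` P" "x \<in> carrier Q" for a x
      proof -
        obtain p f where "p \<in> P" "a = cls p" "f \<in> B" "x = cls f"
          using \<open>a \<in> cls ` P\<close> \<open>x \<in> carrier Q\<close> unfolding Q_carrier by blast
        moreover from this have "p \<in> B" using PB by blast
        ultimately show "x \<otimes>\<^bsub>Q\<^esub> a \<in> cls ` P" "a \<otimes>\<^bsub>Q\<^esub> x \<in> cls ` P"
          using alg_idealD(4,5)[OF PI, of p f] Q_mult[of f p] Q_mult[of p f] by auto
      qed
    qed (rule sub)
    show "cring Q" by (rule cring_Q)
    have "cls 1 \<notin> cls ` P" using P(1) by (simp add: mem alg_prime_def)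
    moreover have "cls 1 \<in> carrier Q" unfolding Q_carrier using one_B by (rule imageI)
    ultimately show "carrier Q \<noteq> cls ` P" by blast
    show "a \<in> cls ` P \<or> b \<in> cls ` P"
      if ab: "a \<in> carrier Q" "b \<in> carrier Q" "a \<otimes>\<^bsub>Q\<^esub> b \<in> cls ` P" for a b
    proof -
      obtain f g where fg: "f \<in> B" "a = cls f" "g \<in> B" "b = cls g"
        using ab(1,2) unfolding Q_carrier by blast
      then have "f * g \<in> P" using ab(3) Q_mult[OF fg(1,3)] mem by simp
      then have "f \<in> P \<or> g \<in> P" using P(1) fg(1,3) unfolding alg_prime_def by blast
      then show ?thesis using fg(2,4) by blast
    qed
  qed
qed

text \<open>Distinct nested primes above \<open>J\<close> remain distinct in the quotient and would
  form a chain of length 1.\<close>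

lemma prime_eq_if_krull_dim_0:
  assumes kd: "krull_dim Q \<le> 0"
    and P: "alg_prime P" "alg_prime P'" "J \<subseteq> P" "P \<subseteq> P'"
  shows "P = P'"
proof (rule ccontr)
  assume ne: "P \<noteq> P'"
  have J': "J \<subseteq> P'" using P by blast
  have PI: "alg_ideal P" using P(1) by (simp add: alg_prime_def)
  have "cls ` P \<noteq> cls ` P'"
  proof
    assume eq: "cls ` P = cls ` P'"
    have "P' \<subseteq> P"
    proof
      fix f assume "f \<in> P'"
      then have "cls f \<in> cls ` P" using eq by blast
      then obtain p where "p \<in> P" "f - p \<in> J" by (auto simp: cls_eq_iff)
      then show "f \<in> P" using alg_idealD(3)[OF PI, of "f - p" p] P(3) by auto
    qed
    then show False using ne P(4) by blast
  qed
  then have sub: "cls ` P \<subset> cls ` P'" using P(4) by blast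
  have "prime_chain Q 1 (\<lambda>i. if i = 0 then cls ` P else cls ` P')"
    using primeideal_image[OF P(1,3)] primeideal_image[OF P(2) J'] sub
    by (auto simp: prime_chain_def)
  then have "ereal (real 1) \<le> krull_dim Q"
    unfolding krull_dim_def by (intro SUP_upper) blast
  then show False using kd by (auto dest: order_trans)
qed

lemma algebraic_if_krull_dim_0:
  assumes kd: "krull_dim Q \<le> 0" and A: "countable A" and f: "f \<in> B"
  shows "\<exists>cs. shifts f cs \<in> J"
proof (rule algebraic_if_zero_dim[OF ideal_J _ _ _ f])
  show "countable ((\<lambda>a. Poly_Mapping.single a 1 :: 'a \<Rightarrow>\<^sub>0 complex) ` A)"
    using A by (rule countable_image)
  show "\<exists>F a. finite F \<and> F \<subseteq> (\<lambda>a. Poly_Mapping.single a 1) ` A \<and> b = (\<Sum>m\<in>F. C (a m) * m)"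
    if "b \<in> B" for b
    using that expansion_C[of b] unfolding mem_B by (intro exI conjI) (auto intro: finite_imageI)
  show "P = P'" if "alg_prime P" "alg_prime P'" "J \<subseteq> P" "P \<subseteq> P'" for P P'
    by (rule prime_eq_if_krull_dim_0[OF kd that])
qed

end

section \<open>The local ring at a point as a quotient of the monoid algebra\<close>

locale zero_dim_monoid_algebra = monoid_algebra_ideal +
  assumes algebraic_J: "f \<in> B \<Longrightarrow> \<exists>cs. shifts f cs \<in> J"
begin

sublocale algebraic_quotient C B J
  by unfold_locales (use ideal_J algebraic_J in auto)

context
  fixes \<phi> assumes \<phi>: "point \<phi>"
begin

lemmas \<phi>_simps = alg_characterD[OF point_character[OF \<phi>]]

abbreviation U :: "('a \<Rightarrow>\<^sub>0 complex) set set" where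
  "U \<equiv> {X \<in> carrier Q. \<forall>g\<in>X. \<phi> g \<noteq> 0}"

abbreviation L :: "(complex, (('a \<Rightarrow>\<^sub>0 complex) set \<times> ('a \<Rightarrow>\<^sub>0 complex) set) set) module" where
  "L \<equiv> localization Q U"

text \<open>The class of f / 1 in the localization, written out: all fractions a / b whose
  denominator is nonzero at \<phi> and for which f b and a have the same germ.\<close>

definition germ :: "('a \<Rightarrow>\<^sub>0 complex) \<Rightarrow> (('a \<Rightarrow>\<^sub>0 complex) set \<times> ('a \<Rightarrow>\<^sub>0 complex) set) set" where
  "germ f = {(cls a, cls b) | a b. a \<in> B \<and> b \<in> B \<and> \<phi> b \<noteq> 0 \<and> f * b - a \<in> germ_ker \<phi>}"

lemma cls_value: "f \<in> B \<Longrightarrow> g \<in> cls f \<Longrightarrow> \<phi> g = \<phi> f"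
proof -
  assume f: "f \<in> B" and "g \<in> cls f"
  then have "g - f \<in> J" by (simp add: mem_cls)
  then have "g - f \<in> B" "\<phi> (g - f) = 0"
    using \<phi> alg_idealD(1)[OF ideal_J] by (auto simp: point_def)
  then show "\<phi> g = \<phi> f" using \<phi>_simps(4)[of "g - f" f] f by simp
qed

lemma cls_in_U:
  assumes "f \<in> B"
  shows "cls f \<in> U \<longleftrightarrow> \<phi> f \<noteq> 0"
proof -
  have "(\<forall>g\<in>cls f. \<phi> g \<noteq> 0) \<longleftrightarrow> \<phi> f \<noteq> 0"
    using cls_value[OF assms] self_in_cls[of f] by metis
  moreover have "cls f \<in> carrier Q" using assms by (simp add: Q_carrier)
  ultimately show ?thesis by simp
qed

lemma U_E:
  assumes "X \<in> U"
  obtains f where "f \<in> B" "X = cls f" "\<phi> f \<noteq> 0"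
proof -
  have "X \<in> cls ` B" using assms by (simp add: Q_carrier)
  then obtain f where f: "f \<in> B" "X = cls f" by blast
  then have "\<phi> f \<noteq> 0" using cls_in_U[OF f(1)] assms by simp
  then show ?thesis by (rule that[OF f])
qed

lemma germ_ker_cls: "a \<in> B \<Longrightarrow> b \<in> B \<Longrightarrow> cls a = cls b \<Longrightarrow> a - b \<in> germ_ker \<phi>"
  using J_subset_germ_ker[OF \<phi>] by (auto simp: cls_eq_iff)

text \<open>The multiplier in the relation of fractions is the same witness as in
  \<open>germ_ker\<close>; later computations can therefore stay in \<open>B\<close>.\<close>

lemma frac_rel_cls:
  assumes "r \<in> B" "s \<in> B" "r' \<in> B" "s' \<in> B" "\<phi> s \<noteq> 0" "\<phi> s' \<noteq> 0"
  shows "((cls r, cls s), (cls r', cls s')) \<in> frac_rel Q U \<longleftrightarrow> r * s' - r' * s \<in> germ_ker \<phi>"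
proof -
  have eq: "cls t \<otimes>\<^bsub>Q\<^esub> ((cls r \<otimes>\<^bsub>Q\<^esub> cls s') \<ominus>\<^bsub>Q\<^esub> (cls r' \<otimes>\<^bsub>Q\<^esub> cls s)) = \<zero>\<^bsub>Q\<^esub> \<longleftrightarrow>
      t * (r * s' - r' * s) \<in> J" if "t \<in> B" for t
    using that assms by (simp add: Q_mult Q_minus closed_B Q_zero cls_eq_iff)
  have "cls r \<in> carrier Q" "cls r' \<in> carrier Q" "cls s \<in> U" "cls s' \<in> U"
    using assms cls_in_U[of s] cls_in_U[of s'] by (simp_all add: Q_carrier)
  then have "((cls r, cls s), (cls r', cls s')) \<in> frac_rel Q U \<longleftrightarrow>
      (\<exists>X\<in>U. X \<otimes>\<^bsub>Q\<^esub> ((cls r \<otimes>\<^bsub>Q\<^esub> cls s') \<ominus>\<^bsub>Q\<^esub> (cls r' \<otimes>\<^bsub>Q\<^esub> cls s)) = \<zero>\<^bsub>Q\<^esub>)"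
    by (simp add: frac_rel_def)
  also have "\<dots> \<longleftrightarrow> (\<exists>t\<in>B. \<phi> t \<noteq> 0 \<and> t * (r * s' - r' * s) \<in> J)"
  proof
    assume "\<exists>X\<in>U. X \<otimes>\<^bsub>Q\<^esub> ((cls r \<otimes>\<^bsub>Q\<^esub> cls s') \<ominus>\<^bsub>Q\<^esub> (cls r' \<otimes>\<^bsub>Q\<^esub> cls s)) = \<zero>\<^bsub>Q\<^esub>"
    then obtain X where X: "X \<in> U"
      "X \<otimes>\<^bsub>Q\<^esub> ((cls r \<otimes>\<^bsub>Q\<^esub> cls s') \<ominus>\<^bsub>Q\<^esub> (cls r' \<otimes>\<^bsub>Q\<^esub> cls s)) = \<zero>\<^bsub>Q\<^esub>" ..
    obtain t where "t \<in> B" "X = cls t" "\<phi> t \<noteq> 0" using X(1) by (rule U_E)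
    then show "\<exists>t\<in>B. \<phi> t \<noteq> 0 \<and> t * (r * s' - r' * s) \<in> J" using eq X(2) by auto
  next
    assume "\<exists>t\<in>B. \<phi> t \<noteq> 0 \<and> t * (r * s' - r' * s) \<in> J"
    then obtain t where t: "t \<in> B" "\<phi> t \<noteq> 0" "t * (r * s' - r' * s) \<in> J" by blast
    then show "\<exists>X\<in>U. X \<otimes>\<^bsub>Q\<^esub> ((cls r \<otimes>\<^bsub>Q\<^esub> cls s') \<ominus>\<^bsub>Q\<^esub> (cls r' \<otimes>\<^bsub>Q\<^esub> cls s)) = \<zero>\<^bsub>Q\<^esub>"
      using eq[OF t(1)] cls_in_U[OF t(1)] by (intro bexI[of _ "cls t"]) blast+
  qed
  also have "\<dots> \<longleftrightarrow> r * s' - r' * s \<in> germ_ker \<phi>"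
    using assms closed_B by (auto simp: germ_ker_def)
  finally show ?thesis .
qed

text \<open>Recognizes r / s as f / 1 from a congruence in \<open>B\<close>. All operations of the
  localization are computed through this.\<close>

lemma frac_eq_germ:
  assumes "r \<in> B" "s \<in> B" "f \<in> B" "\<phi> s \<noteq> 0" and fs: "f * s - r \<in> germ_ker \<phi>"
  shows "frac Q U (cls r) (cls s) = germ f"
proof -
  note I = germ_ker_ideal[OF \<phi>]
  have key: "r * b - a * s \<in> germ_ker \<phi> \<longleftrightarrow> f * b - a \<in> germ_ker \<phi>" if ab: "a \<in> B" "b \<in> B" for a b
  proof -
    \<comment> \<open>The two congruences differ by the given one up to the factor \<open>s\<close>,
      and \<open>germ_ker_cancel\<close> removes \<open>s\<close> because it does not vanish at
      \<phi>.\<close>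
    have eq: "r * b - a * s = s * (f * b - a) - b * (f * s - r)" by (simp add: algebra_simps)
    have b: "b * (f * s - r) \<in> germ_ker \<phi>" by (rule alg_idealD(4)[OF I fs ab(2)])
    show ?thesis
    proof
      assume "r * b - a * s \<in> germ_ker \<phi>"
      from alg_idealD(3)[OF I this b] have "s * (f * b - a) \<in> germ_ker \<phi>" by (simp add: eq)
      then show "f * b - a \<in> germ_ker \<phi>"
        using germ_ker_cancel[OF \<phi> assms(2,4)] diff_B[OF mult_B[OF assms(3) ab(2)] ab(1)] by simp
    next
      assume "f * b - a \<in> germ_ker \<phi>"
      then show "r * b - a * s \<in> germ_ker \<phi>"
        unfolding eq by (intro alg_ideal_diff[OF I _ b] alg_idealD(4)[OF I _ assms(2)])
    qed
  qed
  show ?thesis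
  proof
    show "frac Q U (cls r) (cls s) \<subseteq> germ f"
    proof
      fix p assume "p \<in> frac Q U (cls r) (cls s)"
      then have p: "((cls r, cls s), p) \<in> frac_rel Q U" by (simp add: frac_def)
      then obtain X Y where XY: "p = (X, Y)" "X \<in> carrier Q" "Y \<in> U"
        by (cases p) (simp add: frac_rel_def)
      obtain a where a: "a \<in> B" "X = cls a" using XY(2) by (auto simp: Q_carrier)
      obtain b where b: "b \<in> B" "Y = cls b" "\<phi> b \<noteq> 0" using XY(3) by (rule U_E)
      have "r * b - a * s \<in> germ_ker \<phi>"
        using p frac_rel_cls[of r s a b] a b assms XY(1) by simp
      then show "p \<in> germ f" using key a b XY(1) by (auto simp: germ_def)
    qed
    show "germ f \<subseteq> frac Q U (cls r) (cls s)"
    proof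
      fix p assume "p \<in> germ f"
      then obtain a b where ab: "p = (cls a, cls b)" "a \<in> B" "b \<in> B" "\<phi> b \<noteq> 0" "f * b - a \<in> germ_ker \<phi>"
        by (auto simp: germ_def)
      then show "p \<in> frac Q U (cls r) (cls s)"
        using frac_rel_cls[of r s a b] key assms by (simp add: frac_def)
    qed
  qed
qed

lemma self_in_germ: "f \<in> B \<Longrightarrow> (cls f, cls 1) \<in> germ f"
  using one_B \<phi>_simps(2) alg_idealD(2)[OF germ_ker_ideal[OF \<phi>]]
  unfolding germ_def by (intro CollectI exI[of _ f] exI[of _ 1] conjI refl) simp_all

lemma germ_eq_iff:
  assumes "f \<in> B" "g \<in> B"
  shows "germ f = germ g \<longleftrightarrow> f - g \<in> germ_ker \<phi>"
proof
  assume fg: "f - g \<in> germ_ker \<phi>"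
  have "frac Q U (cls g) (cls 1) = germ f"
    by (rule frac_eq_germ) (use assms one_B \<phi>_simps(2) fg in auto)
  moreover have "frac Q U (cls g) (cls 1) = germ g"
    by (rule frac_eq_germ)
      (use assms one_B \<phi>_simps(2) alg_idealD(2)[OF germ_ker_ideal[OF \<phi>]] in auto)
  ultimately show "germ f = germ g" by simp
next
  note I = germ_ker_ideal[OF \<phi>]
  assume "germ f = germ g"
  then have "(cls g, cls 1) \<in> germ f" using self_in_germ[OF assms(2)] by simp
  then obtain a b where ab: "cls g = cls a" "cls 1 = cls b" "a \<in> B" "b \<in> B" "f * b - a \<in> germ_ker \<phi>"
    by (auto simp: germ_def)
  have "f - g = f * (1 - b) + (f * b - a) + (a - g)" by (simp add: algebra_simps)
  also have "\<dots> \<in> germ_ker \<phi>"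
    using ab assms one_B germ_ker_cls[of 1 b] germ_ker_cls[of a g]
    by (intro alg_idealD(3)[OF I] alg_idealD(4)[OF I]) auto
  finally show "f - g \<in> germ_ker \<phi>" .
qed

text \<open>If \<open>v\<close> inverts the denominator \<open>s\<close> in the germ, then r / s is
  the germ of \<open>r * v\<close>: localizing adds nothing to the image of
  \<open>B\<close>.\<close>

lemma L_carrier: "carrier L = germ ` B"
proof
  note I = germ_ker_ideal[OF \<phi>]
  show "carrier L \<subseteq> germ ` B"
  proof
    fix x assume "x \<in> carrier L"
    then obtain X Y where XY: "X \<in> carrier Q" "Y \<in> U" "x = frac Q U X Y"
      by (auto simp: localization_def quotient_def frac_def)
    obtain r where r: "r \<in> B" "X = cls r" using XY(1) by (auto simp: Q_carrier)
    obtain s where s: "s \<in> B" "Y = cls s" "\<phi> s \<noteq> 0" using XY(2) by (rule U_E)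
    obtain v where v: "v \<in> B" "1 - s * v \<in> germ_ker \<phi>" using germ_unit[OF \<phi> s(1,3)] by blast
    have "r * v * s - r = - r * (1 - s * v)" by (simp add: algebra_simps)
    also have "\<dots> \<in> germ_ker \<phi>" using r v uminus_B by (intro alg_idealD(4)[OF I]) auto
    finally have "x = germ (r * v)"
      unfolding XY(3) r(2) s(2) using r s v by (intro frac_eq_germ mult_B)
    then show "x \<in> germ ` B" using mult_B[OF r(1) v(1)] by blast
  qed
  show "germ ` B \<subseteq> carrier L"
  proof
    fix x assume "x \<in> germ ` B"
    then obtain f where f: "f \<in> B" "x = germ f" by blast
    have "x = frac Q U (cls f) (cls 1)"
      unfolding f(2)
      by (rule frac_eq_germ[symmetric])
        (use f one_B \<phi>_simps(2) alg_idealD(2)[OF I] in auto)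
    moreover have "cls f \<in> carrier Q" "cls 1 \<in> U"
      using f one_B \<phi>_simps(2) cls_in_U[OF one_B] by (simp_all add: Q_carrier)
    ultimately show "x \<in> carrier L"
      by (auto simp: localization_def quotient_def frac_def)
  qed
qed

lemma germ_cases:
  assumes "p \<in> germ f"
  obtains a b where "p = (cls a, cls b)" "a \<in> B" "b \<in> B" "\<phi> b \<noteq> 0" "f * b - a \<in> germ_ker \<phi>"
  using assms by (auto simp: germ_def)

lemma L_add:
  assumes f: "f \<in> B" and g: "g \<in> B"
  shows "germ f \<oplus>\<^bsub>L\<^esub> germ g = germ (f + g)"
proof -
  note I = germ_ker_ideal[OF \<phi>]
  have "frac Q U ((r \<otimes>\<^bsub>Q\<^esub> s') \<oplus>\<^bsub>Q\<^esub> (r' \<otimes>\<^bsub>Q\<^esub> s)) (s \<otimes>\<^bsub>Q\<^esub> s') = germ (f + g)"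
    if "(r, s) \<in> germ f" "(r', s') \<in> germ g" for r s r' s'
  proof -
    obtain a b where ab: "(r, s) = (cls a, cls b)" "a \<in> B" "b \<in> B" "\<phi> b \<noteq> 0"
      "f * b - a \<in> germ_ker \<phi>"
      using \<open>(r, s) \<in> germ f\<close> by (rule germ_cases)
    obtain a' b' where ab': "(r', s') = (cls a', cls b')" "a' \<in> B" "b' \<in> B" "\<phi> b' \<noteq> 0"
      "g * b' - a' \<in> germ_ker \<phi>"
      using \<open>(r', s') \<in> germ g\<close> by (rule germ_cases)
    have eq: "(f + g) * (b * b') - (a * b' + a' * b) = b' * (f * b - a) + b * (g * b' - a')"
      by (simp add: algebra_simps)
    have "frac Q U (cls (a * b' + a' * b)) (cls (b * b')) = germ (f + g)"
    proof (rule frac_eq_germ)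
      show "(f + g) * (b * b') - (a * b' + a' * b) \<in> germ_ker \<phi>"
        unfolding eq using ab ab' by (intro alg_idealD(3)[OF I] alg_idealD(4)[OF I])
    qed (use ab ab' f g \<phi>_simps(5) in \<open>auto intro!: closed_B\<close>)
    then show ?thesis using ab ab' by (simp add: Q_mult Q_add mult_B)
  qed
  moreover have "germ f \<noteq> {}" "germ g \<noteq> {}" using self_in_germ[OF f] self_in_germ[OF g] by auto
  ultimately have "(\<Union>(r, s)\<in>germ f. \<Union>(r', s')\<in>germ g.
      frac Q U ((r \<otimes>\<^bsub>Q\<^esub> s') \<oplus>\<^bsub>Q\<^esub> (r' \<otimes>\<^bsub>Q\<^esub> s)) (s \<otimes>\<^bsub>Q\<^esub> s')) = germ (f + g)"
    by (intro UN_pairs_const)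
  then show ?thesis by (simp add: localization_def)
qed

lemma L_smult:
  assumes f: "f \<in> B"
  shows "c \<odot>\<^bsub>L\<^esub> germ f = germ (C c * f)"
proof -
  note I = germ_ker_ideal[OF \<phi>]
  have "frac Q U (c \<odot>\<^bsub>Q\<^esub> r) s = germ (C c * f)" if "(r, s) \<in> germ f" for r s
  proof -
    obtain a b where ab: "(r, s) = (cls a, cls b)" "a \<in> B" "b \<in> B" "\<phi> b \<noteq> 0"
      "f * b - a \<in> germ_ker \<phi>"
      using \<open>(r, s) \<in> germ f\<close> by (rule germ_cases)
    have eq: "C c * f * b - C c * a = C c * (f * b - a)" by (simp add: algebra_simps)
    have "frac Q U (cls (C c * a)) (cls b) = germ (C c * f)"
    proof (rule frac_eq_germ)
      show "C c * f * b - C c * a \<in> germ_ker \<phi>"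
        unfolding eq using ab C_B by (intro alg_idealD(4)[OF I])
    qed (use ab f in \<open>auto intro!: closed_B\<close>)
    then show ?thesis using ab by (simp add: Q_smult)
  qed
  moreover have "germ f \<noteq> {}" using self_in_germ[OF f] by auto
  ultimately have "(\<Union>(r, s)\<in>germ f. frac Q U (c \<odot>\<^bsub>Q\<^esub> r) s) = germ (C c * f)"
    by (intro UN_pairs_const)
  then show ?thesis by (simp add: localization_def)
qed

lemma L_zero: "\<zero>\<^bsub>L\<^esub> = germ 0"
proof -
  have "frac Q U (cls 0) (cls 1) = germ 0"
    by (rule frac_eq_germ)
      (use zero_B one_B \<phi>_simps(2) alg_idealD(2)[OF germ_ker_ideal[OF \<phi>]] in auto)
  then show ?thesis by (simp add: localization_def Q_zero Q_one)
qed

lemma local_ring_vectorspace: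
  "vectorspace complex_field L" "linear_map complex_field (monoid_alg A) L germ"
  using vectorspace_image[OF vectorspace_monoid_alg, of germ L]
  by (simp_all add: L_carrier L_add L_smult L_zero)

text \<open>The germs of a set that spans modulo \<open>J\<close> span the local ring. This
  finiteness is what makes \<open>vectorspace.dim\<close> an actual dimension.\<close>

lemma has_vdim_local_ring:
  assumes F: "finite F" "F \<subseteq> B" "B \<subseteq> mspan F"
  shows "has_vdim L (vectorspace.dim complex_field L)"
proof -
  interpret L: vectorspace complex_field L by (rule local_ring_vectorspace)
  interpret T: linear_map complex_field "monoid_alg A" L germ by (rule local_ring_vectorspace)
  have gF: "germ ` F \<subseteq> carrier L" using F(2) by (auto simp: L_carrier)
  have span: "germ g \<in> L.span (germ ` F)" if "g = (\<Sum>m\<in>F'. C (a m) * m)" "F' \<subseteq> F" for g F' a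
  proof -
    have "finite F'" using that(2) F(1) by (rule finite_subset)
    then show ?thesis using that
    proof (induction F' arbitrary: g rule: finite_induct)
      case empty
      then show ?case using L.span_zero by (simp add: L_zero)
    next
      case (insert m F')
      have FB: "F' \<subseteq> B" "m \<in> B" using insert.prems(2) F(2) by auto
      let ?h = "\<Sum>m\<in>F'. C (a m) * m"
      have hB: "?h \<in> B" using FB by (auto intro!: sum_B mult_B C_B)
      have "germ g = germ (C (a m) * m) \<oplus>\<^bsub>L\<^esub> germ ?h"
        using insert FB hB by (simp add: L_add mult_B C_B)
      also have "germ (C (a m) * m) = a m \<odot>\<^bsub>L\<^esub> germ m" using FB by (simp add: L_smult)
      finally have eq: "germ g = a m \<odot>\<^bsub>L\<^esub> germ m \<oplus>\<^bsub>L\<^esub> germ ?h" .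
      have "germ m \<in> L.span (germ ` F)" using insert.prems(2) gF by (intro L.span_mem) auto
      moreover have "germ ?h \<in> L.span (germ ` F)" using insert by blast
      moreover have "submodule complex_field (L.span (germ ` F)) L"
        by (rule L.span_is_submodule[OF gF])
      ultimately show ?case unfolding eq by (simp add: submodule_def)
    qed
  qed
  have "carrier L \<subseteq> L.span (germ ` F)"
  proof
    fix x assume "x \<in> carrier L"
    then obtain f where f: "f \<in> B" "x = germ f" by (auto simp: L_carrier)
    obtain j a where ja: "j \<in> J" "f = j + (\<Sum>m\<in>F. C (a m) * m)"
      using mspanE[OF subsetD[OF F(3) f(1)]] .
    have "(\<Sum>m\<in>F. C (a m) * m) \<in> B" using F(2) by (auto intro!: sum_B mult_B C_B)
    then have "x = germ (\<Sum>m\<in>F. C (a m) * m)"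
      using f ja J_subset_germ_ker[OF \<phi>] by (auto simp: germ_eq_iff)
    then show "x \<in> L.span (germ ` F)" using span by blast
  qed
  moreover have "L.span (germ ` F) \<subseteq> carrier L" using gF by (rule L.span_is_subset2)
  ultimately have "L.fin_dim" unfolding L.fin_dim_def using F(1) gF by blast
  then show ?thesis using L.vectorspace_axioms by (simp add: has_vdim_def)
qed

text \<open>Coordinates of the local ring are pulled back along \<open>germ\<close>; from here on
  the localization itself is no longer touched.\<close>

lemma germ_coordinates_exist:
  assumes F: "finite F" "F \<subseteq> B" "B \<subseteq> mspan F"
  shows "\<exists>\<theta>. coordinates_mod (germ_ker \<phi>) (vectorspace.dim complex_field L) \<theta>"
proof -
  let ?d = "vectorspace.dim complex_field L"
  obtain \<eta> where \<eta>: "linear_coordinates L ?d \<eta>"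
    using has_vdim_coordinates[OF has_vdim_local_ring[OF F]] ..
  have gL: "germ f \<in> carrier L" if "f \<in> B" for f using that by (simp add: L_carrier)
  have "coordinates_mod (germ_ker \<phi>) ?d (\<lambda>f. \<eta> (germ f))"
    unfolding coordinates_mod_def
  proof (intro conjI allI ballI impI)
    show "\<eta> (germ (f + g)) i = \<eta> (germ f) i + \<eta> (germ g) i" if "f \<in> B" "g \<in> B" "i < ?d" for f g i
      unfolding L_add[OF that(1,2), symmetric]
      by (rule linear_coordinatesD(1)[OF \<eta> gL[OF that(1)] gL[OF that(2)] that(3)])
    show "\<eta> (germ (C c * f)) i = c * \<eta> (germ f) i" if "f \<in> B" "i < ?d" for c f i
      unfolding L_smult[OF that(1), symmetric]
      by (rule linear_coordinatesD(2)[OF \<eta> gL[OF that(1)] that(2)])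
    show "(\<forall>i<?d. \<eta> (germ f) i = \<eta> (germ g) i) \<longleftrightarrow> f - g \<in> germ_ker \<phi>" if "f \<in> B" "g \<in> B" for f g
    proof -
      have "(\<forall>i<?d. \<eta> (germ f) i = \<eta> (germ g) i) \<longleftrightarrow> germ f = germ g"
      proof
        assume "\<forall>i<?d. \<eta> (germ f) i = \<eta> (germ g) i"
        then show "germ f = germ g" by (rule linear_coordinatesD(3)[OF \<eta> gL[OF that(1)] gL[OF that(2)]])
      next
        assume "germ f = germ g"
        then show "\<forall>i<?d. \<eta> (germ f) i = \<eta> (germ g) i" by simp
      qed
      then show ?thesis by (simp only: germ_eq_iff[OF that])
    qed
    show "\<exists>f\<in>B. \<forall>i<?d. \<eta> (germ f) i = c i" for c
    proof -
      obtain v where v: "v \<in> carrier L" "\<forall>i<?d. \<eta> v i = c i"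
        using linear_coordinatesD(4)[OF \<eta>, of c] by (rule bexE)
      obtain f where "f \<in> B" "v = germ f" using v(1) unfolding L_carrier by (rule imageE)
      then show ?thesis using v(2) by (intro bexI[of _ f]) simp_all
    qed
  qed
  then show ?thesis by blast
qed

end

end

section \<open>Lattice points of cones and fans\<close>

lemma monotone_subsequence_nat:
  fixes s :: "nat \<Rightarrow> nat"
  shows "\<exists>r. strict_mono r \<and> incseq (\<lambda>n. s (r n))"
proof -
  obtain r where r: "strict_mono r" "monoseq (\<lambda>n. s (r n))" using seq_monosub by blast
  show ?thesis
  proof (cases "incseq (\<lambda>n. s (r n))")
    case True
    then show ?thesis using r by blast
  next
    case False
    then have dec: "decseq (\<lambda>n. s (r n))" using r(2) by (simp add: monoseq_iff)
    \<comment> \<open>\<open>N\<close> is an index at which the decreasing subsequence attains its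
      minimum; after it the subsequence is constant.\<close>
    define N where "N = (ARG_MIN (\<lambda>n. s (r n)) n. True)"
    have N: "s (r N) \<le> s (r n)" for n unfolding N_def by (rule arg_min_nat_le) simp
    have "s (r (n + N)) = s (r N)" for n
      using N[of "n + N"] decseqD[OF dec, of N "n + N"] by simp
    moreover have "strict_mono (\<lambda>n. r (n + N))" using r(1) by (simp add: strict_mono_def)
    ultimately show ?thesis by (intro exI[of _ "\<lambda>n. r (n + N)"]) simp
  qed
qed

text \<open>The sequence is thinned for one coordinate after another, and passing to a further
  subsequence keeps the monotonicity already gained.\<close>

lemma dickson:
  fixes f :: "nat \<Rightarrow> 'i \<Rightarrow> nat"
  assumes "finite I"
  shows "\<exists>r. strict_mono r \<and> (\<forall>i\<in>I. incseq (\<lambda>n. f (r n) i))"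
  using assms
proof (induction I rule: finite_induct)
  case empty
  show ?case by (intro exI[of _ id]) (simp add: strict_mono_def)
next
  case (insert i I)
  then obtain r where r: "strict_mono r" "\<And>j. j \<in> I \<Longrightarrow> incseq (\<lambda>n. f (r n) j)" by blast
  obtain s where s: "strict_mono s" "incseq (\<lambda>n. f (r (s n)) i)"
    using monotone_subsequence_nat[of "\<lambda>n. f (r n) i"] by blast
  have "incseq (\<lambda>n. f (r (s n)) j)" if "j \<in> I" for j
    using r(2)[OF that] s(1) by (auto simp: incseq_def strict_mono_less_eq)
  moreover have "strict_mono (\<lambda>n. r (s n))" using r(1) s(1) by (simp add: strict_mono_def)
  ultimately show ?case using s(2) by (intro exI[of _ "\<lambda>n. r (s n)"]) simp
qed

definition ipair :: "int ^ 'n \<Rightarrow> int ^ 'n \<Rightarrow> int" where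
  "ipair m v = (\<Sum>j\<in>UNIV. m $ j * v $ j)"

lemma inner_rvec: "rvec m \<bullet> rvec v = of_int (ipair m v)"
  by (simp add: inner_vec_def rvec_def ipair_def)

lemma ipair_linear:
  "ipair (m + m') v = ipair m v + ipair m' v" "ipair (m - m') v = ipair m v - ipair m' v"
  "ipair (c *s m) v = c * ipair m v" "ipair 0 v = 0"
  by (simp_all add: ipair_def distrib_right left_diff_distrib sum.distrib sum_subtractf
      sum_distrib_left mult.assoc)

text \<open>The l1 norm, used as the measure for descent on lattice points.\<close>

definition lattice_size :: "int ^ 'n \<Rightarrow> nat" where
  "lattice_size m = (\<Sum>j\<in>UNIV. nat \<bar>m $ j\<bar>)"

lemma lattice_size_eq_0: "lattice_size m = 0 \<longleftrightarrow> m = 0"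
  by (auto simp: lattice_size_def vec_eq_iff)

text \<open>Gordan's lemma. A lattice point is encoded by the positive and negative parts of its coordinates
  and its pairings with \<open>V\<close>; differences of comparable points stay in the monoid and in the same
  orthant, so that by Dickson's lemma the minimal points are finitely many and generate.\<close>

lemma gordan:
  fixes V :: "(int ^ 'n) set"
  assumes "finite V"
  shows "\<exists>G. finite G \<and> G \<subseteq> {m. \<forall>v\<in>V. 0 \<le> ipair m v} \<and>
    (\<forall>m. (\<forall>v\<in>V. 0 \<le> ipair m v) \<longrightarrow> (\<exists>k::int ^ 'n \<Rightarrow> nat. m = (\<Sum>g\<in>G. int (k g) *s g)))"
proof -
  define M where "M = {m. \<forall>v\<in>V. 0 \<le> ipair m v}"
  define le where "le m m' \<longleftrightarrow> (\<forall>j. nat (m $ j) \<le> nat (m' $ j) \<and> nat (- m $ j) \<le> nat (- m' $ j)) \<and>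
    (\<forall>v\<in>V. ipair m v \<le> ipair m' v)" for m m'
  have diffM: "m' - m \<in> M" if "le m m'" for m m'
    using that by (auto simp: le_def M_def ipair_linear)
  \<comment> \<open>Comparable points share an orthant with their difference, where the l1 norm is
    additive.\<close>
  have size: "lattice_size m' = lattice_size m + lattice_size (m' - m)" if "le m m'" for m m'
  proof -
    have "nat \<bar>m' $ j\<bar> = nat \<bar>m $ j\<bar> + nat \<bar>(m' - m) $ j\<bar>" for j
    proof -
      have "nat (m $ j) \<le> nat (m' $ j)" "nat (- m $ j) \<le> nat (- m' $ j)"
        using that by (auto simp: le_def)
      then show ?thesis by (simp add: nat_le_eq_zle) linarith
    qed
    then show ?thesis by (simp add: lattice_size_def sum.distrib)
  qed
  define G where "G = {m \<in> M - {0}. \<forall>m'\<in>M - {0}. le m' m \<longrightarrow> m' = m}"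
  have "finite G"
  proof (rule ccontr)
    assume "infinite G"
    then obtain f :: "nat \<Rightarrow> int ^ 'n" where f: "inj f" "range f \<subseteq> G"
      using infinite_countable_subset by blast
    \<comment> \<open>The index set is a disjoint sum: positive parts, negative parts, and pairings
      with \<open>V\<close>. Truncating the pairings to naturals is harmless, since they are
      nonnegative on \<open>M\<close>.\<close>
    define e where "e n = (\<lambda>x. case x of Inl j \<Rightarrow> nat (f n $ j)
      | Inr y \<Rightarrow> (case y of Inl j \<Rightarrow> nat (- f n $ j) | Inr v \<Rightarrow> nat (ipair (f n) v)))" for n
    let ?I = "UNIV <+> (UNIV <+> V) :: ('n + 'n + int ^ 'n) set"
    have "finite ?I" using assms by (intro finite_Plus finite)
    then obtain r where r: "strict_mono r" "\<And>i. i \<in> ?I \<Longrightarrow> incseq (\<lambda>n. e (r n) i)"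
      using dickson[of ?I e] by blast
    have mono: "e (r 0) i \<le> e (r 1) i" if "i \<in> ?I" for i
      using incseqD[OF r(2)[OF that], of 0 1] by simp
    have I: "Inl j \<in> ?I" "Inr (Inl j) \<in> ?I" "v \<in> V \<Longrightarrow> Inr (Inr v) \<in> ?I" for j v
      by auto
    have fG: "f n \<in> G" for n using f(2) by blast
    have "le (f (r 0)) (f (r 1))"
      unfolding le_def
    proof (intro conjI allI ballI)
      show "nat (f (r 0) $ j) \<le> nat (f (r 1) $ j)" for j
        using mono[OF I(1)[of j]] by (simp add: e_def)
      show "nat (- f (r 0) $ j) \<le> nat (- f (r 1) $ j)" for j
        using mono[OF I(2)[of j]] by (simp add: e_def)
      show "ipair (f (r 0)) v \<le> ipair (f (r 1)) v" if v: "v \<in> V" for v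
      proof -
        have "0 \<le> ipair (f (r 1)) v" using fG[of "r 1"] v by (auto simp: G_def M_def)
        then show ?thesis using mono[OF I(3)[OF v]] by (simp add: e_def)
      qed
    qed
    then have "f (r 0) = f (r 1)" using fG[of "r 0"] fG[of "r 1"] by (auto simp: G_def)
    then have "r 0 = r 1" using f(1) by (simp add: inj_eq)
    then show False using r(1) by (simp add: strict_mono_eq)
  qed
  have below: "\<exists>g\<in>G. le g m" if "m \<in> M - {0}" for m
    using that
  proof (induction "lattice_size m" arbitrary: m rule: less_induct)
    case less
    show ?case
    proof (cases "m \<in> G")
      case True
      then show ?thesis by (intro bexI[of _ m]) (auto simp: le_def)
    next
      case False
      then obtain m' where m': "m' \<in> M - {0}" "le m' m" "m' \<noteq> m" using less.prems by (auto simp: G_def)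
      have "lattice_size (m - m') \<noteq> 0" using m'(3) by (simp add: lattice_size_eq_0)
      then have "lattice_size m' < lattice_size m" using size[OF m'(2)] by simp
      then obtain g where "g \<in> G" "le g m'" using less.hyps m'(1) by blast
      then show ?thesis using m'(2) by (intro bexI[of _ g]) (auto simp: le_def intro: order_trans)
    qed
  qed
  have gen: "\<exists>k::int ^ 'n \<Rightarrow> nat. m = (\<Sum>g\<in>G. int (k g) *s g)" if "m \<in> M" for m
    using that
  proof (induction "lattice_size m" arbitrary: m rule: less_induct)
    case less
    show ?case
    proof (cases "m = 0")
      case True
      then show ?thesis by (intro exI[of _ "\<lambda>_. 0"]) simp
    next
      case False
      then obtain g where g: "g \<in> G" "le g m" using below less.prems by blast
      have "lattice_size g \<noteq> 0" using g(1) by (auto simp: lattice_size_eq_0 G_def)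
      then have "lattice_size (m - g) < lattice_size m" using size[OF g(2)] by simp
      then obtain k :: "int ^ 'n \<Rightarrow> nat" where k: "m - g = (\<Sum>g\<in>G. int (k g) *s g)"
        using less.hyps diffM[OF g(2)] by blast
      have "(\<Sum>h\<in>G. int ((k(g := Suc (k g))) h) *s h) = (\<Sum>h\<in>G. int (k h) *s h + (if h = g then g else 0))"
      proof (intro sum.cong refl)
        show "int ((k(g := Suc (k g))) h) *s h = int (k h) *s h + (if h = g then g else 0)" for h
        proof (cases "h = g")
          case True
          show ?thesis unfolding True by (simp add: vec_eq_iff algebra_simps)
        qed simp
      qed
      also have "\<dots> = m" using \<open>finite G\<close> g(1) k[symmetric] by (simp add: sum.distrib)
      finally show ?thesis by metis
    qed
  qed
  show ?thesis
    using \<open>finite G\<close> gen unfolding M_def G_def by (intro exI[of _ G]) (auto simp: G_def M_def)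
qed

lemma mem_dual_monoid_hull:
  "m \<in> dual_monoid (convex_cone hull (rvec ` V)) \<longleftrightarrow> (\<forall>v\<in>V. 0 \<le> ipair m v)"
proof
  assume "m \<in> dual_monoid (convex_cone hull (rvec ` V))"
  then have "0 \<le> rvec m \<bullet> rvec v" if "v \<in> V" for v
    using that by (auto simp: dual_monoid_def intro: hull_inc)
  then show "\<forall>v\<in>V. 0 \<le> ipair m v" by (simp add: inner_rvec)
next
  assume "\<forall>v\<in>V. 0 \<le> ipair m v"
  then have "rvec ` V \<subseteq> {x. 0 \<le> rvec m \<bullet> x}" by (auto simp: inner_rvec)
  then have "convex_cone hull (rvec ` V) \<subseteq> {x. 0 \<le> rvec m \<bullet> x}"
    by (rule hull_minimal) (rule convex_cone_halfspace_ge)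
  then show "m \<in> dual_monoid (convex_cone hull (rvec ` V))" by (auto simp: dual_monoid_def)
qed

text \<open>Rounding a real point with a small error, after scaling it, makes all pairings with a finite set
  of lattice points that vanish or are positive keep this property.\<close>

lemma integral_functional:
  fixes a :: "real ^ 'n" and V :: "(int ^ 'n) set"
  assumes fin: "finite V" and nonneg: "\<And>v. v \<in> V \<Longrightarrow> 0 \<le> a \<bullet> rvec v"
  obtains m :: "int ^ 'n" where "\<And>v. v \<in> V \<Longrightarrow> a \<bullet> rvec v = 0 \<Longrightarrow> ipair m v = 0"
    "\<And>v. v \<in> V \<Longrightarrow> 0 < a \<bullet> rvec v \<Longrightarrow> 0 < ipair m v"
proof -
  \<comment> \<open>\<open>K\<close> bounds the l1 norm of every vector of \<open>V\<close>; the
    summand 1 keeps it positive.\<close>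
  define K where "K = 1 + (\<Sum>v\<in>V. \<Sum>j\<in>UNIV. \<bar>real_of_int (v $ j)\<bar>)"
  \<comment> \<open>At most 1, so that an integer closer to 0 than \<delta> vanishes; at most every
    positive pairing, so that an error below \<delta> cannot cancel one.\<close>
  define \<delta> where "\<delta> = Min (insert 1 ((\<lambda>v. a \<bullet> rvec v) ` {v \<in> V. 0 < a \<bullet> rvec v}))"
  have K: "K \<ge> 1" unfolding K_def by (simp add: sum_nonneg)
  have \<delta>0: "\<delta> > 0" unfolding \<delta>_def using fin by (subst Min_gr_iff) auto
  have \<delta>1: "\<delta> \<le> 1" unfolding \<delta>_def using fin by (intro Min_le) auto
  have \<delta>: "\<delta> \<le> a \<bullet> rvec v" if "v \<in> V" "0 < a \<bullet> rvec v" for v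
    unfolding \<delta>_def using fin that by (intro Min_le) auto
  obtain N :: nat where N: "K / \<delta> < real N" using reals_Archimedean2 by blast
  have "K / \<delta> > 0" using K \<delta>0 by simp
  then have N0: "N > 0" using N by simp
  \<comment> \<open>Dirichlet's simultaneous approximation numbers the coordinates by naturals,
    hence this enumeration of the index type.\<close>
  obtain h :: "nat \<Rightarrow> 'n" where h: "bij_betw h {0..<CARD('n)} UNIV"
    using ex_bij_betw_nat_finite[of "UNIV :: 'n set"] by auto
  define h' where "h' = the_inv_into {0..<CARD('n)} h"
  have h': "h' j < CARD('n)" "h (h' j) = j" for j
    using h f_the_inv_into_f[of h "{0..<CARD('n)}" j] the_inv_into_into[of h "{0..<CARD('n)}" j "{0..<CARD('n)}"]
    by (auto simp: h'_def bij_betw_def)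
  obtain q p where q: "0 < q" and pq: "\<And>i. i < CARD('n) \<Longrightarrow> \<bar>of_int q * a $ h i - of_int (p i)\<bar> < 1 / N"
    using Dirichlet_approx_simult[OF N0, of "CARD('n)" "\<lambda>i. a $ h i"] by metis
  define m :: "int ^ 'n" where "m = (\<chi> j. p (h' j))"
  have close: "\<bar>of_int q * a $ j - of_int (m $ j)\<bar> < 1 / N" for j
    using pq[OF h'(1)[of j]] by (simp add: m_def h'(2))
  have err: "\<bar>of_int q * (a \<bullet> rvec v) - of_int (ipair m v)\<bar> < \<delta>" if "v \<in> V" for v
  proof -
    have "of_int q * (a \<bullet> rvec v) - of_int (ipair m v)
        = (\<Sum>j\<in>UNIV. (of_int q * a $ j - of_int (m $ j)) * of_int (v $ j))"
      by (simp add: inner_vec_def rvec_def ipair_def sum_distrib_left sum_subtractf[symmetric] algebra_simps)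
    also have "\<bar>\<dots>\<bar> \<le> (\<Sum>j\<in>UNIV. \<bar>(of_int q * a $ j - of_int (m $ j)) * of_int (v $ j)\<bar>)"
      by (rule sum_abs)
    also have "\<dots> \<le> (\<Sum>j\<in>UNIV. 1 / N * \<bar>real_of_int (v $ j)\<bar>)"
      unfolding abs_mult using close by (intro sum_mono mult_right_mono) (auto intro: less_imp_le)
    also have "\<dots> = 1 / N * (\<Sum>j\<in>UNIV. \<bar>real_of_int (v $ j)\<bar>)" by (simp add: sum_distrib_left)
    also have "\<dots> \<le> 1 / N * K"
    proof (rule mult_left_mono)
      have "(\<Sum>j\<in>UNIV. \<bar>real_of_int (v $ j)\<bar>) \<le> (\<Sum>v\<in>V. \<Sum>j\<in>UNIV. \<bar>real_of_int (v $ j)\<bar>)"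
        using that fin by (intro member_le_sum) (auto intro: sum_nonneg)
      then show "(\<Sum>j\<in>UNIV. \<bar>real_of_int (v $ j)\<bar>) \<le> K" by (simp add: K_def)
    qed simp
    also have "\<dots> < \<delta>" using N N0 \<delta>0 by (simp add: field_simps)
    finally show ?thesis .
  qed
  show ?thesis
  proof (rule that[of m])
    show "ipair m v = 0" if "v \<in> V" "a \<bullet> rvec v = 0" for v
      using err[OF that(1)] that(2) \<delta>1 by simp
    show "0 < ipair m v" if "v \<in> V" "0 < a \<bullet> rvec v" for v
    proof -
      \<comment> \<open>The denominator \<open>q\<close> is a positive integer, so scaling leaves
        the pairing at least \<delta>, above the error.\<close>
      have "1 * (a \<bullet> rvec v) \<le> of_int q * (a \<bullet> rvec v)"
        using q that by (intro mult_right_mono) auto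
      then have "0 < real_of_int (ipair m v)" using err[OF that(1)] \<delta>[OF that] by linarith
      then show ?thesis by simp
    qed
  qed
qed

section \<open>Rational cones and the generators of rays\<close>

lemma rational_cone_convex_cone: "rational_cone \<sigma> \<Longrightarrow> convex_cone \<sigma>"
  by (auto simp: rational_cone_def convex_cone_convex_cone_hull)

lemma rvec_simps: "rvec (m + m') = rvec m + rvec m'" "rvec (m - m') = rvec m - rvec m'"
  "rvec (- m) = - rvec m" "rvec 0 = 0" "rvec (c *s m) = of_int c *\<^sub>R rvec m"
  by (simp_all add: rvec_def vec_eq_iff)

lemma rvec_eq_iff: "rvec m = rvec m' \<longleftrightarrow> m = m'"
  by (simp add: rvec_def vec_eq_iff)

text \<open>The generator is a nonzero lattice point of least l1 norm on the ray: division with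
  remainder by it would otherwise leave a shorter one.\<close>

lemma ray_generator_exists:
  assumes r: "rational_cone r" "strongly_convex r" "dim r = 1"
  shows "\<exists>u. u \<noteq> 0 \<and> r = {t *\<^sub>R rvec u | t. 0 \<le> t} \<and>
    {m. rvec m \<in> r} = range (\<lambda>j::nat. \<chi> i. int j * u $ i)"
proof -
  obtain V where V: "finite V" "r = convex_cone hull (rvec ` V)" using r(1) by (auto simp: rational_cone_def)
  have cc: "convex_cone r" by (rule rational_cone_convex_cone[OF r(1)])
  have "\<exists>w\<in>V. w \<noteq> 0"
  proof (rule ccontr)
    assume "\<not> ?thesis"
    then have "rvec ` V \<subseteq> {0}" by (auto simp: rvec_simps)
    then have "r \<subseteq> {0}" unfolding V(2) by (rule hull_minimal) simp
    then show False using r(3) dim_subset[of r "{0}"] by simp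
  qed
  then obtain w where w: "w \<in> V" "w \<noteq> 0" by blast
  have wr: "rvec w \<in> r" unfolding V(2) using w by (simp add: hull_inc)
  have w0: "rvec w \<noteq> 0" using w(2) rvec_eq_iff[of w 0] by (simp add: rvec_simps)
  have "r \<subseteq> span {rvec w}"
    using wr w0 r(3) by (intro card_ge_dim_independent) auto
  \<comment> \<open>A negative multiple of \<open>w\<close> in the cone would put \<open>- w\<close>
    there too, against strong convexity.\<close>
  have on_line: "\<exists>c\<ge>0. x = c *\<^sub>R rvec w" if x: "x \<in> r" for x
  proof -
    obtain c where c: "x = c *\<^sub>R rvec w"
      using \<open>r \<subseteq> span {rvec w}\<close> x by (auto simp: span_singleton)
    have "c \<ge> 0"
    proof (rule ccontr)
      assume "\<not> c \<ge> 0"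
      then have "(1 / (- c)) *\<^sub>R x \<in> r" using cc x by (intro convex_cone_scaleR) auto
      moreover have "(1 / (- c)) *\<^sub>R x = - rvec w" using \<open>\<not> c \<ge> 0\<close> c by simp
      ultimately have "rvec w \<in> r \<inter> uminus ` r" using wr by (auto intro: image_eqI[of _ _ "- rvec w"])
      then have "rvec w \<in> {0}" using r(2) unfolding strongly_convex_def by simp
      then show False using w0 by simp
    qed
    then show ?thesis using c by blast
  qed
  define Lp where "Lp m \<longleftrightarrow> rvec m \<in> r \<and> m \<noteq> 0" for m
  have "Lp w" using wr w(2) by (simp add: Lp_def)
  then obtain u where u: "Lp u" and min: "\<And>m. Lp m \<Longrightarrow> lattice_size u \<le> lattice_size m"
    using ex_has_least_nat[of Lp w lattice_size] by blast
  obtain t0 where t0: "t0 \<ge> 0" "rvec u = t0 *\<^sub>R rvec w" using on_line u by (auto simp: Lp_def)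
  have "t0 \<noteq> 0" using t0(2) u rvec_eq_iff[of u 0] by (auto simp: Lp_def rvec_simps)
  have on_u: "\<exists>s\<ge>0. x = s *\<^sub>R rvec u" if x: "x \<in> r" for x
  proof -
    obtain c where "c \<ge> 0" "x = c *\<^sub>R rvec w" using on_line[OF x] by blast
    then show ?thesis using t0 \<open>t0 \<noteq> 0\<close> by (intro exI[of _ "c / t0"]) simp
  qed
  have r_eq: "r = {t *\<^sub>R rvec u | t. 0 \<le> t}"
    using on_u convex_cone_scaleR[OF cc] u by (auto simp: Lp_def)
  have multiple: "\<exists>j::nat. m = int j *s u" if m: "rvec m \<in> r" for m
  proof -
    obtain s where s: "s \<ge> 0" "rvec m = s *\<^sub>R rvec u" using on_u[OF m] by blast
    \<comment> \<open>The remainder of \<open>m\<close> after the integral part of the factor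
      \<open>s\<close> is removed.\<close>
    define m' where "m' = m - \<lfloor>s\<rfloor> *s u"
    define c where "c = s - of_int \<lfloor>s\<rfloor>"
    have c: "0 \<le> c" "c < 1" unfolding c_def by linarith+
    have m': "rvec m' = c *\<^sub>R rvec u" by (simp add: m'_def rvec_simps s(2) c_def algebra_simps)
    have "m' = 0"
    proof (rule ccontr)
      assume "m' \<noteq> 0"
      then have "Lp m'" using u convex_cone_scaleR[OF cc] c by (auto simp: Lp_def m')
      then have "lattice_size u \<le> lattice_size m'" by (rule min)
      have sz: "real (lattice_size m) = (\<Sum>j\<in>UNIV. \<bar>rvec m $ j\<bar>)" for m :: "int ^ 'a"
        by (simp add: lattice_size_def rvec_def)
      have "real (lattice_size m') = c * real (lattice_size u)"
        using c by (simp add: sz m' abs_mult sum_distrib_left[symmetric])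
      also have "\<dots> < 1 * real (lattice_size u)"
        using c u by (intro mult_strict_right_mono) (auto simp: Lp_def lattice_size_eq_0 intro!: gr0I)
      finally have "lattice_size m' < lattice_size u" by simp
      then show False using \<open>lattice_size u \<le> lattice_size m'\<close> by simp
    qed
    then have "m = \<lfloor>s\<rfloor> *s u" by (simp add: m'_def)
    moreover have "\<lfloor>s\<rfloor> = int (nat \<lfloor>s\<rfloor>)" using s(1) by simp
    ultimately show ?thesis by metis
  qed
  have "{m. rvec m \<in> r} = range (\<lambda>j::nat. \<chi> i. int j * u $ i)"
  proof (rule equalityI; rule subsetI)
    fix m assume "m \<in> {m. rvec m \<in> r}"
    then obtain j :: nat where "m = int j *s u" using multiple by blast
    then have "m = (\<chi> i. int j * u $ i)" by (simp add: vec_eq_iff)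
    then show "m \<in> range (\<lambda>j::nat. \<chi> i. int j * u $ i)" by blast
  next
    fix m assume "m \<in> range (\<lambda>j::nat. \<chi> i. int j * u $ i)"
    then obtain j :: nat where "m = (\<chi> i. int j * u $ i)" by blast
    then have "m = int j *s u" by (simp add: vec_eq_iff)
    then show "m \<in> {m. rvec m \<in> r}" using u convex_cone_scaleR[OF cc] by (simp add: Lp_def rvec_simps)
  qed
  then show ?thesis using u r_eq by (auto simp: Lp_def)
qed

text \<open>Two generators are natural multiples of each other, hence equal; this makes the definite
  description meaningful.\<close>

lemma ray_generator:
  assumes r: "rational_cone r" "strongly_convex r" "dim r = 1"
  shows "r = {t *\<^sub>R rvec (ray_generator r) | t. 0 \<le> t}"
proof -
  obtain u where u: "u \<noteq> 0" "r = {t *\<^sub>R rvec u | t. 0 \<le> t}"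
    "{m. rvec m \<in> r} = range (\<lambda>j::nat. \<chi> i. int j * u $ i)"
    using ray_generator_exists[OF r] by blast
  have "ray_generator r = u"
    unfolding ray_generator_def
  proof (rule the_equality)
    fix u' assume u': "{m. rvec m \<in> r} = range (\<lambda>j::nat. \<chi> i. int j * u' $ i)"
    have "u \<in> range (\<lambda>j::nat. \<chi> i. int j * u $ i)"
      by (rule range_eqI[of _ _ 1]) (simp add: vec_eq_iff)
    then obtain j :: nat where j: "u = (\<chi> i. int j * u' $ i)" using u(3) u' by auto
    have "u' \<in> range (\<lambda>j::nat. \<chi> i. int j * u' $ i)"
      by (rule range_eqI[of _ _ 1]) (simp add: vec_eq_iff)
    then obtain k :: nat where k: "u' = (\<chi> i. int k * u $ i)" using u(3) u' by auto
    obtain i where i: "u $ i \<noteq> 0" using u(1) by (auto simp: vec_eq_iff)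
    have "u $ i = int j * (int k * u $ i)" using arg_cong[OF j, of "\<lambda>v. v $ i"] arg_cong[OF k, of "\<lambda>v. v $ i"] by simp
    then have "int j * int k = 1" using i by simp
    then have "k = 1" by (metis of_nat_1 of_nat_eq_iff of_nat_mult nat_mult_eq_1_iff)
    then show "u' = u" using k by (simp add: vec_eq_iff)
  qed (rule u(3))
  then show ?thesis using u(2) by simp
qed

section \<open>Faces and dual monoids in a fan\<close>

locale ray_fan =
  fixes \<Sigma> :: "(real ^ 'n) set set" and \<rho> :: "'k::finite \<Rightarrow> (real ^ 'n) set"
  assumes fan: "complete_fan \<Sigma>" and rays: "enumerates_rays \<Sigma> \<rho>"
begin

lemma finite_fan: "finite \<Sigma>"
  using fan by (simp add: complete_fan_def)

lemma cone_props:
  assumes "\<sigma> \<in> \<Sigma>"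
  shows "rational_cone \<sigma>" "strongly_convex \<sigma>" "convex_cone \<sigma>" "0 \<in> \<sigma>"
proof -
  show "rational_cone \<sigma>" "strongly_convex \<sigma>" using fan assms by (auto simp: complete_fan_def)
  then show "convex_cone \<sigma>" by (intro rational_cone_convex_cone)
  then show "0 \<in> \<sigma>" by (rule convex_cone_contains_0)
qed

lemma fan_Int:
  assumes "\<sigma> \<in> \<Sigma>" "\<tau> \<in> \<Sigma>"
  shows "\<sigma> \<inter> \<tau> \<in> \<Sigma>"
proof -
  have "(\<sigma> \<inter> \<tau>) face_of \<sigma>" using fan assms by (simp add: complete_fan_def)
  moreover have "\<sigma> \<inter> \<tau> \<noteq> {}" using cone_props(4) assms by blast
  ultimately show ?thesis using fan assms(1) unfolding complete_fan_def by blast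
qed

lemma face:
  assumes "\<sigma> \<in> \<Sigma>" "\<tau> \<in> \<Sigma>" "\<tau> \<subseteq> \<sigma>"
  shows "\<tau> face_of \<sigma>"
proof -
  have "(\<sigma> \<inter> \<tau>) face_of \<sigma>" using fan assms by (simp add: complete_fan_def)
  moreover have "\<sigma> \<inter> \<tau> = \<tau>" using assms(3) by blast
  ultimately show ?thesis by simp
qed

lemma ray: "\<rho> i \<in> \<Sigma>" "\<rho> i = {t *\<^sub>R rvec (ray_generator (\<rho> i)) | t. 0 \<le> t}"
proof -
  have "\<rho> i \<in> {\<sigma> \<in> \<Sigma>. dim \<sigma> = 1}"
    using rays by (auto simp: enumerates_rays_def bij_betw_def)
  then have i: "\<rho> i \<in> \<Sigma>" "dim (\<rho> i) = 1" by simp_all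
  then show "\<rho> i \<in> \<Sigma>" by simp
  show "\<rho> i = {t *\<^sub>R rvec (ray_generator (\<rho> i)) | t. 0 \<le> t}"
    by (rule ray_generator[OF cone_props(1,2)[OF i(1)] i(2)])
qed

lemma ray_subset_iff: "\<sigma> \<in> \<Sigma> \<Longrightarrow> \<rho> i \<subseteq> \<sigma> \<longleftrightarrow> rvec (ray_generator (\<rho> i)) \<in> \<sigma>"
proof
  assume "\<rho> i \<subseteq> \<sigma>"
  moreover have "1 *\<^sub>R rvec (ray_generator (\<rho> i)) \<in> \<rho> i" by (subst (2) ray(2)) (intro CollectI exI[of _ 1] conjI, simp_all)
  ultimately show "rvec (ray_generator (\<rho> i)) \<in> \<sigma>" by auto
next
  assume "\<sigma> \<in> \<Sigma>" "rvec (ray_generator (\<rho> i)) \<in> \<sigma>"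
  then show "\<rho> i \<subseteq> \<sigma>"
    using convex_cone_scaleR[OF cone_props(3)] by (subst ray(2)) auto
qed

lemma char_div_ipair: "char_div \<rho> m $ i = ipair m (ray_generator (\<rho> i))"
  by (simp add: char_div_def ipair_def)

lemma char_div_inner: "real_of_int (char_div \<rho> m $ i) = rvec m \<bullet> rvec (ray_generator (\<rho> i))"
  by (simp add: char_div_ipair inner_rvec)

lemma ray_generator_in_ray: "rvec (ray_generator (\<rho> i)) \<in> \<rho> i"
  using ray_subset_iff[OF ray(1)[of i], of i] by simp

lemma char_div_nonneg:
  assumes "m \<in> dual_monoid \<sigma>" "\<rho> i \<subseteq> \<sigma>"
  shows "0 \<le> char_div \<rho> m $ i"
proof -
  have "0 \<le> real_of_int (char_div \<rho> m $ i)"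
    unfolding char_div_inner using assms ray_generator_in_ray by (auto simp: dual_monoid_def)
  then show ?thesis by simp
qed

lemma dual_monoid_antimono: "\<tau> \<subseteq> \<sigma> \<Longrightarrow> dual_monoid \<sigma> \<subseteq> dual_monoid \<tau>"
  by (auto simp: dual_monoid_def)

lemma dual_monoid_0: "0 \<in> dual_monoid \<sigma>"
  by (simp add: dual_monoid_def rvec_simps)

lemma dual_monoid_add: "m \<in> dual_monoid \<sigma> \<Longrightarrow> m' \<in> dual_monoid \<sigma> \<Longrightarrow> m + m' \<in> dual_monoid \<sigma>"
  by (simp add: dual_monoid_def rvec_simps inner_add_left)

text \<open>Only generators of \<sigma> with positive pairing with \<open>m\<close> can pair
  negatively with \<open>m'\<close>, and on these a large multiple of \<open>m\<close> outweighs
  \<open>m'\<close>. Algebraically, inverting one monomial reaches the chart of the face.\<close>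

lemma dual_monoid_face_shift:
  assumes \<sigma>: "\<sigma> \<in> \<Sigma>" and m: "m \<in> dual_monoid \<sigma>" and m': "m' \<in> dual_monoid {x \<in> \<sigma>. rvec m \<bullet> x = 0}"
  shows "\<exists>l::nat. m' + int l *s m \<in> dual_monoid \<sigma>"
proof -
  obtain V where V: "finite V" "\<sigma> = convex_cone hull (rvec ` V)"
    using cone_props(1)[OF \<sigma>] by (auto simp: rational_cone_def)
  \<comment> \<open>The sum of all absolute pairings is a multiple large enough for every generator
    at once.\<close>
  define l where "l = (\<Sum>v\<in>V. nat \<bar>ipair m' v\<bar>)"
  have "0 \<le> ipair (m' + int l *s m) v" if v: "v \<in> V" for v
  proof -
    have v\<sigma>: "rvec v \<in> \<sigma>" unfolding V(2) using v by (simp add: hull_inc)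
    have nn: "0 \<le> ipair m v" using m v unfolding V(2) mem_dual_monoid_hull by blast
    show ?thesis
    proof (cases "ipair m v = 0")
      case True
      then have "rvec v \<in> {x \<in> \<sigma>. rvec m \<bullet> x = 0}" using v\<sigma> by (simp add: inner_rvec)
      then have "0 \<le> rvec m' \<bullet> rvec v" using m' unfolding dual_monoid_def by blast
      then show ?thesis using True by (simp add: ipair_linear inner_rvec)
    next
      case False
      then have "1 \<le> ipair m v" using nn by simp
      then have "int l * 1 \<le> int l * ipair m v" by (intro mult_left_mono) auto
      moreover have "nat \<bar>ipair m' v\<bar> \<le> l" unfolding l_def using V(1) v by (intro member_le_sum) auto
      ultimately show ?thesis by (simp add: ipair_linear)
    qed
  qed
  then show ?thesis unfolding V(2) mem_dual_monoid_hull by blast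
qed

text \<open>Faces of a polyhedral cone are exposed, by a real functional at first. Only its zeros
  and signs on finitely many generators matter, and an integral functional reproduces these.\<close>

lemma face_functional:
  assumes \<sigma>: "\<sigma> \<in> \<Sigma>" and \<tau>: "\<tau> \<in> \<Sigma>" and sub: "\<tau> \<subseteq> \<sigma>"
  obtains m where "m \<in> dual_monoid \<sigma>" "\<tau> = {x \<in> \<sigma>. rvec m \<bullet> x = 0}"
proof -
  obtain V where V: "finite V" "\<sigma> = convex_cone hull (rvec ` V)"
    using cone_props(1)[OF \<sigma>] by (auto simp: rational_cone_def)
  have "polyhedron \<sigma>" unfolding V(2) using V(1) by (intro polyhedron_convex_cone_hull) simp
  then have "\<tau> exposed_face_of \<sigma>" using face[OF \<sigma> \<tau> sub] exposed_face_of_polyhedron by blast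
  then obtain a b where ab: "\<sigma> \<subseteq> {x. a \<bullet> x \<le> b}" "\<tau> = \<sigma> \<inter> {x. a \<bullet> x = b}"
    by (auto simp: exposed_face_of_def)
  \<comment> \<open>The supporting hyperplane passes through the origin because the origin lies in
    the face.\<close>
  have "b = 0" using ab(2) cone_props(4)[OF \<tau>] by auto
  have V\<sigma>: "rvec v \<in> \<sigma>" if "v \<in> V" for v unfolding V(2) using that by (simp add: hull_inc)
  have nonneg: "0 \<le> (- a) \<bullet> rvec v" if "v \<in> V" for v using ab(1) V\<sigma>[OF that] \<open>b = 0\<close> by auto
  obtain m where m: "\<And>v. v \<in> V \<Longrightarrow> (- a) \<bullet> rvec v = 0 \<Longrightarrow> ipair m v = 0"
    "\<And>v. v \<in> V \<Longrightarrow> 0 < (- a) \<bullet> rvec v \<Longrightarrow> 0 < ipair m v"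
    using integral_functional[OF V(1) nonneg] by blast
  have in\<tau>: "rvec v \<in> \<tau> \<longleftrightarrow> ipair m v = 0" if "v \<in> V" for v
    using m[OF that] nonneg[OF that] V\<sigma>[OF that] ab(2) \<open>b = 0\<close> by force
  have m_nonneg: "0 \<le> ipair m v" if "v \<in> V" for v
    using m[OF that] nonneg[OF that] by force
  have m\<sigma>: "m \<in> dual_monoid \<sigma>" unfolding V(2) mem_dual_monoid_hull using m_nonneg by blast
  have zero_set: "\<tau> = {x \<in> \<sigma>. rvec m \<bullet> x = 0}"
  proof
    \<comment> \<open>A convex cone: if \<open>m\<close> is nonnegative on two points and vanishes
      on their sum, it vanishes on both. Since it contains the generators, it contains
      \<sigma>.\<close>
    let ?T = "{x. 0 \<le> rvec m \<bullet> x \<and> (rvec m \<bullet> x = 0 \<longrightarrow> x \<in> \<tau>)}"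
    have "convex_cone ?T"
      unfolding convex_cone_iff
    proof (intro conjI ballI allI impI)
      show "0 \<in> ?T" using cone_props(4)[OF \<tau>] by simp
      show "x + y \<in> ?T" if "x \<in> ?T" "y \<in> ?T" for x y
        using that convex_cone_add[OF cone_props(3)[OF \<tau>]] by (auto simp: inner_add_right)
      show "c *\<^sub>R x \<in> ?T" if "x \<in> ?T" "0 \<le> c" for x c
        using that convex_cone_scaleR[OF cone_props(3)[OF \<tau>]] cone_props(4)[OF \<tau>] by auto
    qed
    moreover have "rvec ` V \<subseteq> ?T" using m_nonneg in\<tau> by (auto simp: inner_rvec)
    ultimately have "\<sigma> \<subseteq> ?T" unfolding V(2) by (intro hull_minimal)
    then show "{x \<in> \<sigma>. rvec m \<bullet> x = 0} \<subseteq> \<tau>" by auto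
    \<comment> \<open>On \<open>V\<close>, hence on \<open>\<sigma>\<close>, \<open>m\<close> is bounded above by a multiple of \<open>-a\<close>, which vanishes on \<open>\<tau>\<close>.\<close>
    define c where "c = Max (insert 0 ((\<lambda>v. of_int (ipair m v) / ((- a) \<bullet> rvec v)) ` V))"
    have "of_int (ipair m v) \<le> c * ((- a) \<bullet> rvec v)" if v: "v \<in> V" for v
    proof (cases "(- a) \<bullet> rvec v = 0")
      case True
      then show ?thesis using m(1)[OF v] by simp
    next
      case False
      have "of_int (ipair m v) / ((- a) \<bullet> rvec v) \<le> c"
        unfolding c_def using v V(1) by (intro Max_ge) auto
      then show ?thesis using False nonneg[OF v]
        by (subst (asm) pos_divide_le_eq) (auto simp: less_le)
    qed
    then have "rvec ` V \<subseteq> {x. 0 \<le> (c *\<^sub>R (- a) - rvec m) \<bullet> x}"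
      by (auto simp: inner_diff_left inner_rvec)
    then have "\<sigma> \<subseteq> {x. 0 \<le> (c *\<^sub>R (- a) - rvec m) \<bullet> x}"
      unfolding V(2) by (rule hull_minimal) (rule convex_cone_halfspace_ge)
    then have "rvec m \<bullet> x \<le> c * ((- a) \<bullet> x)" if "x \<in> \<sigma>" for x
      using that by (auto simp: inner_diff_left)
    then have "rvec m \<bullet> x \<le> 0" if "x \<in> \<tau>" for x
      using that ab(2) \<open>b = 0\<close> by force
    moreover have "0 \<le> rvec m \<bullet> x" if "x \<in> \<sigma>" for x using m\<sigma> that by (simp add: dual_monoid_def)
    ultimately show "\<tau> \<subseteq> {x \<in> \<sigma>. rvec m \<bullet> x = 0}" using sub by force
  qed
  show ?thesis by (rule that[OF m\<sigma> zero_set])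
qed

lemma dual_monoid_generators:
  assumes "\<sigma> \<in> \<Sigma>"
  shows "\<exists>G. finite G \<and> G \<subseteq> dual_monoid \<sigma> \<and>
    (\<forall>m\<in>dual_monoid \<sigma>. \<exists>k::int ^ 'n \<Rightarrow> nat. m = (\<Sum>g\<in>G. int (k g) *s g))"
proof -
  obtain V where V: "finite V" "\<sigma> = convex_cone hull (rvec ` V)"
    using cone_props(1)[OF assms] by (auto simp: rational_cone_def)
  have "dual_monoid \<sigma> = {m. \<forall>v\<in>V. 0 \<le> ipair m v}"
    unfolding V(2) using mem_dual_monoid_hull by blast
  then show ?thesis using gordan[OF V(1)] by auto
qed

end

section \<open>The charts of a closed subscheme and their gluing\<close>

lemma push_exponents_superset:
  assumes "finite S" "Poly_Mapping.keys f \<subseteq> S"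
  shows "push_exponents \<phi> f = (\<Sum>a\<in>S. Poly_Mapping.single (\<phi> a) (Poly_Mapping.lookup f a))"
  unfolding push_exponents_def
  by (rule sum.mono_neutral_left) (use assms in \<open>auto simp: in_keys_iff\<close>)

lemma push_exponents_add:
  "push_exponents \<phi> (f + g) = push_exponents \<phi> f + push_exponents \<phi> g"
proof -
  let ?S = "Poly_Mapping.keys f \<union> Poly_Mapping.keys g"
  have "Poly_Mapping.keys (f + g) \<subseteq> ?S" by (rule keys_add)
  then show ?thesis
    by (simp add: push_exponents_superset[of ?S] lookup_add single_add sum.distrib)
qed

lemma push_exponents_single: "push_exponents \<phi> (Poly_Mapping.single a c) = Poly_Mapping.single (\<phi> a) c"
  by (simp add: push_exponents_superset[of "{a}"])

lemma push_exponents_0: "push_exponents \<phi> 0 = 0"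
  by (simp add: push_exponents_def)

lemma push_exponents_sum: "push_exponents \<phi> (sum f A) = (\<Sum>x\<in>A. push_exponents \<phi> (f x))"
  by (induction A rule: infinite_finite_induct) (simp_all add: push_exponents_0 push_exponents_add)

lemma push_exponents_mult:
  assumes "\<And>a b. \<phi> (a + b) = \<phi> a + \<phi> b"
  shows "push_exponents \<phi> (f * g) = push_exponents \<phi> f * push_exponents \<phi> g"
proof -
  have "f * g = (\<Sum>a\<in>Poly_Mapping.keys f. \<Sum>b\<in>Poly_Mapping.keys g.
      Poly_Mapping.single (a + b) (Poly_Mapping.lookup f a * Poly_Mapping.lookup g b))"
    by (subst poly_mapping_sum_single[of "Poly_Mapping.keys f" f, OF finite_keys order_refl],
        subst poly_mapping_sum_single[of "Poly_Mapping.keys g" g, OF finite_keys order_refl])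
      (simp add: sum_product mult_single)
  then have "push_exponents \<phi> (f * g) = (\<Sum>a\<in>Poly_Mapping.keys f. \<Sum>b\<in>Poly_Mapping.keys g.
      Poly_Mapping.single (\<phi> a + \<phi> b) (Poly_Mapping.lookup f a * Poly_Mapping.lookup g b))"
    by (simp add: push_exponents_sum push_exponents_single assms)
  then show ?thesis by (simp add: push_exponents_def sum_product mult_single)
qed

lemma chart_eval_superset:
  assumes "finite S" "Poly_Mapping.keys f \<subseteq> S"
  shows "chart_eval \<gamma> f = (\<Sum>m\<in>S. Poly_Mapping.lookup f m * \<gamma> m)"
  unfolding chart_eval_def
  by (rule sum.mono_neutral_left) (use assms in \<open>auto simp: in_keys_iff\<close>)

lemma chart_eval_add: "chart_eval \<gamma> (f + g) = chart_eval \<gamma> f + chart_eval \<gamma> g"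
proof -
  let ?S = "Poly_Mapping.keys f \<union> Poly_Mapping.keys g"
  have "Poly_Mapping.keys (f + g) \<subseteq> ?S" by (rule keys_add)
  then show ?thesis
    by (simp add: chart_eval_superset[of ?S] lookup_add distrib_right sum.distrib)
qed

lemma chart_eval_single: "chart_eval \<gamma> (Poly_Mapping.single m c) = c * \<gamma> m"
  by (simp add: chart_eval_superset[of "{m}"])

lemma chart_eval_sum: "chart_eval \<gamma> (sum f A) = (\<Sum>x\<in>A. chart_eval \<gamma> (f x))"
  by (induction A rule: infinite_finite_induct) (simp_all add: chart_eval_def[of _ 0] chart_eval_add)

lemma chart_eval_mult:
  assumes "\<And>a b. a \<in> Poly_Mapping.keys f \<Longrightarrow> b \<in> Poly_Mapping.keys g \<Longrightarrow> \<gamma> (a + b) = \<gamma> a * \<gamma> b"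
  shows "chart_eval \<gamma> (f * g) = chart_eval \<gamma> f * chart_eval \<gamma> g"
proof -
  have "f * g = (\<Sum>a\<in>Poly_Mapping.keys f. \<Sum>b\<in>Poly_Mapping.keys g.
      Poly_Mapping.single (a + b) (Poly_Mapping.lookup f a * Poly_Mapping.lookup g b))"
    by (subst poly_mapping_sum_single[of "Poly_Mapping.keys f" f, OF finite_keys order_refl],
        subst poly_mapping_sum_single[of "Poly_Mapping.keys g" g, OF finite_keys order_refl])
      (simp add: sum_product mult_single)
  then have "chart_eval \<gamma> (f * g) = (\<Sum>a\<in>Poly_Mapping.keys f. \<Sum>b\<in>Poly_Mapping.keys g.
      (Poly_Mapping.lookup f a * \<gamma> a) * (Poly_Mapping.lookup g b * \<gamma> b))"
    by (simp add: chart_eval_sum chart_eval_single assms mult_ac cong: sum.cong)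
  then show ?thesis by (simp add: chart_eval_def sum_product)
qed

lemma ivec_add: "ivec (a + b) = ivec a + ivec b"
  by (simp add: ivec_def vec_eq_iff)

lemma char_div_add: "char_div \<rho> (m + m') = char_div \<rho> m + char_div \<rho> m'"
  by (simp add: char_div_def vec_eq_iff distrib_right sum.distrib)

lemma char_div_smult: "char_div \<rho> (c *s m) = c *s char_div \<rho> m"
  by (simp add: char_div_def vec_eq_iff sum_distrib_left mult.assoc)

lemma monoid_algebra_UNIV: "monoid_algebra UNIV"
  by unfold_locales auto

lemma cox_ring_ideal:
  assumes "ideal I cox_ring"
  shows "0 \<in> I" "f \<in> I \<Longrightarrow> g \<in> I \<Longrightarrow> f + g \<in> I" "f \<in> I \<Longrightarrow> s * f \<in> I"
proof -
  interpret monoid_algebra UNIV by (rule monoid_algebra_UNIV)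
  interpret ideal I cox_ring by fact
  show "0 \<in> I"
    using additive_subgroup.zero_closed[OF ideal.axioms(1)[OF assms]] by (simp add: cox_ring_def)
  show "f \<in> I \<Longrightarrow> g \<in> I \<Longrightarrow> f + g \<in> I" 
    using additive_subgroup.a_closed[OF ideal.axioms(1)[OF assms]] by (simp add: cox_ring_def)
  show "f \<in> I \<Longrightarrow> s * f \<in> I" using I_l_closed[of f s] by (simp add: cox_ring_def mem_B)
qed

section \<open>Chart ideals inside the Laurent polynomials\<close>

locale toric_subscheme = ray_fan \<Sigma> \<rho>
  for \<Sigma> :: "(real ^ 'n) set set" and \<rho> :: "'k::finite \<Rightarrow> (real ^ 'n) set" +
  fixes I :: "'k cox set"
  assumes ideal_I: "ideal I cox_ring"
begin

abbreviation X :: "int ^ 'k \<Rightarrow> int ^ 'k \<Rightarrow>\<^sub>0 complex" where "X a \<equiv> Poly_Mapping.single a 1"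

abbreviation laurent :: "'k cox \<Rightarrow> int ^ 'k \<Rightarrow>\<^sub>0 complex" where "laurent \<equiv> push_exponents ivec"

abbreviation homog :: "(int ^ 'n \<Rightarrow>\<^sub>0 complex) \<Rightarrow> int ^ 'k \<Rightarrow>\<^sub>0 complex" where
  "homog \<equiv> push_exponents (char_div \<rho>)"

lemmas laurent_mult = push_exponents_mult[OF ivec_add]
lemmas homog_mult = push_exponents_mult[of "char_div \<rho>", OF char_div_add]

definition hat_exponent :: "(real ^ 'n) set \<Rightarrow> nat \<Rightarrow> int ^ 'k" where
  "hat_exponent \<sigma> l = (\<chi> i. if \<rho> i \<subseteq> \<sigma> then 0 else int l)"

lemma laurent_xhat_power: "laurent (xhat \<rho> \<sigma> ^ l) = X (hat_exponent \<sigma> l)"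
proof (induction l)
  case 0
  have "ivec 0 = (0 :: int ^ 'k)" by (simp add: ivec_def vec_eq_iff)
  moreover have "hat_exponent \<sigma> 0 = 0" by (simp add: hat_exponent_def vec_eq_iff)
  ultimately show ?case using push_exponents_single[of "ivec :: nat ^ 'k \<Rightarrow> int ^ 'k" 0 "1::complex"] by simp
next
  case (Suc l)
  have "laurent (xhat \<rho> \<sigma>) = X (hat_exponent \<sigma> 1)"
    by (simp add: xhat_def push_exponents_single hat_exponent_def ivec_def vec_eq_iff if_distrib
        cong: if_cong)
  moreover have "hat_exponent \<sigma> 1 + hat_exponent \<sigma> l = hat_exponent \<sigma> (Suc l)"
    by (simp add: hat_exponent_def vec_eq_iff)
  ultimately show ?case by (simp add: laurent_mult Suc mult_single)
qed

lemma mem_local_ideal: "h \<in> local_ideal \<rho> I \<sigma> \<longleftrightarrow> (\<exists>l. h * X (hat_exponent \<sigma> l) \<in> laurent ` I)"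
  by (auto simp: local_ideal_def laurent_xhat_power image_iff)

lemma laurent_range:
  assumes "\<And>b i. b \<in> Poly_Mapping.keys h \<Longrightarrow> 0 \<le> b $ i"
  shows "\<exists>s. h = laurent s"
proof -
  have eq: "ivec (\<chi> i. nat (b $ i)) = b" if "b \<in> Poly_Mapping.keys h" for b
    using assms[OF that] by (simp add: ivec_def vec_eq_iff)
  have "h = (\<Sum>b\<in>Poly_Mapping.keys h. Poly_Mapping.single b (Poly_Mapping.lookup h b))"
    by (rule poly_mapping_sum_single) auto
  also have "\<dots> = (\<Sum>b\<in>Poly_Mapping.keys h.
      laurent (Poly_Mapping.single (\<chi> i. nat (b $ i)) (Poly_Mapping.lookup h b)))"
    by (intro sum.cong refl) (simp add: push_exponents_single eq)
  also have "\<dots> = laurent (\<Sum>b\<in>Poly_Mapping.keys h.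
      Poly_Mapping.single (\<chi> i. nat (b $ i)) (Poly_Mapping.lookup h b))"
    by (simp add: push_exponents_sum)
  finally show ?thesis by blast
qed

lemma laurent_I_mult: "h \<in> laurent ` I \<Longrightarrow> laurent s * h \<in> laurent ` I"
  using cox_ring_ideal(3)[OF ideal_I] by (auto simp: laurent_mult[symmetric])

lemma laurent_I_add: "h \<in> laurent ` I \<Longrightarrow> h' \<in> laurent ` I \<Longrightarrow> h + h' \<in> laurent ` I"
  using cox_ring_ideal(2)[OF ideal_I] by (auto simp: push_exponents_add[symmetric])

text \<open>The missing factor is a monomial with nonnegative exponents, hence an element of the Cox
  ring. It lets different denominators be raised to a common one.\<close>

lemma laurent_I_shift:
  assumes "h * X a \<in> laurent ` I" "\<And>i. a $ i \<le> b $ i"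
  shows "h * X b \<in> laurent ` I"
proof -
  obtain s where s: "X (b - a) = laurent s"
    using laurent_range[of "X (b - a)"] assms(2) by auto
  have "h * X b = laurent s * (h * X a)"
    by (simp add: s[symmetric] mult_ac mult_single)
  then show ?thesis using laurent_I_mult[OF assms(1)] by simp
qed

sublocale chart: monoid_algebra "dual_monoid \<sigma>" for \<sigma> :: "(real ^ 'n) set"
  by unfold_locales (auto intro: dual_monoid_0 dual_monoid_add)

abbreviation B :: "(real ^ 'n) set \<Rightarrow> (int ^ 'n \<Rightarrow>\<^sub>0 complex) set" where
  "B \<sigma> \<equiv> chart.B \<sigma>"

abbreviation J :: "(real ^ 'n) set \<Rightarrow> (int ^ 'n \<Rightarrow>\<^sub>0 complex) set" where
  "J \<sigma> \<equiv> chart_ideal \<rho> I \<sigma>"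

lemma mem_J: "g \<in> J \<sigma> \<longleftrightarrow> g \<in> B \<sigma> \<and> (\<exists>l. homog g * X (hat_exponent \<sigma> l) \<in> laurent ` I)"
  by (simp add: chart_ideal_def mem_local_ideal)

text \<open>Characters in the dual monoid of \<sigma> have nonnegative exponents at the rays of
  \<sigma>; at the other rays a large power of \<open>xhat\<close> compensates.\<close>

lemma homog_clear_denominators:
  assumes "g \<in> B \<sigma>"
  shows "\<exists>l s. homog g * X (hat_exponent \<sigma> l) = laurent s"
proof -
  \<comment> \<open>A crude bound for the absolute value of every exponent that occurs.\<close>
  define l where "l = (\<Sum>m\<in>Poly_Mapping.keys g. \<Sum>i\<in>UNIV. nat \<bar>char_div \<rho> m $ i\<bar>)"
  have eq: "homog g * X (hat_exponent \<sigma> l) = (\<Sum>m\<in>Poly_Mapping.keys g.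
      Poly_Mapping.single (char_div \<rho> m + hat_exponent \<sigma> l) (Poly_Mapping.lookup g m))"
    by (simp add: push_exponents_def sum_distrib_right mult_single)
  have "0 \<le> b $ i" if b: "b \<in> Poly_Mapping.keys (homog g * X (hat_exponent \<sigma> l))" for b i
  proof -
    obtain m where m: "m \<in> Poly_Mapping.keys g" "b = char_div \<rho> m + hat_exponent \<sigma> l"
    proof -
      have "(\<Sum>m\<in>Poly_Mapping.keys g. Poly_Mapping.lookup
          (Poly_Mapping.single (char_div \<rho> m + hat_exponent \<sigma> l) (Poly_Mapping.lookup g m)) b) \<noteq> 0"
        using b unfolding eq by (simp add: in_keys_iff lookup_sum)
      then obtain m where "m \<in> Poly_Mapping.keys g" "Poly_Mapping.lookup
          (Poly_Mapping.single (char_div \<rho> m + hat_exponent \<sigma> l) (Poly_Mapping.lookup g m)) b \<noteq> 0"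
        by (rule sum.not_neutral_contains_not_neutral)
      then show ?thesis using that[of m] by (simp add: lookup_single when_def split: if_splits)
    qed
    show ?thesis
    proof (cases "\<rho> i \<subseteq> \<sigma>")
      case True
      then show ?thesis
        using char_div_nonneg m assms by (auto simp: hat_exponent_def chart.mem_B)
    next
      case False
      have "nat \<bar>char_div \<rho> m $ i\<bar> \<le> (\<Sum>i\<in>UNIV. nat \<bar>char_div \<rho> m $ i\<bar>)"
        by (rule member_le_sum) auto
      also have "\<dots> \<le> l" unfolding l_def using m(1)
        by (intro member_le_sum[of m _ "\<lambda>m. \<Sum>i\<in>UNIV. nat \<bar>char_div \<rho> m $ i\<bar>"]) auto
      finally show ?thesis using False m(2) by (simp add: hat_exponent_def)
    qed
  qed
  then show ?thesis using laurent_range by blast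
qed

lemma hat_exponent_mono: "l \<le> l' \<Longrightarrow> hat_exponent \<sigma> l $ i \<le> hat_exponent \<sigma> l' $ i"
  by (simp add: hat_exponent_def)

lemma alg_ideal_J: "chart.alg_ideal \<sigma> (J \<sigma>)"
  unfolding chart.alg_ideal_def
proof (intro conjI ballI)
  show "J \<sigma> \<subseteq> B \<sigma>" by (auto simp: mem_J)
  have "0 \<in> laurent ` I"
    using cox_ring_ideal(1)[OF ideal_I] push_exponents_0[of ivec] by (metis image_eqI)
  then show "0 \<in> J \<sigma>" by (simp add: mem_J push_exponents_0 chart.zero_B)
  fix g assume "g \<in> J \<sigma>"
  then obtain l where g: "g \<in> B \<sigma>" "homog g * X (hat_exponent \<sigma> l) \<in> laurent ` I" by (auto simp: mem_J)
  {
    fix g' assume "g' \<in> J \<sigma>"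
    then obtain l' where g': "g' \<in> B \<sigma>" "homog g' * X (hat_exponent \<sigma> l') \<in> laurent ` I"
      by (auto simp: mem_J)
    have "homog g * X (hat_exponent \<sigma> (l + l')) \<in> laurent ` I"
      by (rule laurent_I_shift[OF g(2)]) (simp add: hat_exponent_mono)
    moreover have "homog g' * X (hat_exponent \<sigma> (l + l')) \<in> laurent ` I"
      by (rule laurent_I_shift[OF g'(2)]) (simp add: hat_exponent_mono)
    ultimately have "homog (g + g') * X (hat_exponent \<sigma> (l + l')) \<in> laurent ` I"
      using laurent_I_add by (simp add: push_exponents_add distrib_right)
    then show "g + g' \<in> J \<sigma>" using chart.add_B[OF g(1) g'(1)] by (auto simp: mem_J)
  next
    fix b assume b: "b \<in> B \<sigma>"
    then obtain l' s where s: "homog b * X (hat_exponent \<sigma> l') = laurent s"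
      using homog_clear_denominators by blast
    have "hat_exponent \<sigma> (l + l') = hat_exponent \<sigma> l + hat_exponent \<sigma> l'"
      by (simp add: hat_exponent_def vec_eq_iff)
    then have "X (hat_exponent \<sigma> (l + l')) = X (hat_exponent \<sigma> l) * X (hat_exponent \<sigma> l')"
      by (simp add: mult_single)
    then have "homog (b * g) * X (hat_exponent \<sigma> (l + l')) =
        (homog b * X (hat_exponent \<sigma> l')) * (homog g * X (hat_exponent \<sigma> l))"
      by (simp add: homog_mult mult_ac)
    also have "\<dots> \<in> laurent ` I" unfolding s by (rule laurent_I_mult[OF g(2)])
    finally show "b * g \<in> J \<sigma>" using chart.mult_B[OF b g(1)] by (auto simp: mem_J)
  }
qed

sublocale chart: monoid_algebra_ideal "dual_monoid \<sigma>" "J \<sigma>" for \<sigma> :: "(real ^ 'n) set"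
  by unfold_locales (rule alg_ideal_J)

lemma B_antimono: "\<tau> \<subseteq> \<sigma> \<Longrightarrow> B \<sigma> \<subseteq> B \<tau>"
  using dual_monoid_antimono[of \<tau> \<sigma>] by (auto simp: chart.mem_B)

lemma J_antimono: "\<tau> \<subseteq> \<sigma> \<Longrightarrow> J \<sigma> \<subseteq> J \<tau>"
proof
  fix g assume sub: "\<tau> \<subseteq> \<sigma>" and "g \<in> J \<sigma>"
  then obtain l where g: "g \<in> B \<sigma>" "homog g * X (hat_exponent \<sigma> l) \<in> laurent ` I"
    by (auto simp: mem_J)
  have "homog g * X (hat_exponent \<tau> l) \<in> laurent ` I"
    by (rule laurent_I_shift[OF g(2)]) (use sub in \<open>auto simp: hat_exponent_def\<close>)
  then show "g \<in> J \<tau>" using g(1) B_antimono[OF sub] by (auto simp: mem_J)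
qed

abbreviation charmon :: "int ^ 'n \<Rightarrow> int ^ 'n \<Rightarrow>\<^sub>0 complex" where "charmon m \<equiv> Poly_Mapping.single m 1"

lemma mono_B: "m \<in> dual_monoid \<sigma> \<Longrightarrow> charmon m \<in> B \<sigma>"
  by (simp add: chart.mem_B)

lemma mono_power: "charmon m ^ l = charmon (int l *s m)"
  by (induction l) (simp_all add: mult_single vec_eq_iff algebra_simps flip: single_one)

text \<open>A functional \<open>m\<close> that cuts out the face \<open>\<tau>\<close> of \<open>\<sigma>\<close> makes \<open>\<complex>[U\<^sub>\<tau>]\<close> the localization of
  \<open>\<complex>[U\<^sub>\<sigma>]\<close> at \<open>\<chi>\<^sup>m\<close>.\<close>

lemma face_monomial:
  assumes "\<sigma> \<in> \<Sigma>" "\<tau> \<in> \<Sigma>" "\<tau> \<subseteq> \<sigma>"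
  shows "\<exists>m. m \<in> dual_monoid \<sigma> \<and> m \<in> dual_monoid \<tau> \<and> - m \<in> dual_monoid \<tau> \<and>
    (\<forall>f\<in>B \<tau>. \<exists>L. \<forall>l\<ge>L. charmon m ^ l * f \<in> B \<sigma>) \<and>
    (\<forall>f\<in>J \<tau>. \<exists>L. \<forall>l\<ge>L. charmon m ^ l * f \<in> J \<sigma>)"
proof -
  obtain m where m12: "m \<in> dual_monoid \<sigma>" "\<tau> = {x \<in> \<sigma>. rvec m \<bullet> x = 0}"
    using face_functional[OF assms] by blast
  note m = m12 dual_monoid_face_shift[OF assms(1) m12(1), folded m12(2)]
  have m\<tau>: "m \<in> dual_monoid \<tau>" using m(1) dual_monoid_antimono[OF assms(3)] by blast
  have neg: "- m \<in> dual_monoid \<tau>"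
  proof -
    have "rvec m \<bullet> x = 0" if "x \<in> \<tau>" for x using that m(2) by blast
    then show ?thesis by (simp add: dual_monoid_def rvec_simps)
  qed
  have mult: "int l *s m \<in> dual_monoid \<sigma>" for l
    using m(1) by (auto simp: dual_monoid_def rvec_simps)
  have inB: "\<exists>L. \<forall>l\<ge>L. charmon m ^ l * f \<in> B \<sigma>" if f: "f \<in> B \<tau>" for f
  proof -
    have "\<exists>l::nat. \<forall>a\<in>Poly_Mapping.keys f. a + int l *s m \<in> dual_monoid \<sigma>"
    proof -
      obtain n where n: "\<And>a. a \<in> Poly_Mapping.keys f \<Longrightarrow> a + int (n a) *s m \<in> dual_monoid \<sigma>"
        using m(3) f by (metis chart.mem_B subsetD)
      \<comment> \<open>The sum of the exponents needed for the single keys works for all of them,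
        since further multiples of \<open>m\<close> stay in the dual monoid of \<sigma>.\<close>
      have "a + int (\<Sum>a\<in>Poly_Mapping.keys f. n a) *s m \<in> dual_monoid \<sigma>" if a: "a \<in> Poly_Mapping.keys f" for a
      proof -
        let ?S = "\<Sum>a\<in>Poly_Mapping.keys f. n a"
        have "n a \<le> ?S" using a by (intro member_le_sum) auto
        then have eq: "a + int ?S *s m = (a + int (n a) *s m) + int (?S - n a) *s m"
          by (simp add: vec_eq_iff of_nat_diff algebra_simps)
        show ?thesis unfolding eq by (rule dual_monoid_add[OF n[OF a] mult])
      qed
      then show ?thesis by blast
    qed
    then obtain L where L: "\<And>a. a \<in> Poly_Mapping.keys f \<Longrightarrow> a + int L *s m \<in> dual_monoid \<sigma>" by blast
    have "charmon m ^ l * f \<in> B \<sigma>" if "L \<le> l" for l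
    proof -
      have "charmon m ^ L * f = (\<Sum>a\<in>Poly_Mapping.keys f.
          Poly_Mapping.single (int L *s m + a) (Poly_Mapping.lookup f a))"
        by (subst poly_mapping_sum_single[of "Poly_Mapping.keys f" f, OF finite_keys order_refl])
          (simp add: mono_power sum_distrib_left mult_single)
      also have "\<dots> \<in> B \<sigma>" using L by (intro chart.sum_B) (simp add: chart.mem_B add.commute)
      finally have "charmon m ^ (l - L) * (charmon m ^ L * f) \<in> B \<sigma>"
        by (rule chart.mult_B[OF chart.power_B[OF mono_B[OF m(1)]]])
      then show ?thesis using that by (simp add: mult.assoc[symmetric] power_add[symmetric])
    qed
    then show ?thesis by blast
  qed
  have inJ: "\<exists>L. \<forall>l\<ge>L. charmon m ^ l * f \<in> J \<sigma>" if f: "f \<in> J \<tau>" for f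
  proof -
    obtain L where L: "\<And>l. L \<le> l \<Longrightarrow> charmon m ^ l * f \<in> B \<sigma>" using inB f by (meson mem_J)
    obtain r where r: "homog f * X (hat_exponent \<tau> r) \<in> laurent ` I" using f by (auto simp: mem_J)
    have "charmon m ^ l * f \<in> J \<sigma>" if l: "L + r \<le> l" for l
    proof -
      \<comment> \<open>At rays outside \<sigma> the pairing with \<open>m\<close> may be negative;
        the extra term absorbs \<open>l\<close> times its size.\<close>
      define r' where "r' = r + l * (\<Sum>i\<in>UNIV. nat \<bar>char_div \<rho> m $ i\<bar>)"
      \<comment> \<open>Rays of \<tau> impose nothing; at rays of \<sigma> outside \<tau> the
        pairing with \<open>m\<close> is at least 1 and \<open>l\<close> exceeds \<open>r\<close>;
        outside \<sigma> the choice of \<open>r'\<close> suffices.\<close>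
      have ge: "hat_exponent \<tau> r $ i \<le> (int l *s char_div \<rho> m + hat_exponent \<sigma> r') $ i" for i
      proof (cases "\<rho> i \<subseteq> \<sigma>")
        case True
        then have nn: "0 \<le> char_div \<rho> m $ i" by (rule char_div_nonneg[OF m(1)])
        show ?thesis
        proof (cases "\<rho> i \<subseteq> \<tau>")
          case True
          then show ?thesis using nn \<open>\<rho> i \<subseteq> \<sigma>\<close> by (simp add: hat_exponent_def)
        next
          case False
          then have "rvec (ray_generator (\<rho> i)) \<notin> \<tau>" using ray_subset_iff assms(2) by blast
          then have "real_of_int (char_div \<rho> m $ i) \<noteq> 0"
            unfolding char_div_inner using m(2) \<open>\<rho> i \<subseteq> \<sigma>\<close> ray_generator_in_ray by blast
          then have "1 \<le> char_div \<rho> m $ i" using nn by simp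
          then have "int l * 1 \<le> int l * char_div \<rho> m $ i" by (intro mult_left_mono) auto
          then show ?thesis using False True l by (simp add: hat_exponent_def)
        qed
      next
        case False
        then have "\<not> \<rho> i \<subseteq> \<tau>" using assms(3) by blast
        have "nat \<bar>char_div \<rho> m $ i\<bar> \<le> (\<Sum>i\<in>UNIV. nat \<bar>char_div \<rho> m $ i\<bar>)"
          by (rule member_le_sum) auto
        then have "- (char_div \<rho> m $ i) \<le> int (\<Sum>i\<in>UNIV. nat \<bar>char_div \<rho> m $ i\<bar>)" by linarith
        then have "int l * - (char_div \<rho> m $ i) \<le> int l * int (\<Sum>i\<in>UNIV. nat \<bar>char_div \<rho> m $ i\<bar>)"
          by (intro mult_left_mono) auto
        then show ?thesis using False \<open>\<not> \<rho> i \<subseteq> \<tau>\<close> by (simp add: hat_exponent_def r'_def)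
      qed
      have "homog (charmon m ^ l * f) * X (hat_exponent \<sigma> r') =
          homog f * X (int l *s char_div \<rho> m + hat_exponent \<sigma> r')"
        by (simp add: homog_mult mono_power push_exponents_single char_div_smult mult_ac mult_single
            add.commute)
      also have "\<dots> \<in> laurent ` I" by (rule laurent_I_shift[OF r ge])
      finally show ?thesis using L[of l] l by (auto simp: mem_J)
    qed
    then show ?thesis by blast
  qed
  show ?thesis using m(1) m\<tau> neg inB inJ by (intro exI[of _ m] conjI ballI)
qed

section \<open>Points of the charts and of the subscheme\<close>

lemma chart_points_eval:
  assumes "\<gamma> \<in> chart_points \<sigma>"
  shows "chart.alg_character \<sigma> (chart_eval \<gamma>)"
  unfolding chart.alg_character_def
proof (intro conjI allI ballI)
  show "chart_eval \<gamma> (chart.C x) = x" for x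
    using assms by (simp add: chart_eval_single chart_points_def)
  fix f g assume "f \<in> B \<sigma>" "g \<in> B \<sigma>"
  then show "chart_eval \<gamma> (f * g) = chart_eval \<gamma> f * chart_eval \<gamma> g"
    using assms by (intro chart_eval_mult) (auto simp: chart.mem_B chart_points_def)
qed (rule chart_eval_add)

lemma chart_eval_restrict:
  assumes "\<gamma> = restrict \<epsilon> (dual_monoid \<sigma>)" "f \<in> B \<sigma>"
  shows "chart_eval \<gamma> f = chart_eval \<epsilon> f"
  unfolding chart_eval_def using assms by (intro sum.cong) (auto simp: chart.mem_B)

lemma chart_points_eqI:
  assumes "\<gamma> \<in> chart_points \<sigma>" "\<delta> \<in> chart_points \<sigma>"
    and "\<And>m. m \<in> dual_monoid \<sigma> \<Longrightarrow> \<gamma> m = \<delta> m"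
  shows "\<gamma> = \<delta>"
  using assms by (intro extensionalityI[of _ "dual_monoid \<sigma>"]) (auto simp: chart_points_def)

lemma restrict_chart_point:
  assumes "\<epsilon> \<in> chart_points \<tau>" "\<tau> \<subseteq> \<sigma>"
  shows "restrict \<epsilon> (dual_monoid \<sigma>) \<in> chart_points \<sigma>"
  unfolding chart_points_def
proof (intro CollectI conjI ballI)
  have sub: "dual_monoid \<sigma> \<subseteq> dual_monoid \<tau>" by (rule dual_monoid_antimono[OF assms(2)])
  show "restrict \<epsilon> (dual_monoid \<sigma>) \<in> extensional (dual_monoid \<sigma>)" by simp
  show "restrict \<epsilon> (dual_monoid \<sigma>) 0 = 1"
    using assms(1) by (simp add: chart_points_def dual_monoid_0)
  fix a b assume ab: "a \<in> dual_monoid \<sigma>" "b \<in> dual_monoid \<sigma>"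
  then have "\<epsilon> (a + b) = \<epsilon> a * \<epsilon> b" using assms(1) sub by (auto simp: chart_points_def)
  then show "restrict \<epsilon> (dual_monoid \<sigma>) (a + b) =
      restrict \<epsilon> (dual_monoid \<sigma>) a * restrict \<epsilon> (dual_monoid \<sigma>) b"
    using ab dual_monoid_add[OF ab] by simp
qed

definition scheme_points :: "(real ^ 'n) set \<Rightarrow> (int ^ 'n \<Rightarrow> complex) set" where
  "scheme_points \<sigma> = {\<gamma> \<in> chart_points \<sigma>. \<forall>g\<in>J \<sigma>. chart_eval \<gamma> g = 0}"

abbreviation K :: "(real ^ 'n) set \<Rightarrow> (int ^ 'n \<Rightarrow> complex) \<Rightarrow> (int ^ 'n \<Rightarrow>\<^sub>0 complex) set" where
  "K \<sigma> \<gamma> \<equiv> algebraic_quotient.germ_ker (B \<sigma>) (J \<sigma>) (chart_eval \<gamma>)"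

lemma chart_eval_mono_nonzero:
  assumes "\<epsilon> \<in> chart_points \<tau>" "m \<in> dual_monoid \<tau>" "- m \<in> dual_monoid \<tau>"
  shows "\<epsilon> m \<noteq> 0" "chart_eval \<epsilon> (charmon m ^ l) \<noteq> 0"
proof -
  have "\<epsilon> (m + - m) = \<epsilon> m * \<epsilon> (- m)" "\<epsilon> 0 = 1"
    using assms unfolding chart_points_def by blast+
  then show 0: "\<epsilon> m \<noteq> 0" by auto
  have "chart_eval \<epsilon> (charmon m ^ l) = chart_eval \<epsilon> (charmon m) ^ l"
    by (rule chart.alg_characterD(6)[OF chart_points_eval[OF assms(1)] mono_B[OF assms(2)]])
  then show "chart_eval \<epsilon> (charmon m ^ l) \<noteq> 0" using 0 by (simp add: chart_eval_single)
qed

text \<open>An equation of Y on the smaller chart becomes one on the larger chart after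
  multiplication by a power of the inverted monomial, which is nonzero at \<epsilon>.\<close>

lemma restrict_scheme_point_iff:
  assumes "\<sigma> \<in> \<Sigma>" "\<tau> \<in> \<Sigma>" "\<tau> \<subseteq> \<sigma>" and \<epsilon>: "\<epsilon> \<in> chart_points \<tau>"
  shows "restrict \<epsilon> (dual_monoid \<sigma>) \<in> scheme_points \<sigma> \<longleftrightarrow> \<epsilon> \<in> scheme_points \<tau>"
proof
  assume \<gamma>: "restrict \<epsilon> (dual_monoid \<sigma>) \<in> scheme_points \<sigma>"
  obtain m where m: "m \<in> dual_monoid \<sigma>" "m \<in> dual_monoid \<tau>" "- m \<in> dual_monoid \<tau>"
    "\<forall>f\<in>B \<tau>. \<exists>L. \<forall>l\<ge>L. charmon m ^ l * f \<in> B \<sigma>"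
    "\<forall>f\<in>J \<tau>. \<exists>L. \<forall>l\<ge>L. charmon m ^ l * f \<in> J \<sigma>"
    using face_monomial[OF assms(1-3)] by blast
  have "chart_eval \<epsilon> g = 0" if g: "g \<in> J \<tau>" for g
  proof -
    obtain l where l: "charmon m ^ l * g \<in> J \<sigma>" using m(5) g by blast
    then have "chart_eval (restrict \<epsilon> (dual_monoid \<sigma>)) (charmon m ^ l * g) = 0"
      using \<gamma> by (simp add: scheme_points_def)
    then have "chart_eval \<epsilon> (charmon m ^ l * g) = 0"
      using chart_eval_restrict[OF refl, of "charmon m ^ l * g" \<sigma> \<epsilon>] l by (simp add: mem_J)
    moreover have "chart_eval \<epsilon> (charmon m ^ l * g) = chart_eval \<epsilon> (charmon m ^ l) * chart_eval \<epsilon> g"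
      using g by (intro chart.alg_characterD(5)[OF chart_points_eval[OF \<epsilon>]])
        (auto simp: mem_J intro: chart.power_B mono_B m(2))
    ultimately show ?thesis using chart_eval_mono_nonzero(2)[OF \<epsilon> m(2,3)] by simp
  qed
  then show "\<epsilon> \<in> scheme_points \<tau>" using \<epsilon> by (simp add: scheme_points_def)
next
  assume "\<epsilon> \<in> scheme_points \<tau>"
  then have \<epsilon>J: "\<forall>g\<in>J \<tau>. chart_eval \<epsilon> g = 0" by (simp add: scheme_points_def)
  have "chart_eval (restrict \<epsilon> (dual_monoid \<sigma>)) g = 0" if g: "g \<in> J \<sigma>" for g
  proof -
    have "g \<in> B \<sigma>" using g by (simp add: mem_J)
    then have "chart_eval (restrict \<epsilon> (dual_monoid \<sigma>)) g = chart_eval \<epsilon> g"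
      by (rule chart_eval_restrict[OF refl])
    then show ?thesis using \<epsilon>J J_antimono[OF assms(3)] g by auto
  qed
  then show "restrict \<epsilon> (dual_monoid \<sigma>) \<in> scheme_points \<sigma>"
    using restrict_chart_point[OF \<epsilon> assms(3)] by (simp add: scheme_points_def)
qed

section \<open>Glueing is an equivalence relation\<close>

lemma glue_refl: "\<sigma> \<in> \<Sigma> \<Longrightarrow> \<gamma> \<in> chart_points \<sigma> \<Longrightarrow> ((\<sigma>, \<gamma>), (\<sigma>, \<gamma>)) \<in> glue \<Sigma>"
  by (auto simp: glue_def chart_points_def extensional_restrict intro!: bexI[of _ \<gamma>])

lemma glueE:
  assumes "((\<sigma>, \<gamma>), (\<tau>, \<delta>)) \<in> glue \<Sigma>"
  obtains \<epsilon> where "\<sigma> \<in> \<Sigma>" "\<tau> \<in> \<Sigma>" "\<epsilon> \<in> chart_points (\<sigma> \<inter> \<tau>)"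
    "\<gamma> = restrict \<epsilon> (dual_monoid \<sigma>)" "\<delta> = restrict \<epsilon> (dual_monoid \<tau>)"
  using assms by (auto simp: glue_def)

lemma glueI:
  assumes "\<sigma> \<in> \<Sigma>" "\<tau> \<in> \<Sigma>" "\<epsilon> \<in> chart_points (\<sigma> \<inter> \<tau>)"
    "\<gamma> = restrict \<epsilon> (dual_monoid \<sigma>)" "\<delta> = restrict \<epsilon> (dual_monoid \<tau>)"
  shows "((\<sigma>, \<gamma>), (\<tau>, \<delta>)) \<in> glue \<Sigma>"
  using assms by (auto simp: glue_def)

lemma glue_sym: "p \<in> glue \<Sigma> \<Longrightarrow> prod.swap p \<in> glue \<Sigma>"
  by (auto simp: glue_def Int_commute)

lemma glue_points: "((\<sigma>, \<gamma>), (\<tau>, \<delta>)) \<in> glue \<Sigma> \<Longrightarrow> \<gamma> \<in> chart_points \<sigma> \<and> \<delta> \<in> chart_points \<tau>"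
  by (elim glueE) (auto intro: restrict_chart_point)

text \<open>A point of \<open>U\<^sub>\<sigma>\<close> lies in the open subset \<open>U\<^sub>\<tau>\<close> if the monomial that cuts out \<open>\<tau>\<close> does
  not vanish there.\<close>

lemma extend_chart_point:
  assumes \<gamma>: "\<gamma> \<in> chart_points \<sigma>" and sub: "\<tau> \<subseteq> \<sigma>"
    and m: "m \<in> dual_monoid \<sigma>" "\<gamma> m \<noteq> 0" "- m \<in> dual_monoid \<tau>"
    and loc: "\<And>a. a \<in> dual_monoid \<tau> \<Longrightarrow> \<exists>l::nat. a + int l *s m \<in> dual_monoid \<sigma>"
  obtains \<epsilon> where "\<epsilon> \<in> chart_points \<tau>" "\<gamma> = restrict \<epsilon> (dual_monoid \<sigma>)"
proof -
  have mult: "\<gamma> (a + b) = \<gamma> a * \<gamma> b" if "a \<in> dual_monoid \<sigma>" "b \<in> dual_monoid \<sigma>" for a b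
    using \<gamma> that by (auto simp: chart_points_def)
  have \<gamma>0: "\<gamma> 0 = 1" using \<gamma> by (auto simp: chart_points_def)
  have lm: "int l *s m \<in> dual_monoid \<sigma>" for l
    using m(1) by (auto simp: dual_monoid_def rvec_simps)
  have pow: "\<gamma> (int l *s m) = \<gamma> m ^ l" for l
  proof (induction l)
    case (Suc l)
    have "int (Suc l) *s m = m + int l *s m" by (simp add: vec_eq_iff algebra_simps)
    then show ?case using mult[OF m(1) lm[of l]] Suc by simp
  qed (simp add: \<gamma>0)
  define n where "n a = (SOME l::nat. a + int l *s m \<in> dual_monoid \<sigma>)" for a
  have n: "a + int (n a) *s m \<in> dual_monoid \<sigma>" if "a \<in> dual_monoid \<tau>" for a
    unfolding n_def using loc[OF that] by (rule someI_ex)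
  define \<epsilon> where "\<epsilon> = restrict (\<lambda>a. \<gamma> (a + int (n a) *s m) / \<gamma> m ^ n a) (dual_monoid \<tau>)"
  \<comment> \<open>The quotient does not depend on the exponent that was chosen to clear the
    denominator; multiplicativity rests on this.\<close>
  have \<epsilon>: "\<epsilon> a * \<gamma> m ^ l = \<gamma> (a + int l *s m)"
    if a: "a \<in> dual_monoid \<tau>" and l: "a + int l *s m \<in> dual_monoid \<sigma>" for a l
  proof -
    have eq: "(a + int l *s m) + int (n a) *s m = (a + int (n a) *s m) + int l *s m"
      by (simp add: add_ac)
    have "\<gamma> (a + int l *s m) * \<gamma> m ^ n a = \<gamma> ((a + int l *s m) + int (n a) *s m)"
      unfolding mult[OF l lm[of "n a"]] pow ..
    also have "\<dots> = \<gamma> (a + int (n a) *s m) * \<gamma> m ^ l"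
      unfolding eq mult[OF n[OF a] lm[of l]] pow ..
    finally show ?thesis using a m(2) by (simp add: \<epsilon>_def field_simps)
  qed
  have "\<epsilon> \<in> chart_points \<tau>"
    unfolding chart_points_def
  proof (intro CollectI conjI ballI)
    show "\<epsilon> \<in> extensional (dual_monoid \<tau>)" by (simp add: \<epsilon>_def)
    show "\<epsilon> 0 = 1" using \<epsilon>[of 0 0] \<gamma>0 by (simp add: dual_monoid_0)
    fix a b assume ab: "a \<in> dual_monoid \<tau>" "b \<in> dual_monoid \<tau>"
    have eq: "(a + b) + int (n a + n b) *s m = (a + int (n a) *s m) + (b + int (n b) *s m)"
      by (simp add: vec_eq_iff algebra_simps)
    have "(a + b) + int (n a + n b) *s m \<in> dual_monoid \<sigma>"
      unfolding eq by (rule dual_monoid_add[OF n[OF ab(1)] n[OF ab(2)]])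
    then have "\<epsilon> (a + b) * \<gamma> m ^ (n a + n b) = \<gamma> ((a + b) + int (n a + n b) *s m)"
      by (rule \<epsilon>[OF dual_monoid_add[OF ab]])
    also have "\<dots> = \<gamma> ((a + int (n a) *s m) + (b + int (n b) *s m))"
      unfolding eq ..
    also have "\<dots> = (\<epsilon> a * \<gamma> m ^ n a) * (\<epsilon> b * \<gamma> m ^ n b)"
      using mult[OF n[OF ab(1)] n[OF ab(2)]] \<epsilon>[OF ab(1) n[OF ab(1)]] \<epsilon>[OF ab(2) n[OF ab(2)]] by simp
    finally show "\<epsilon> (a + b) = \<epsilon> a * \<epsilon> b" using m(2) by (simp add: power_add)
  qed
  moreover have "\<gamma> = restrict \<epsilon> (dual_monoid \<sigma>)"
  proof (rule chart_points_eqI[OF \<gamma> restrict_chart_point[OF \<open>\<epsilon> \<in> chart_points \<tau>\<close> sub]])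
    fix a assume a: "a \<in> dual_monoid \<sigma>"
    then show "\<gamma> a = restrict \<epsilon> (dual_monoid \<sigma>) a"
      using \<epsilon>[of a 0] dual_monoid_antimono[OF sub] by auto
  qed
  ultimately show ?thesis by (rule that)
qed

text \<open>The inclusion of the chart of a face is injective on points: the value at
  \<open>a\<close> is the value at a shifted exponent divided by a power of the nonzero value at
  \<open>m\<close>.\<close>

lemma chart_point_unique_extension:
  assumes "\<sigma> \<in> \<Sigma>" "\<tau> \<in> \<Sigma>" "\<tau> \<subseteq> \<sigma>" and \<epsilon>: "\<epsilon> \<in> chart_points \<tau>" "\<epsilon>' \<in> chart_points \<tau>"
    and eq: "restrict \<epsilon> (dual_monoid \<sigma>) = restrict \<epsilon>' (dual_monoid \<sigma>)"
  shows "\<epsilon> = \<epsilon>'"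
proof (rule chart_points_eqI[OF \<epsilon>])
  fix a assume a: "a \<in> dual_monoid \<tau>"
  obtain m where m: "m \<in> dual_monoid \<sigma>" "m \<in> dual_monoid \<tau>" "- m \<in> dual_monoid \<tau>"
    "\<forall>f\<in>B \<tau>. \<exists>L. \<forall>l\<ge>L. charmon m ^ l * f \<in> B \<sigma>"
    "\<forall>f\<in>J \<tau>. \<exists>L. \<forall>l\<ge>L. charmon m ^ l * f \<in> J \<sigma>"
    using face_monomial[OF assms(1-3)] by blast
  obtain l where l: "charmon m ^ l * charmon a \<in> B \<sigma>" using m(4) mono_B[OF a] by blast
  have "chart_eval \<epsilon> (charmon m ^ l * charmon a) = chart_eval \<epsilon>' (charmon m ^ l * charmon a)"
    using chart_eval_restrict[OF refl l, of \<epsilon>] chart_eval_restrict[OF refl l, of \<epsilon>'] eq by simp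
  moreover have "chart_eval \<delta> (charmon m ^ l * charmon a) = \<delta> m ^ l * \<delta> a" if \<delta>: "\<delta> \<in> chart_points \<tau>" for \<delta>
  proof -
    note ch = chart.alg_characterD[OF chart_points_eval[OF \<delta>]]
    show ?thesis
      by (simp add: ch(5) ch(6) chart.power_B mono_B m(2) a chart_eval_single)
  qed
  moreover have "\<epsilon> m = \<epsilon>' m" using fun_cong[OF eq, of m] m(1) by simp
  ultimately have "\<epsilon> m ^ l * \<epsilon> a = \<epsilon> m ^ l * \<epsilon>' a" using \<epsilon> by simp
  then show "\<epsilon> a = \<epsilon>' a" using chart_eval_mono_nonzero(1)[OF \<epsilon>(1) m(2,3)] by simp
qed

text \<open>The middle point lies in two open faces of its chart, so both cutting monomials are
  nonzero there. So is their product, whose exponent cuts out the triple intersection; the point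
  comes from that chart and can be restricted to \<sigma> \<inter> \<upsilon>.\<close>

lemma glue_trans:
  assumes "((\<sigma>, \<gamma>), (\<tau>, \<delta>)) \<in> glue \<Sigma>" "((\<tau>, \<delta>), (\<upsilon>, \<eta>)) \<in> glue \<Sigma>"
  shows "((\<sigma>, \<gamma>), (\<upsilon>, \<eta>)) \<in> glue \<Sigma>"
proof -
  obtain \<epsilon>\<^sub>1 where 1: "\<sigma> \<in> \<Sigma>" "\<tau> \<in> \<Sigma>" "\<epsilon>\<^sub>1 \<in> chart_points (\<sigma> \<inter> \<tau>)"
    "\<gamma> = restrict \<epsilon>\<^sub>1 (dual_monoid \<sigma>)" "\<delta> = restrict \<epsilon>\<^sub>1 (dual_monoid \<tau>)"
    using assms(1) by (rule glueE)
  obtain \<epsilon>\<^sub>2 where 2: "\<upsilon> \<in> \<Sigma>" "\<epsilon>\<^sub>2 \<in> chart_points (\<tau> \<inter> \<upsilon>)"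
    "\<delta> = restrict \<epsilon>\<^sub>2 (dual_monoid \<tau>)" "\<eta> = restrict \<epsilon>\<^sub>2 (dual_monoid \<upsilon>)"
    using assms(2) by (rule glueE)
  let ?\<omega> = "\<sigma> \<inter> \<tau> \<inter> \<upsilon>"
  have cones: "\<sigma> \<inter> \<tau> \<in> \<Sigma>" "\<tau> \<inter> \<upsilon> \<in> \<Sigma>" "?\<omega> \<in> \<Sigma>" using 1 2 fan_Int by auto
  have \<delta>: "\<delta> \<in> chart_points \<tau>" using glue_points[OF assms(1)] by simp
  obtain m where m: "m \<in> dual_monoid \<tau>" "\<sigma> \<inter> \<tau> = {x \<in> \<tau>. rvec m \<bullet> x = 0}"
    using face_functional[OF 1(2) cones(1)] by blast
  obtain m' where m': "m' \<in> dual_monoid \<tau>" "\<tau> \<inter> \<upsilon> = {x \<in> \<tau>. rvec m' \<bullet> x = 0}"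
    using face_functional[OF 1(2) cones(2)] by blast
  have "\<delta> m \<noteq> 0"
  proof -
    have "\<forall>x\<in>\<sigma> \<inter> \<tau>. rvec m \<bullet> x = 0" using m(2) by blast
    then have "- m \<in> dual_monoid (\<sigma> \<inter> \<tau>)" "m \<in> dual_monoid (\<sigma> \<inter> \<tau>)"
      by (simp_all add: dual_monoid_def rvec_simps)
    then show ?thesis using chart_eval_mono_nonzero(1)[OF 1(3)] 1(5) m(1) by simp
  qed
  moreover have "\<delta> m' \<noteq> 0"
  proof -
    have "\<forall>x\<in>\<tau> \<inter> \<upsilon>. rvec m' \<bullet> x = 0" using m'(2) by blast
    then have "- m' \<in> dual_monoid (\<tau> \<inter> \<upsilon>)" "m' \<in> dual_monoid (\<tau> \<inter> \<upsilon>)"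
      by (simp_all add: dual_monoid_def rvec_simps)
    then show ?thesis using chart_eval_mono_nonzero(1)[OF 2(2)] 2(3) m'(1) by simp
  qed
  ultimately have nz: "\<delta> (m + m') \<noteq> 0" using \<delta> m(1) m'(1) by (auto simp: chart_points_def)
  have mm: "m + m' \<in> dual_monoid \<tau>" by (rule dual_monoid_add[OF m(1) m'(1)])
  \<comment> \<open>Both summands are nonnegative on \<tau>, so their sum vanishes only where both
    do.\<close>
  have \<omega>: "?\<omega> = {x \<in> \<tau>. rvec (m + m') \<bullet> x = 0}"
  proof
    show "?\<omega> \<subseteq> {x \<in> \<tau>. rvec (m + m') \<bullet> x = 0}"
    proof
      fix x assume x: "x \<in> ?\<omega>"
      then have "rvec m \<bullet> x = 0" "rvec m' \<bullet> x = 0" using m(2) m'(2) by blast+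
      then show "x \<in> {x \<in> \<tau>. rvec (m + m') \<bullet> x = 0}" using x by (simp add: rvec_simps inner_add_left)
    qed
    show "{x \<in> \<tau>. rvec (m + m') \<bullet> x = 0} \<subseteq> ?\<omega>"
    proof
      fix x assume "x \<in> {x \<in> \<tau>. rvec (m + m') \<bullet> x = 0}"
      then have x: "x \<in> \<tau>" "rvec m \<bullet> x + rvec m' \<bullet> x = 0" by (simp_all add: rvec_simps inner_add_left)
      moreover have "0 \<le> rvec m \<bullet> x" "0 \<le> rvec m' \<bullet> x" using x(1) m(1) m'(1) by (simp_all add: dual_monoid_def)
      ultimately have "rvec m \<bullet> x = 0" "rvec m' \<bullet> x = 0" by linarith+
      then show "x \<in> ?\<omega>" using x(1) m(2) m'(2) by blast
    qed
  qed
  have neg: "- (m + m') \<in> dual_monoid ?\<omega>"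
    unfolding \<omega> dual_monoid_def by (auto simp: rvec_simps inner_simps)
  have shift: "\<exists>l::nat. a + int l *s (m + m') \<in> dual_monoid \<tau>" if "a \<in> dual_monoid ?\<omega>" for a
    using dual_monoid_face_shift[OF 1(2) mm, of a] that unfolding \<omega> .
  have "?\<omega> \<subseteq> \<tau>" by blast
  from extend_chart_point[OF \<delta> this mm nz neg shift]
  obtain \<epsilon> where \<epsilon>: "\<epsilon> \<in> chart_points ?\<omega>" "\<delta> = restrict \<epsilon> (dual_monoid \<tau>)" .
  have sub: "dual_monoid \<sigma> \<subseteq> dual_monoid (\<sigma> \<inter> \<tau>)" "dual_monoid \<upsilon> \<subseteq> dual_monoid (\<tau> \<inter> \<upsilon>)"
    "dual_monoid \<sigma> \<subseteq> dual_monoid (\<sigma> \<inter> \<upsilon>)" "dual_monoid \<upsilon> \<subseteq> dual_monoid (\<sigma> \<inter> \<upsilon>)"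
    "dual_monoid \<tau> \<subseteq> dual_monoid (\<sigma> \<inter> \<tau>)" "dual_monoid \<tau> \<subseteq> dual_monoid (\<tau> \<inter> \<upsilon>)"
    by (intro dual_monoid_antimono; blast)+
  \<comment> \<open>Uniqueness of extensions identifies the given witnesses with restrictions of the
    point of the triple intersection.\<close>
  have "\<epsilon>\<^sub>1 = restrict \<epsilon> (dual_monoid (\<sigma> \<inter> \<tau>))"
    by (rule chart_point_unique_extension[OF 1(2) cones(1) _ 1(3) restrict_chart_point[OF \<epsilon>(1)]])
      (use \<epsilon>(2) 1(5) sub(5) in \<open>auto simp: Int_absorb1\<close>)
  moreover have "\<epsilon>\<^sub>2 = restrict \<epsilon> (dual_monoid (\<tau> \<inter> \<upsilon>))"
    by (rule chart_point_unique_extension[OF 1(2) cones(2) _ 2(2) restrict_chart_point[OF \<epsilon>(1)]])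
      (use \<epsilon>(2) 2(3) sub(6) in \<open>auto simp: Int_absorb1\<close>)
  ultimately show ?thesis
    using 1 2 sub
    by (intro glueI[OF 1(1) 2(1) restrict_chart_point[OF \<epsilon>(1), of "\<sigma> \<inter> \<upsilon>"]])
      (auto simp: Int_absorb1)
qed

end

section \<open>Global sections of a zero-dimensional subscheme\<close>

text \<open>\<open>V\<close> and \<open>W\<close> are matched coordinate by coordinate. The vector
  space structure of \<open>W\<close> is transported from \<open>V\<close>, so its axioms need no
  separate check.\<close>

lemma vspace_iso_if_coordinates:
  assumes V: "has_vdim V N" and \<psi>: "linear_coordinates W N \<psi>"
    and add: "\<And>v w. v \<in> carrier W \<Longrightarrow> w \<in> carrier W \<Longrightarrow> v \<oplus>\<^bsub>W\<^esub> w \<in> carrier W"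
    and smult: "\<And>c v. v \<in> carrier W \<Longrightarrow> c \<odot>\<^bsub>W\<^esub> v \<in> carrier W"
    and zero: "\<zero>\<^bsub>W\<^esub> \<in> carrier W" "\<And>i. i < N \<Longrightarrow> \<psi> \<zero>\<^bsub>W\<^esub> i = 0"
  shows "vspace_iso V W"
proof -
  obtain \<phi> where \<phi>: "linear_coordinates V N \<phi>" using has_vdim_coordinates[OF V] by blast
  interpret V: vectorspace complex_field V using V by (simp add: has_vdim_def)
  define T where "T v = (SOME w. w \<in> carrier W \<and> (\<forall>i<N. \<psi> w i = \<phi> v i))" for v
  have T: "T v \<in> carrier W" "\<forall>i<N. \<psi> (T v) i = \<phi> v i" for v
  proof -
    have "\<exists>w. w \<in> carrier W \<and> (\<forall>i<N. \<psi> w i = \<phi> v i)"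
      using linear_coordinatesD(4)[OF \<psi>, of "\<phi> v"] by (simp add: Bex_def)
    from someI_ex[OF this] show "T v \<in> carrier W" "\<forall>i<N. \<psi> (T v) i = \<phi> v i"
      unfolding T_def by blast+
  qed
  have TI: "T v = w" if "w \<in> carrier W" "\<And>i. i < N \<Longrightarrow> \<psi> w i = \<phi> v i" for v w
    by (rule linear_coordinatesD(3)[OF \<psi> T(1) that(1)]) (use T(2) that(2) in simp)
  have inj: "inj_on T (carrier V)"
  proof (rule inj_onI)
    fix v w assume vw: "v \<in> carrier V" "w \<in> carrier V" "T v = T w"
    have "\<forall>i<N. \<phi> v i = \<phi> w i" using T(2)[of v] T(2)[of w] vw(3) by simp
    then show "v = w" by (rule linear_coordinatesD(3)[OF \<phi> vw(1,2)])
  qed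
  have surj: "T ` carrier V = carrier W"
  proof
    show "T ` carrier V \<subseteq> carrier W" using T(1) by blast
    show "carrier W \<subseteq> T ` carrier V"
    proof
      fix w assume w: "w \<in> carrier W"
      obtain v where v: "v \<in> carrier V" "\<forall>i<N. \<phi> v i = \<psi> w i"
        using linear_coordinatesD(4)[OF \<phi>, of "\<psi> w"] by (rule bexE)
      have "T v = w" by (rule TI[OF w]) (use v(2) in simp)
      then show "w \<in> T ` carrier V" using v(1) by blast
    qed
  qed
  have "linear_map complex_field V W T"
  proof (rule vectorspace_image(2)[OF V.vectorspace_axioms surj])
    show "T (x \<oplus>\<^bsub>V\<^esub> y) = T x \<oplus>\<^bsub>W\<^esub> T y" if "x \<in> carrier V" "y \<in> carrier V" for x y
      by (rule TI[OF add[OF T(1) T(1)]])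
        (use T(2) that in \<open>simp add: linear_coordinatesD(1)[OF \<psi> T(1) T(1)] linear_coordinatesD(1)[OF \<phi>]\<close>)
    show "T (c \<odot>\<^bsub>V\<^esub> x) = c \<odot>\<^bsub>W\<^esub> T x" if "x \<in> carrier V" for c x
      by (rule TI[OF smult[OF T(1)]])
        (use T(2) that in \<open>simp add: linear_coordinatesD(2)[OF \<psi> T(1)] linear_coordinatesD(2)[OF \<phi>]\<close>)
    show "T \<zero>\<^bsub>V\<^esub> = \<zero>\<^bsub>W\<^esub>"
    proof (rule TI[OF zero(1)])
      fix i assume i: "i < N"
      \<comment> \<open>The coordinates of zero vanish by homogeneity with the scalar 0.\<close>
      have "\<phi> (0 \<odot>\<^bsub>V\<^esub> \<zero>\<^bsub>V\<^esub>) i = 0 * \<phi> \<zero>\<^bsub>V\<^esub> i" by (rule linear_coordinatesD(2)[OF \<phi> _ i]) simp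
      moreover have "0 \<odot>\<^bsub>V\<^esub> \<zero>\<^bsub>V\<^esub> = \<zero>\<^bsub>V\<^esub>" using V.lmult_0[of "\<zero>\<^bsub>V\<^esub>"] by simp
      ultimately show "\<psi> \<zero>\<^bsub>W\<^esub> i = \<phi> \<zero>\<^bsub>V\<^esub> i" using zero(2)[OF i] by simp
    qed
  qed
  moreover have "bij_betw T (carrier V) (carrier W)" using inj surj by (simp add: bij_betw_def)
  ultimately show ?thesis unfolding vspace_iso_def by blast
qed

text \<open>An inequality, because a chart that misses Y has the zero ring, of dimension minus
  infinity.\<close>

locale zero_dim_toric_subscheme = toric_subscheme \<Sigma> \<rho> I
  for \<Sigma> :: "(real ^ 'n) set set" and \<rho> :: "'k::finite \<Rightarrow> (real ^ 'n) set" and I :: "'k cox set" +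
  assumes krull: "\<sigma> \<in> \<Sigma> \<Longrightarrow> krull_dim (chart_alg \<rho> I \<sigma>) \<le> 0"
begin

lemma zero_dim_chart: "\<sigma> \<in> \<Sigma> \<Longrightarrow> zero_dim_monoid_algebra (dual_monoid \<sigma>) (J \<sigma>)"
proof -
  assume "\<sigma> \<in> \<Sigma>"
  then have "krull_dim (quot_alg (monoid_alg (dual_monoid \<sigma>)) (J \<sigma>)) \<le> 0"
    using krull by (simp add: chart_alg_def)
  moreover have "countable (dual_monoid \<sigma>)" by (rule countableI_type)
  ultimately show ?thesis
    by unfold_locales (rule chart.algebraic_if_krull_dim_0)
qed

context
  fixes \<sigma> assumes \<sigma>: "\<sigma> \<in> \<Sigma>"
begin

interpretation Z: zero_dim_monoid_algebra "dual_monoid \<sigma>" "J \<sigma>"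
  by (rule zero_dim_chart[OF \<sigma>])

lemma point_eval: "\<gamma> \<in> scheme_points \<sigma> \<Longrightarrow> Z.point (chart_eval \<gamma>)"
  using chart_points_eval by (simp add: Z.point_def scheme_points_def)

lemma K_ideal: "\<gamma> \<in> scheme_points \<sigma> \<Longrightarrow> chart.alg_ideal \<sigma> (K \<sigma> \<gamma>)"
  by (rule Z.germ_ker_ideal[OF point_eval])

lemma J_subset_K: "\<gamma> \<in> scheme_points \<sigma> \<Longrightarrow> J \<sigma> \<subseteq> K \<sigma> \<gamma>"
  by (rule Z.J_subset_germ_ker[OF point_eval])

lemma mem_K: "f \<in> K \<sigma> \<gamma> \<longleftrightarrow> f \<in> B \<sigma> \<and> (\<exists>u\<in>B \<sigma>. chart_eval \<gamma> u \<noteq> 0 \<and> u * f \<in> J \<sigma>)"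
  by (auto simp: Z.germ_ker_def)

lemma K_unit:
  "\<gamma> \<in> scheme_points \<sigma> \<Longrightarrow> w \<in> B \<sigma> \<Longrightarrow> chart_eval \<gamma> w \<noteq> 0 \<Longrightarrow> \<exists>s\<in>B \<sigma>. 1 - w * s \<in> K \<sigma> \<gamma>"
  by (rule Z.germ_unit[OF point_eval])

text \<open>\<open>Inter_germ_ker\<close> asks for all characters of the coordinate ring; each is
  evaluation at a chart point, namely at its values on the monomials.\<close>

lemma in_J_if_germs:
  assumes f: "f \<in> B \<sigma>" and germs: "\<And>\<gamma>. \<gamma> \<in> scheme_points \<sigma> \<Longrightarrow> f \<in> K \<sigma> \<gamma>"
  shows "f \<in> J \<sigma>"
proof (rule Z.Inter_germ_ker[OF f])
  fix \<phi> assume \<phi>: "Z.point \<phi>"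
  note ch = chart.alg_characterD[OF Z.point_character[OF \<phi>]]
  define \<gamma> where "\<gamma> = restrict (\<lambda>m. \<phi> (charmon m)) (dual_monoid \<sigma>)"
  have eval: "chart_eval \<gamma> g = \<phi> g" if g: "g \<in> B \<sigma>" for g
  proof -
    have gA: "m \<in> dual_monoid \<sigma>" if "m \<in> Poly_Mapping.keys g" for m
      using g that by (auto simp: chart.mem_B)
    have "\<phi> g = \<phi> (\<Sum>m\<in>Poly_Mapping.keys g. chart.C (Poly_Mapping.lookup g m) * charmon m)"
      by (subst (1) poly_mapping_sum_single[of "Poly_Mapping.keys g" g]) (simp_all add: mult_single)
    also have "\<dots> = (\<Sum>m\<in>Poly_Mapping.keys g. \<phi> (chart.C (Poly_Mapping.lookup g m) * charmon m))"
      by (rule chart.alg_character_sum[OF Z.point_character[OF \<phi>]])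
        (intro chart.mult_B chart.C_B mono_B gA)
    also have "\<dots> = chart_eval \<gamma> g"
      unfolding chart_eval_def
    proof (rule sum.cong[OF refl])
      fix m assume "m \<in> Poly_Mapping.keys g"
      then show "\<phi> (chart.C (Poly_Mapping.lookup g m) * charmon m) = Poly_Mapping.lookup g m * \<gamma> m"
        using ch(5)[OF chart.C_B mono_B[OF gA]] ch(1) gA by (simp add: \<gamma>_def)
    qed
    finally show ?thesis ..
  qed
  have "\<gamma> \<in> chart_points \<sigma>"
    unfolding chart_points_def
  proof (intro CollectI conjI ballI)
    show "\<gamma> \<in> extensional (dual_monoid \<sigma>)" by (simp add: \<gamma>_def)
    show "\<gamma> 0 = 1" using ch(2) by (simp add: \<gamma>_def dual_monoid_0)
    fix a b assume ab: "a \<in> dual_monoid \<sigma>" "b \<in> dual_monoid \<sigma>"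
    have "charmon (a + b) = charmon a * charmon b" by (simp add: mult_single)
    then show "\<gamma> (a + b) = \<gamma> a * \<gamma> b"
      using ch(5)[OF mono_B[OF ab(1)] mono_B[OF ab(2)]] ab dual_monoid_add[OF ab] by (simp add: \<gamma>_def)
  qed
  moreover have "chart_eval \<gamma> g = 0" if "g \<in> J \<sigma>" for g
    using that eval[of g] \<phi> by (simp add: Z.point_def mem_J)
  ultimately have "f \<in> K \<sigma> \<gamma>" by (intro germs) (simp add: scheme_points_def)
  then obtain u where "u \<in> B \<sigma>" "chart_eval \<gamma> u \<noteq> 0" "u * f \<in> J \<sigma>" unfolding mem_K by blast
  then show "f \<in> Z.germ_ker \<phi>" using f eval by (auto simp: Z.germ_ker_def)
qed

lemma germs_realized_chart:
  assumes "finite S" "S \<subseteq> scheme_points \<sigma>" "\<And>\<gamma>. \<gamma> \<in> S \<Longrightarrow> b \<gamma> \<in> B \<sigma>"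
  shows "\<exists>f\<in>B \<sigma>. \<forall>\<gamma>\<in>S. f - b \<gamma> \<in> K \<sigma> \<gamma>"
proof (rule Z.germs_realized[OF assms(1)])
  show "Z.point (chart_eval \<gamma>)" if "\<gamma> \<in> S" for \<gamma> using point_eval assms(2) that by blast
  show "\<exists>x\<in>B \<sigma>. chart_eval \<gamma> x \<noteq> chart_eval \<gamma>' x" if S: "\<gamma> \<in> S" "\<gamma>' \<in> S" "\<gamma> \<noteq> \<gamma>'" for \<gamma> \<gamma>'
  proof (rule ccontr)
    assume n: "\<not> ?thesis"
    have "\<gamma> m = \<gamma>' m" if "m \<in> dual_monoid \<sigma>" for m
      using n mono_B[OF that] chart_eval_single[of _ m 1] by (metis mult_1)
    then show False
      using chart_points_eqI[of \<gamma> \<sigma> \<gamma>'] S assms(2) by (auto simp: scheme_points_def)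
  qed
qed (rule assms(3))

text \<open>Gordan's lemma gives finitely many monomial generators, and each is algebraic modulo
  \<open>J \<sigma>\<close>.\<close>

lemma finite_spanning: "\<exists>F. finite F \<and> F \<subseteq> B \<sigma> \<and> B \<sigma> \<subseteq> Z.mspan F"
proof -
  obtain G where G: "finite G" "G \<subseteq> dual_monoid \<sigma>"
    "\<forall>m\<in>dual_monoid \<sigma>. \<exists>k::int ^ 'n \<Rightarrow> nat. m = (\<Sum>g\<in>G. int (k g) *s g)"
    using dual_monoid_generators[OF \<sigma>] by blast
  have "charmon ` G \<subseteq> B \<sigma>" using G(2) mono_B by blast
  then obtain F where F: "finite F" "F \<subseteq> B \<sigma>" "\<And>k. (\<Prod>x\<in>charmon ` G. x ^ k x) \<in> Z.mspan F"
    using Z.monomials_mspan[of "charmon ` G"] G(1) by blast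
  have inj: "inj_on charmon G" by (auto simp: inj_on_def dest: arg_cong[of _ _ Poly_Mapping.keys])
  have prod: "(\<Prod>g\<in>G'. charmon g ^ k g) = charmon (\<Sum>g\<in>G'. int (k g) *s g)" if "finite G'" for G' and k :: "int ^ 'n \<Rightarrow> nat"
    using that by (induction G' rule: finite_induct) (simp_all add: mono_power mult_single)
  have mono_span: "charmon m \<in> Z.mspan F" if m: "m \<in> dual_monoid \<sigma>" for m
  proof -
    obtain k :: "int ^ 'n \<Rightarrow> nat" where k: "m = (\<Sum>g\<in>G. int (k g) *s g)" using G(3) m by blast
    have "charmon m = (\<Prod>x\<in>charmon ` G. x ^ k (the_elem (Poly_Mapping.keys x)))"
      using prod[OF G(1), of k] by (simp add: k prod.reindex[OF inj])
    then show ?thesis using F(3)[of "\<lambda>x. k (the_elem (Poly_Mapping.keys x))"] by simp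
  qed
  have "f \<in> Z.mspan F" if f: "f \<in> B \<sigma>" for f
  proof -
    have "f = (\<Sum>m\<in>Poly_Mapping.keys f. chart.C (Poly_Mapping.lookup f m) * charmon m)"
      by (subst (1) poly_mapping_sum_single[of "Poly_Mapping.keys f" f]) (simp_all add: mult_single)
    also have "\<dots> \<in> Z.mspan F"
      using f by (intro Z.mspan_sum Z.mspan_scale mono_span) (auto simp: chart.mem_B)
    finally show ?thesis .
  qed
  then show ?thesis using F(1,2) by blast
qed

text \<open>A chart point is recovered from its evaluation map on monomials, so finiteness passes
  over from the points of the algebra.\<close>

lemma finite_scheme_points: "finite (scheme_points \<sigma>)"
proof -
  obtain F where F: "finite F" "F \<subseteq> B \<sigma>" "B \<sigma> \<subseteq> Z.mspan F" using finite_spanning by blast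
  have "(\<lambda>\<gamma>. restrict (chart_eval \<gamma>) (B \<sigma>)) ` scheme_points \<sigma> \<subseteq> (\<lambda>\<phi>. restrict \<phi> (B \<sigma>)) ` Collect Z.point"
    using point_eval by blast
  then have "finite ((\<lambda>\<gamma>. restrict (chart_eval \<gamma>) (B \<sigma>)) ` scheme_points \<sigma>)"
    using Z.finite_points[OF F] by (rule finite_subset)
  moreover have "inj_on (\<lambda>\<gamma>. restrict (chart_eval \<gamma>) (B \<sigma>)) (scheme_points \<sigma>)"
  proof (rule inj_onI)
    fix \<gamma> \<delta> assume p: "\<gamma> \<in> scheme_points \<sigma>" "\<delta> \<in> scheme_points \<sigma>"
      and eq: "restrict (chart_eval \<gamma>) (B \<sigma>) = restrict (chart_eval \<delta>) (B \<sigma>)"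
    have "\<gamma> m = \<delta> m" if "m \<in> dual_monoid \<sigma>" for m
      using fun_cong[OF eq, of "charmon m"] mono_B[OF that] by (simp add: chart_eval_single)
    then show "\<gamma> = \<delta>" using chart_points_eqI[of \<gamma> \<sigma> \<delta>] p by (simp add: scheme_points_def)
  qed
  ultimately show ?thesis by (rule finite_imageD)
qed

lemma coordinates_exist:
  assumes \<gamma>: "\<gamma> \<in> scheme_points \<sigma>"
  shows "\<exists>\<theta>. chart.coordinates_mod \<sigma> (K \<sigma> \<gamma>) (vectorspace.dim complex_field (local_ring \<rho> I (\<sigma>, \<gamma>))) \<theta>"
proof -
  obtain F where F: "finite F" "F \<subseteq> B \<sigma>" "B \<sigma> \<subseteq> Z.mspan F" using finite_spanning by blast
  have eq: "local_ring \<rho> I (\<sigma>, \<gamma>) = Z.L (chart_eval \<gamma>)"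
    by (simp add: local_ring_def chart_alg_def)
  show ?thesis
    using Z.germ_coordinates_exist[OF point_eval[OF \<gamma>] F]
    unfolding eq .
qed

end

text \<open>A multiplier from the smaller chart is brought into the larger ring by a power of the
  inverted monomial and stays nonzero at the point.\<close>

lemma K_restrict:
  assumes "\<sigma> \<in> \<Sigma>" "\<tau> \<in> \<Sigma>" "\<tau> \<subseteq> \<sigma>" "\<epsilon> \<in> chart_points \<tau>" and f: "f \<in> B \<sigma>"
  shows "f \<in> K \<tau> \<epsilon> \<longleftrightarrow> f \<in> K \<sigma> (restrict \<epsilon> (dual_monoid \<sigma>))"
proof
  let ?\<gamma> = "restrict \<epsilon> (dual_monoid \<sigma>)"
  have f\<tau>: "f \<in> B \<tau>" using f B_antimono[OF assms(3)] by blast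
  {
    assume "f \<in> K \<sigma> ?\<gamma>"
    then obtain u where u: "u \<in> B \<sigma>" "chart_eval ?\<gamma> u \<noteq> 0" "u * f \<in> J \<sigma>"
      unfolding mem_K[OF assms(1)] by blast
    then have "u \<in> B \<tau>" "chart_eval \<epsilon> u \<noteq> 0" "u * f \<in> J \<tau>"
      using B_antimono[OF assms(3)] J_antimono[OF assms(3)] chart_eval_restrict[OF refl u(1), of \<epsilon>] by auto
    then show "f \<in> K \<tau> \<epsilon>" unfolding mem_K[OF assms(2)] using f\<tau> by blast
  next
    assume "f \<in> K \<tau> \<epsilon>"
    then obtain u where u: "u \<in> B \<tau>" "chart_eval \<epsilon> u \<noteq> 0" "u * f \<in> J \<tau>"
      unfolding mem_K[OF assms(2)] by blast
    obtain m where m: "m \<in> dual_monoid \<sigma>" "m \<in> dual_monoid \<tau>" "- m \<in> dual_monoid \<tau>"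
      "\<forall>f\<in>B \<tau>. \<exists>L. \<forall>l\<ge>L. charmon m ^ l * f \<in> B \<sigma>"
      "\<forall>f\<in>J \<tau>. \<exists>L. \<forall>l\<ge>L. charmon m ^ l * f \<in> J \<sigma>"
      using face_monomial[OF assms(1-3)] by blast
    obtain L where L: "\<forall>l\<ge>L. charmon m ^ l * u \<in> B \<sigma>" using m(4) u(1) by blast
    obtain L' where L': "\<forall>l\<ge>L'. charmon m ^ l * (u * f) \<in> J \<sigma>" using m(5) u(3) by blast
    \<comment> \<open>One exponent serves both memberships, which hold for all large
      exponents.\<close>
    let ?v = "charmon m ^ (L + L') * u"
    have v: "?v \<in> B \<sigma>" "?v * f \<in> J \<sigma>" using L L' by (simp_all add: mult.assoc)
    have "chart_eval ?\<gamma> ?v = chart_eval \<epsilon> ?v" by (rule chart_eval_restrict[OF refl v(1)])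
    also have "\<dots> = chart_eval \<epsilon> (charmon m ^ (L + L')) * chart_eval \<epsilon> u"
      by (rule chart.alg_characterD(5)[OF chart_points_eval[OF assms(4)]
            chart.power_B[OF mono_B[OF m(2)]] u(1)])
    finally have "chart_eval ?\<gamma> ?v \<noteq> 0"
      using u(2) chart_eval_mono_nonzero(2)[OF assms(4) m(2,3)] by simp
    then show "f \<in> K \<sigma> ?\<gamma>" unfolding mem_K[OF assms(1)] using v f by blast
  }
qed

text \<open>Modulo the germs that vanish at \<open>\<epsilon>\<close>, the monomial that is inverted on \<open>U\<^sub>\<tau>\<close> already has
  an inverse in \<open>\<complex>[U\<^sub>\<sigma>]\<close>.\<close>

lemma B_mod_K:
  assumes "\<sigma> \<in> \<Sigma>" "\<tau> \<in> \<Sigma>" "\<tau> \<subseteq> \<sigma>" "\<epsilon> \<in> scheme_points \<tau>" and f: "f \<in> B \<tau>"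
  shows "\<exists>g\<in>B \<sigma>. f - g \<in> K \<tau> \<epsilon>"
proof -
  have \<epsilon>: "\<epsilon> \<in> chart_points \<tau>" using assms(4) by (simp add: scheme_points_def)
  let ?\<gamma> = "restrict \<epsilon> (dual_monoid \<sigma>)"
  have \<gamma>: "?\<gamma> \<in> scheme_points \<sigma>" using restrict_scheme_point_iff[OF assms(1-3) \<epsilon>] assms(4) by simp
  obtain m where m: "m \<in> dual_monoid \<sigma>" "m \<in> dual_monoid \<tau>" "- m \<in> dual_monoid \<tau>"
    "\<forall>f\<in>B \<tau>. \<exists>L. \<forall>l\<ge>L. charmon m ^ l * f \<in> B \<sigma>"
    "\<forall>f\<in>J \<tau>. \<exists>L. \<forall>l\<ge>L. charmon m ^ l * f \<in> J \<sigma>"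
    using face_monomial[OF assms(1-3)] by blast
  obtain l where l: "charmon m ^ l * f \<in> B \<sigma>" using m(4) f by blast
  let ?w = "charmon m ^ l"
  have w: "?w \<in> B \<sigma>" by (rule chart.power_B[OF mono_B[OF m(1)]])
  have "chart_eval ?\<gamma> ?w \<noteq> 0"
    using chart_eval_restrict[OF refl w, of \<epsilon>] chart_eval_mono_nonzero(2)[OF \<epsilon> m(2,3)] by simp
  then obtain s where s: "s \<in> B \<sigma>" "1 - ?w * s \<in> K \<sigma> ?\<gamma>" using K_unit[OF assms(1) \<gamma> w] by blast
  have "1 - ?w * s \<in> B \<sigma>" by (intro chart.diff_B chart.one_B chart.mult_B w s(1))
  then have "1 - ?w * s \<in> K \<tau> \<epsilon>" using K_restrict[OF assms(1-3) \<epsilon>] s(2) by blast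
  then have "f * (1 - ?w * s) \<in> K \<tau> \<epsilon>"
    by (rule chart.alg_idealD(4)[OF K_ideal[OF assms(2,4)] _ f])
  moreover have "f * (1 - ?w * s) = f - s * (?w * f)" by (simp add: algebra_simps)
  ultimately show ?thesis using chart.mult_B[OF s(1) l] by metis
qed

text \<open>By \<open>B_mod_K\<close> and \<open>K_restrict\<close> the inclusion of
  \<open>B \<sigma>\<close> into \<open>B \<tau>\<close> is bijective on germs at \<epsilon>.
  Coordinates move to the smaller chart through representatives \<open>r f\<close> in
  \<open>B \<sigma>\<close>.\<close>

lemma coordinates_restrict:
  assumes "\<sigma> \<in> \<Sigma>" "\<tau> \<in> \<Sigma>" "\<tau> \<subseteq> \<sigma>" "\<epsilon> \<in> scheme_points \<tau>"
    and \<theta>: "chart.coordinates_mod \<sigma> (K \<sigma> (restrict \<epsilon> (dual_monoid \<sigma>))) d \<theta>"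
  shows "\<exists>\<theta>'. chart.coordinates_mod \<tau> (K \<tau> \<epsilon>) d \<theta>'"
proof -
  have \<epsilon>: "\<epsilon> \<in> chart_points \<tau>" using assms(4) by (simp add: scheme_points_def)
  let ?\<gamma> = "restrict \<epsilon> (dual_monoid \<sigma>)"
  note I = K_ideal[OF assms(2,4)]
  obtain r where r: "\<And>f. f \<in> B \<tau> \<Longrightarrow> r f \<in> B \<sigma>" "\<And>f. f \<in> B \<tau> \<Longrightarrow> f - r f \<in> K \<tau> \<epsilon>"
    using B_mod_K[OF assms(1-4)] by metis
  have B: "f \<in> B \<sigma> \<Longrightarrow> f \<in> B \<tau>" for f using B_antimono[OF assms(3)] by blast
  note \<theta>1 = chart.coordinates_modD(1)[OF \<theta>] and \<theta>2 = chart.coordinates_modD(2)[OF \<theta>]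
  have \<theta>3: "(\<forall>i<d. \<theta> f i = \<theta> g i) \<longleftrightarrow> f - g \<in> K \<tau> \<epsilon>" if "f \<in> B \<sigma>" "g \<in> B \<sigma>" for f g
    using chart.coordinates_modD(3)[OF \<theta> that] K_restrict[OF assms(1-3) \<epsilon> chart.diff_B[OF that]]
    by simp
  note \<theta>4 = chart.coordinates_modD(4)[OF \<theta>]
  \<comment> \<open>Any congruent element of \<open>B \<sigma>\<close> may replace
    \<open>r f\<close>, so linearity holds although \<open>r\<close> itself need not be
    linear.\<close>
  have eq: "\<theta> (r f) i = \<theta> g i" if "f \<in> B \<tau>" "g \<in> B \<sigma>" "f - g \<in> K \<tau> \<epsilon>" "i < d" for f g i
  proof -
    have "r f - g = (f - g) - (f - r f)" by simp
    then have "r f - g \<in> K \<tau> \<epsilon>" using chart.alg_ideal_diff[OF I that(3) r(2)[OF that(1)]] by simp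
    then show ?thesis using \<theta>3[OF r(1)[OF that(1)] that(2)] that(4) by blast
  qed
  have "chart.coordinates_mod \<tau> (K \<tau> \<epsilon>) d (\<lambda>f. \<theta> (r f))"
    unfolding chart.coordinates_mod_def
  proof (intro conjI allI ballI impI)
    fix f g i assume fg: "f \<in> B \<tau>" "g \<in> B \<tau>" "i < d"
    have e: "(f + g) - (r f + r g) = (f - r f) + (g - r g)" by simp
    have "(f + g) - (r f + r g) \<in> K \<tau> \<epsilon>"
      unfolding e by (rule chart.alg_idealD(3)[OF I r(2)[OF fg(1)] r(2)[OF fg(2)]])
    then have "\<theta> (r (f + g)) i = \<theta> (r f + r g) i"
      by (rule eq[OF chart.add_B[OF fg(1,2)] chart.add_B[OF r(1)[OF fg(1)] r(1)[OF fg(2)]] _ fg(3)])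
    then show "\<theta> (r (f + g)) i = \<theta> (r f) i + \<theta> (r g) i"
      using \<theta>1[OF r(1)[OF fg(1)] r(1)[OF fg(2)] fg(3)] by simp
  next
    fix c f i assume f: "f \<in> B \<tau>" "i < d"
    have "chart.C c * f - chart.C c * r f = chart.C c * (f - r f)" by (simp add: algebra_simps)
    then have "chart.C c * f - chart.C c * r f \<in> K \<tau> \<epsilon>"
      using chart.alg_idealD(4)[OF I r(2)[OF f(1)] chart.C_B] by simp
    then have "\<theta> (r (chart.C c * f)) i = \<theta> (chart.C c * r f) i"
      by (rule eq[OF chart.mult_B[OF chart.C_B f(1)] chart.mult_B[OF chart.C_B r(1)[OF f(1)]] _ f(2)])
    then show "\<theta> (r (chart.C c * f)) i = c * \<theta> (r f) i"
      using \<theta>2[OF r(1)[OF f(1)] f(2)] by simp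
  next
    fix f g assume fg: "f \<in> B \<tau>" "g \<in> B \<tau>"
    have k: "(f - r f) - (g - r g) \<in> K \<tau> \<epsilon>"
      by (rule chart.alg_ideal_diff[OF I r(2)[OF fg(1)] r(2)[OF fg(2)]])
    have "r f - r g \<in> K \<tau> \<epsilon> \<longleftrightarrow> f - g \<in> K \<tau> \<epsilon>"
    proof
      assume "r f - r g \<in> K \<tau> \<epsilon>"
      from chart.alg_idealD(3)[OF I this k] show "f - g \<in> K \<tau> \<epsilon>" by simp
    next
      assume "f - g \<in> K \<tau> \<epsilon>"
      from chart.alg_ideal_diff[OF I this k] show "r f - r g \<in> K \<tau> \<epsilon>" by simp
    qed
    then show "(\<forall>i<d. \<theta> (r f) i = \<theta> (r g) i) \<longleftrightarrow> f - g \<in> K \<tau> \<epsilon>"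
      using \<theta>3[OF r(1)[OF fg(1)] r(1)[OF fg(2)]] by simp
  next
    fix c :: "nat \<Rightarrow> complex"
    obtain g where g: "g \<in> B \<sigma>" "\<forall>i<d. \<theta> g i = c i" using \<theta>4 by blast
    have "g - g \<in> K \<tau> \<epsilon>" using chart.alg_idealD(2)[OF I] by simp
    then have "\<forall>i<d. \<theta> (r g) i = c i" using eq[OF B[OF g(1)] g(1)] g(2) by simp
    then show "\<exists>f\<in>B \<tau>. \<forall>i<d. \<theta> (r f) i = c i" using B[OF g(1)] by blast
  qed
  then show ?thesis by blast
qed

lemma class_member_glue:
  assumes "\<zeta> \<in> toric_variety \<Sigma>" "p \<in> \<zeta>"
  shows "\<zeta> = glue \<Sigma> `` {p}"
proof -
  obtain p0 where p0: "\<zeta> = glue \<Sigma> `` {p0}" using assms(1) by (auto simp: toric_variety_def quotient_def)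
  have 1: "(p0, p) \<in> glue \<Sigma>" using assms(2) p0 by simp
  have 2: "(p, p0) \<in> glue \<Sigma>" using glue_sym[OF 1] by simp
  have tr: "(a, c) \<in> glue \<Sigma>" if "(a, b) \<in> glue \<Sigma>" "(b, c) \<in> glue \<Sigma>" for a b c
    using glue_trans that by (cases a; cases b; cases c) blast
  show ?thesis unfolding p0 using tr[OF 1] tr[OF 2] by blast
qed

lemma class_nonempty: "\<zeta> \<in> toric_variety \<Sigma> \<Longrightarrow> \<exists>p. p \<in> \<zeta>"
  using glue_refl unfolding toric_variety_def quotient_def by fastforce

lemma glued_scheme_points:
  assumes "((\<sigma>, \<gamma>), (\<tau>, \<delta>)) \<in> glue \<Sigma>" "\<gamma> \<in> scheme_points \<sigma>"
  shows "\<delta> \<in> scheme_points \<tau>"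
proof -
  obtain \<epsilon> where \<epsilon>: "\<sigma> \<in> \<Sigma>" "\<tau> \<in> \<Sigma>" "\<epsilon> \<in> chart_points (\<sigma> \<inter> \<tau>)"
    "\<gamma> = restrict \<epsilon> (dual_monoid \<sigma>)" "\<delta> = restrict \<epsilon> (dual_monoid \<tau>)"
    using assms(1) by (rule glueE)
  have c: "\<sigma> \<inter> \<tau> \<in> \<Sigma>" by (rule fan_Int[OF \<epsilon>(1,2)])
  have "\<epsilon> \<in> scheme_points (\<sigma> \<inter> \<tau>)"
    using restrict_scheme_point_iff[OF \<epsilon>(1) c Int_lower1 \<epsilon>(3)] assms(2) \<epsilon>(4) by simp
  then show ?thesis
    using restrict_scheme_point_iff[OF \<epsilon>(2) c Int_lower2 \<epsilon>(3)] \<epsilon>(5) by simp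
qed

section \<open>Points of Y and their smallest charts\<close>

abbreviation Pts :: "'n chart_point set set" where "Pts \<equiv> subscheme_points \<Sigma> \<rho> I"

text \<open>\<open>subscheme_points\<close> asks for one representative on which the ideal vanishes;
  glueing carries this to every representative.\<close>

lemma Pts_member:
  assumes "\<zeta> \<in> Pts" "(\<sigma>, \<gamma>) \<in> \<zeta>"
  shows "\<sigma> \<in> \<Sigma>" "\<gamma> \<in> scheme_points \<sigma>"
proof -
  obtain \<sigma>0 \<gamma>0 where p0: "\<zeta> \<in> toric_variety \<Sigma>" "(\<sigma>0, \<gamma>0) \<in> \<zeta>" "\<forall>g\<in>J \<sigma>0. chart_eval \<gamma>0 g = 0"
    using assms(1) by (auto simp: subscheme_points_def)
  have g: "((\<sigma>0, \<gamma>0), (\<sigma>, \<gamma>)) \<in> glue \<Sigma>"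
    using class_member_glue[OF p0(1,2)] assms(2) by blast
  then show "\<sigma> \<in> \<Sigma>" by (auto simp: glue_def)
  have "\<gamma>0 \<in> scheme_points \<sigma>0" using glue_points[OF g] p0(3) by (simp add: scheme_points_def)
  then show "\<gamma> \<in> scheme_points \<sigma>" by (rule glued_scheme_points[OF g])
qed

text \<open>Among the charts that contain a point there is a smallest one. Germs are compared there, which
  makes cocycle conditions unnecessary.\<close>

lemma minimal_chart:
  assumes "\<zeta> \<in> Pts"
  shows "\<exists>p. p \<in> \<zeta> \<and> (\<forall>(\<sigma>, \<gamma>)\<in>\<zeta>. fst p \<subseteq> \<sigma> \<and> \<gamma> = restrict (snd p) (dual_monoid \<sigma>))"
proof -
  have \<zeta>: "\<zeta> \<in> toric_variety \<Sigma>" using assms by (simp add: subscheme_points_def)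
  have "fst ` \<zeta> \<subseteq> \<Sigma>" using Pts_member(1)[OF assms] by fastforce
  then have "finite (fst ` \<zeta>)" using finite_fan by (rule finite_subset)
  moreover have "fst ` \<zeta> \<noteq> {}" using class_nonempty[OF \<zeta>] by blast
  ultimately obtain \<tau> where \<tau>: "\<tau> \<in> fst ` \<zeta>" "\<forall>\<sigma>\<in>fst ` \<zeta>. \<sigma> \<subseteq> \<tau> \<longrightarrow> \<tau> = \<sigma>"
    using finite_has_minimal[of "fst ` \<zeta>"] by blast
  obtain \<epsilon> where \<epsilon>: "(\<tau>, \<epsilon>) \<in> \<zeta>" using \<tau>(1) by force
  have "\<tau> \<subseteq> \<sigma> \<and> \<gamma> = restrict \<epsilon> (dual_monoid \<sigma>)" if m: "(\<sigma>, \<gamma>) \<in> \<zeta>" for \<sigma> \<gamma>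
  proof -
    have "((\<sigma>, \<gamma>), (\<tau>, \<epsilon>)) \<in> glue \<Sigma>" using class_member_glue[OF \<zeta> m] \<epsilon> by blast
    then obtain \<epsilon>' where e: "\<sigma> \<in> \<Sigma>" "\<tau> \<in> \<Sigma>" "\<epsilon>' \<in> chart_points (\<sigma> \<inter> \<tau>)"
      "\<gamma> = restrict \<epsilon>' (dual_monoid \<sigma>)" "\<epsilon> = restrict \<epsilon>' (dual_monoid \<tau>)"
      by (rule glueE)
    have c: "\<sigma> \<inter> \<tau> \<in> \<Sigma>" by (rule fan_Int[OF e(1,2)])
    have "restrict \<epsilon>' (dual_monoid (\<sigma> \<inter> \<tau>)) = \<epsilon>'"
      using e(3) by (auto simp: chart_points_def extensional_restrict)
    \<comment> \<open>The overlap with any other chart of the point contains the point as well, so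
      minimality of \<tau> forces the overlap to be \<tau>.\<close>
    then have "((\<sigma>, \<gamma>), (\<sigma> \<inter> \<tau>, \<epsilon>')) \<in> glue \<Sigma>"
      using e by (intro glueI[of _ _ \<epsilon>'] c) (simp_all add: Int_assoc[symmetric])
    then have "(\<sigma> \<inter> \<tau>, \<epsilon>') \<in> \<zeta>" using class_member_glue[OF \<zeta> m] by blast
    then have "\<sigma> \<inter> \<tau> \<in> fst ` \<zeta>" by force
    then have eq: "\<sigma> \<inter> \<tau> = \<tau>" using \<tau>(2) by blast
    then have "\<epsilon>' = \<epsilon>" using e(3,5) by (auto simp: chart_points_def extensional_restrict)
    then show ?thesis using eq e(4) by blast
  qed
  then show ?thesis using \<epsilon> by (intro exI[of _ "(\<tau>, \<epsilon>)"]) auto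
qed

definition base :: "'n chart_point set \<Rightarrow> 'n chart_point" where
  "base \<zeta> = (SOME p. p \<in> \<zeta> \<and> (\<forall>(\<sigma>, \<gamma>)\<in>\<zeta>. fst p \<subseteq> \<sigma> \<and> \<gamma> = restrict (snd p) (dual_monoid \<sigma>)))"

abbreviation bcone :: "'n chart_point set \<Rightarrow> (real ^ 'n) set" where "bcone \<zeta> \<equiv> fst (base \<zeta>)"

abbreviation bpoint :: "'n chart_point set \<Rightarrow> int ^ 'n \<Rightarrow> complex" where "bpoint \<zeta> \<equiv> snd (base \<zeta>)"

lemma base:
  assumes "\<zeta> \<in> Pts"
  shows "(bcone \<zeta>, bpoint \<zeta>) \<in> \<zeta>" "bcone \<zeta> \<in> \<Sigma>" "bpoint \<zeta> \<in> scheme_points (bcone \<zeta>)"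
    "bpoint \<zeta> \<in> chart_points (bcone \<zeta>)"
    "(\<sigma>, \<gamma>) \<in> \<zeta> \<Longrightarrow> bcone \<zeta> \<subseteq> \<sigma> \<and> \<gamma> = restrict (bpoint \<zeta>) (dual_monoid \<sigma>)"
proof -
  have *: "base \<zeta> \<in> \<zeta> \<and>
      (\<forall>(\<sigma>, \<gamma>)\<in>\<zeta>. bcone \<zeta> \<subseteq> \<sigma> \<and> \<gamma> = restrict (bpoint \<zeta>) (dual_monoid \<sigma>))"
    unfolding base_def by (rule someI_ex[OF minimal_chart[OF assms]])
  then show m: "(bcone \<zeta>, bpoint \<zeta>) \<in> \<zeta>" by simp
  show "bcone \<zeta> \<in> \<Sigma>" by (rule Pts_member(1)[OF assms m])
  show "bpoint \<zeta> \<in> scheme_points (bcone \<zeta>)" by (rule Pts_member(2)[OF assms m])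
  then show "bpoint \<zeta> \<in> chart_points (bcone \<zeta>)" by (simp add: scheme_points_def)
  show "(\<sigma>, \<gamma>) \<in> \<zeta> \<Longrightarrow> bcone \<zeta> \<subseteq> \<sigma> \<and> \<gamma> = restrict (bpoint \<zeta>) (dual_monoid \<sigma>)"
    using * by blast
qed

lemma Pts_eq_glue: "\<zeta> \<in> Pts \<Longrightarrow> \<zeta> = glue \<Sigma> `` {base \<zeta>}"
  using class_member_glue[of \<zeta> "base \<zeta>"] base(1)[of \<zeta>] by (simp add: subscheme_points_def)

lemma class_in_Pts:
  assumes "\<sigma> \<in> \<Sigma>" "\<gamma> \<in> scheme_points \<sigma>"
  shows "glue \<Sigma> `` {(\<sigma>, \<gamma>)} \<in> Pts" "(\<sigma>, \<gamma>) \<in> glue \<Sigma> `` {(\<sigma>, \<gamma>)}"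
proof -
  have \<gamma>: "\<gamma> \<in> chart_points \<sigma>" using assms(2) by (simp add: scheme_points_def)
  show m: "(\<sigma>, \<gamma>) \<in> glue \<Sigma> `` {(\<sigma>, \<gamma>)}" using glue_refl[OF assms(1) \<gamma>] by simp
  have "glue \<Sigma> `` {(\<sigma>, \<gamma>)} \<in> toric_variety \<Sigma>"
    using assms(1) \<gamma> unfolding toric_variety_def by (intro quotientI) simp
  then show "glue \<Sigma> `` {(\<sigma>, \<gamma>)} \<in> Pts"
    using m assms(2) unfolding subscheme_points_def scheme_points_def by blast
qed

lemma chart_member:
  assumes "\<zeta> \<in> Pts" "\<sigma> \<in> \<Sigma>" "bcone \<zeta> \<subseteq> \<sigma>"
  shows "(\<sigma>, restrict (bpoint \<zeta>) (dual_monoid \<sigma>)) \<in> \<zeta>"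
proof -
  have "\<sigma> \<inter> bcone \<zeta> = bcone \<zeta>" using assms(3) by blast
  moreover have "bpoint \<zeta> = restrict (bpoint \<zeta>) (dual_monoid (bcone \<zeta>))"
    using base(4)[OF assms(1)] by (auto simp: chart_points_def extensional_restrict)
  ultimately have "((bcone \<zeta>, bpoint \<zeta>), (\<sigma>, restrict (bpoint \<zeta>) (dual_monoid \<sigma>))) \<in> glue \<Sigma>"
    using base(2,4)[OF assms(1)] assms(2)
    by (intro glueI[of _ _ "bpoint \<zeta>"]) (simp_all add: Int_commute)
  then have "(\<sigma>, restrict (bpoint \<zeta>) (dual_monoid \<sigma>)) \<in> glue \<Sigma> `` {base \<zeta>}" by simp
  then show ?thesis using Pts_eq_glue[OF assms(1)] by blast
qed

lemma finite_Pts: "finite Pts"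
proof -
  have "Pts \<subseteq> (\<lambda>p. glue \<Sigma> `` {p}) ` (Sigma \<Sigma> scheme_points)"
  proof
    fix \<zeta> assume \<zeta>: "\<zeta> \<in> Pts"
    have "(bcone \<zeta>, bpoint \<zeta>) \<in> Sigma \<Sigma> scheme_points" using base(2,3)[OF \<zeta>] by (rule SigmaI)
    then show "\<zeta> \<in> (\<lambda>p. glue \<Sigma> `` {p}) ` (Sigma \<Sigma> scheme_points)"
      by (intro image_eqI[where x = "base \<zeta>"] Pts_eq_glue[OF \<zeta>]) simp
  qed
  moreover have "finite (Sigma \<Sigma> scheme_points)"
    using finite_fan finite_scheme_points by (rule finite_SigmaI)
  ultimately show ?thesis by (meson finite_imageI finite_subset)
qed

text \<open>The multiplicity refers to an arbitrarily picked representative. Its chart contains the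
  smallest one, so its coordinates can be moved there.\<close>

lemma base_coordinates:
  assumes "\<zeta> \<in> Pts"
  shows "\<exists>\<theta>. chart.coordinates_mod (bcone \<zeta>) (K (bcone \<zeta>) (bpoint \<zeta>)) (multiplicity_at \<rho> I \<zeta>) \<theta>"
proof -
  define p where "p = (SOME p. p \<in> \<zeta>)"
  have "p \<in> \<zeta>" unfolding p_def using base(1)[OF assms] by (rule someI)
  then obtain \<sigma> \<gamma> where p: "p = (\<sigma>, \<gamma>)" "(\<sigma>, \<gamma>) \<in> \<zeta>" by (cases p) auto
  have \<sigma>: "\<sigma> \<in> \<Sigma>" "\<gamma> \<in> scheme_points \<sigma>" using Pts_member[OF assms p(2)] by auto
  have b: "bcone \<zeta> \<subseteq> \<sigma>" "\<gamma> = restrict (bpoint \<zeta>) (dual_monoid \<sigma>)" using base(5)[OF assms p(2)] by auto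
  have "multiplicity_at \<rho> I \<zeta> = vectorspace.dim complex_field (local_ring \<rho> I (\<sigma>, \<gamma>))"
    using p(1) by (simp add: multiplicity_at_def p_def)
  then obtain \<theta> where "chart.coordinates_mod \<sigma> (K \<sigma> \<gamma>) (multiplicity_at \<rho> I \<zeta>) \<theta>" using coordinates_exist[OF \<sigma>] by auto
  then show ?thesis
    using coordinates_restrict[OF \<sigma>(1) base(2)[OF assms] b(1) base(3)[OF assms]] b(2) by blast
qed

definition \<Theta> :: "'n chart_point set \<Rightarrow> (int ^ 'n \<Rightarrow>\<^sub>0 complex) \<Rightarrow> nat \<Rightarrow> complex" where
  "\<Theta> \<zeta> = (SOME \<theta>. chart.coordinates_mod (bcone \<zeta>) (K (bcone \<zeta>) (bpoint \<zeta>)) (multiplicity_at \<rho> I \<zeta>) \<theta>)"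

lemma \<Theta>_coordinates:
  assumes "\<zeta> \<in> Pts"
  shows "chart.coordinates_mod (bcone \<zeta>) (K (bcone \<zeta>) (bpoint \<zeta>)) (multiplicity_at \<rho> I \<zeta>) (\<Theta> \<zeta>)"
  unfolding \<Theta>_def using base_coordinates[OF assms] by (rule someI_ex)

lemmas \<Theta> = chart.coordinates_modD[OF \<Theta>_coordinates]

section \<open>Sections, their germs, and the count of coordinates\<close>

abbreviation G :: "(complex, (real ^ 'n) set \<Rightarrow> (int ^ 'n \<Rightarrow>\<^sub>0 complex) set) module" where
  "G \<equiv> global_sections \<Sigma> \<rho> I"

text \<open>Representatives of a global section; agreement on overlaps becomes membership in the
  ideal of the overlap.\<close>

definition family :: "((real ^ 'n) set \<Rightarrow> int ^ 'n \<Rightarrow>\<^sub>0 complex) \<Rightarrow> bool" where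
  "family f \<longleftrightarrow> (\<forall>\<sigma>\<in>\<Sigma>. f \<sigma> \<in> B \<sigma>) \<and> (\<forall>\<sigma>\<in>\<Sigma>. \<forall>\<tau>\<in>\<Sigma>. f \<sigma> - f \<tau> \<in> J (\<sigma> \<inter> \<tau>))"

definition section_of :: "((real ^ 'n) set \<Rightarrow> int ^ 'n \<Rightarrow>\<^sub>0 complex) \<Rightarrow>
    (real ^ 'n) set \<Rightarrow> (int ^ 'n \<Rightarrow>\<^sub>0 complex) set" where
  "section_of f = (\<lambda>\<sigma>\<in>\<Sigma>. chart.cls \<sigma> (f \<sigma>))"

lemma chart_restrict_cls:
  assumes "\<tau> \<subseteq> \<sigma>"
  shows "chart_restrict \<rho> I \<tau> (chart.cls \<sigma> f) = chart.cls \<tau> f"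
proof -
  have "chart.cls \<tau> g = chart.cls \<tau> f" if "g \<in> chart.cls \<sigma> f" for g
    using that J_antimono[OF assms] by (auto simp: chart.mem_cls chart.cls_eq_iff)
  then have "(\<Union>g\<in>chart.cls \<sigma> f. chart.cls \<tau> g) = (\<Union>g\<in>chart.cls \<sigma> f. chart.cls \<tau> f)"
    by (intro SUP_cong refl)
  moreover have "chart.cls \<sigma> f \<noteq> {}" using chart.self_in_cls[of f \<sigma>] by auto
  ultimately show ?thesis by (simp add: chart_restrict_def chart.coset_eq_cls)
qed

lemma carrier_chart_alg: "carrier (chart_alg \<rho> I \<sigma>) = chart.cls \<sigma> ` B \<sigma>"
  unfolding chart_alg_def by (rule chart.Q_carrier)

lemma carrier_G: "carrier G = section_of ` Collect family"
proof
  show "carrier G \<subseteq> section_of ` Collect family"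
  proof
    fix s assume s: "s \<in> carrier G"
    then have sE: "s \<in> (\<Pi>\<^sub>E \<sigma>\<in>\<Sigma>. chart.cls \<sigma> ` B \<sigma>)"
      and compat: "\<forall>\<sigma>\<in>\<Sigma>. \<forall>\<tau>\<in>\<Sigma>. chart_restrict \<rho> I (\<sigma> \<inter> \<tau>) (s \<sigma>) = chart_restrict \<rho> I (\<sigma> \<inter> \<tau>) (s \<tau>)"
      unfolding global_sections_def carrier_chart_alg partial_object.simps by blast+
    have "\<exists>f\<in>B \<sigma>. s \<sigma> = chart.cls \<sigma> f" if "\<sigma> \<in> \<Sigma>" for \<sigma>
      using PiE_mem[OF sE that] by blast
    then obtain f where f: "\<And>\<sigma>. \<sigma> \<in> \<Sigma> \<Longrightarrow> f \<sigma> \<in> B \<sigma>" "\<And>\<sigma>. \<sigma> \<in> \<Sigma> \<Longrightarrow> s \<sigma> = chart.cls \<sigma> (f \<sigma>)"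
      by metis
    have "f \<sigma> - f \<tau> \<in> J (\<sigma> \<inter> \<tau>)" if "\<sigma> \<in> \<Sigma>" "\<tau> \<in> \<Sigma>" for \<sigma> \<tau>
    proof -
      have "chart_restrict \<rho> I (\<sigma> \<inter> \<tau>) (s \<sigma>) = chart_restrict \<rho> I (\<sigma> \<inter> \<tau>) (s \<tau>)"
        using compat that by blast
      then have "chart.cls (\<sigma> \<inter> \<tau>) (f \<sigma>) = chart.cls (\<sigma> \<inter> \<tau>) (f \<tau>)"
        by (simp add: f(2) that chart_restrict_cls)
      then show ?thesis by (simp add: chart.cls_eq_iff)
    qed
    then have "family f" using f(1) by (simp add: family_def)
    moreover have "s = section_of f"
    proof -
      have "s = restrict s \<Sigma>" using PiE_restrict[OF sE] ..
      also have "\<dots> = section_of f" unfolding section_of_def by (rule restrict_ext) (rule f(2))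
      finally show ?thesis .
    qed
    ultimately show "s \<in> section_of ` Collect family" by blast
  qed
  show "section_of ` Collect family \<subseteq> carrier G"
  proof
    fix s assume "s \<in> section_of ` Collect family"
    then obtain f where f: "family f" "s = section_of f" by blast
    have "s \<in> (\<Pi>\<^sub>E \<sigma>\<in>\<Sigma>. carrier (chart_alg \<rho> I \<sigma>))"
      using f(1) by (auto simp: f(2) section_of_def family_def carrier_chart_alg)
    moreover have "chart_restrict \<rho> I (\<sigma> \<inter> \<tau>) (s \<sigma>) = chart_restrict \<rho> I (\<sigma> \<inter> \<tau>) (s \<tau>)"
      if "\<sigma> \<in> \<Sigma>" "\<tau> \<in> \<Sigma>" for \<sigma> \<tau>
    proof -
      have "f \<sigma> - f \<tau> \<in> J (\<sigma> \<inter> \<tau>)" using f(1) that by (simp add: family_def)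
      then show ?thesis by (simp add: f(2) section_of_def that chart_restrict_cls chart.cls_eq_iff)
    qed
    ultimately show "s \<in> carrier G" unfolding global_sections_def partial_object.simps by blast
  qed
qed

lemma family_add: "family f \<Longrightarrow> family g \<Longrightarrow> family (\<lambda>\<sigma>. f \<sigma> + g \<sigma>)"
proof -
  assume fg: "family f" "family g"
  have "(f \<sigma> + g \<sigma>) - (f \<tau> + g \<tau>) \<in> J (\<sigma> \<inter> \<tau>)" if "\<sigma> \<in> \<Sigma>" "\<tau> \<in> \<Sigma>" for \<sigma> \<tau>
  proof -
    have e: "(f \<sigma> + g \<sigma>) - (f \<tau> + g \<tau>) = (f \<sigma> - f \<tau>) + (g \<sigma> - g \<tau>)" by simp
    show ?thesis
      unfolding e using fg that by (intro chart.alg_idealD(3)[OF alg_ideal_J]) (auto simp: family_def)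
  qed
  then show ?thesis using fg by (auto simp: family_def intro: chart.add_B)
qed

lemma family_scale: "family f \<Longrightarrow> family (\<lambda>\<sigma>. chart.C c * f \<sigma>)"
proof -
  assume f: "family f"
  have "chart.C c * f \<sigma> - chart.C c * f \<tau> \<in> J (\<sigma> \<inter> \<tau>)" if "\<sigma> \<in> \<Sigma>" "\<tau> \<in> \<Sigma>" for \<sigma> \<tau>
  proof -
    have e: "chart.C c * f \<sigma> - chart.C c * f \<tau> = chart.C c * (f \<sigma> - f \<tau>)"
      by (simp add: right_diff_distrib)
    show ?thesis
      unfolding e using f that by (intro chart.alg_idealD(4)[OF alg_ideal_J] chart.C_B) (auto simp: family_def)
  qed
  then show ?thesis using f by (auto simp: family_def intro: chart.mult_B chart.C_B)
qed

lemma family_zero: "family (\<lambda>_. 0)"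
  using chart.zero_B chart.alg_idealD(2)[OF alg_ideal_J] by (simp add: family_def)

lemma G_add: "section_of f \<oplus>\<^bsub>G\<^esub> section_of g = section_of (\<lambda>\<sigma>. f \<sigma> + g \<sigma>)"
proof -
  have "section_of f \<oplus>\<^bsub>G\<^esub> section_of g =
      (\<lambda>\<sigma>\<in>\<Sigma>. section_of f \<sigma> \<oplus>\<^bsub>chart_alg \<rho> I \<sigma>\<^esub> section_of g \<sigma>)"
    by (simp add: global_sections_def)
  also have "\<dots> = section_of (\<lambda>\<sigma>. f \<sigma> + g \<sigma>)"
    unfolding section_of_def by (rule restrict_ext) (simp add: chart_alg_def chart.Q_add)
  finally show ?thesis .
qed

lemma G_smult: "family f \<Longrightarrow> c \<odot>\<^bsub>G\<^esub> section_of f = section_of (\<lambda>\<sigma>. chart.C c * f \<sigma>)"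
proof -
  assume f: "family f"
  have "c \<odot>\<^bsub>G\<^esub> section_of f = (\<lambda>\<sigma>\<in>\<Sigma>. c \<odot>\<^bsub>chart_alg \<rho> I \<sigma>\<^esub> section_of f \<sigma>)"
    by (simp add: global_sections_def)
  also have "\<dots> = section_of (\<lambda>\<sigma>. chart.C c * f \<sigma>)"
    unfolding section_of_def
    by (rule restrict_ext) (use f in \<open>simp add: chart_alg_def chart.Q_smult family_def\<close>)
  finally show ?thesis .
qed

lemma G_zero: "\<zero>\<^bsub>G\<^esub> = section_of (\<lambda>_. 0)"
  by (simp add: global_sections_def section_of_def chart_alg_def chart.Q_zero)

definition germ_coord :: "((real ^ 'n) set \<Rightarrow> (int ^ 'n \<Rightarrow>\<^sub>0 complex) set) \<Rightarrow>
    'n chart_point set \<Rightarrow> nat \<Rightarrow> complex" where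
  "germ_coord s \<zeta> i = \<Theta> \<zeta> (SOME f. f \<in> s (bcone \<zeta>)) i"

text \<open>The representative picked in \<open>germ_coord\<close> is immaterial: two of them differ
  by an element of \<open>J\<close>, which has zero germ.\<close>

lemma germ_coord_section:
  assumes f: "family f" and \<zeta>: "\<zeta> \<in> Pts" and i: "i < multiplicity_at \<rho> I \<zeta>"
  shows "germ_coord (section_of f) \<zeta> i = \<Theta> \<zeta> (f (bcone \<zeta>)) i"
proof -
  let ?\<tau> = "bcone \<zeta>"
  define g where "g = (SOME g. g \<in> section_of f ?\<tau>)"
  have \<tau>: "?\<tau> \<in> \<Sigma>" by (rule base(2)[OF \<zeta>])
  have eq: "section_of f ?\<tau> = chart.cls ?\<tau> (f ?\<tau>)" using \<tau> by (simp add: section_of_def)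
  have "g \<in> section_of f ?\<tau>"
    unfolding g_def eq using chart.self_in_cls by (rule someI)
  then have gJ: "g - f ?\<tau> \<in> J ?\<tau>" and gB: "g \<in> B ?\<tau>"
    using f \<tau> chart.cls_subset_B[of "f ?\<tau>" ?\<tau>] by (auto simp: eq chart.mem_cls family_def)
  have "g - f ?\<tau> \<in> K ?\<tau> (bpoint \<zeta>)" using gJ J_subset_K[OF \<tau> base(3)[OF \<zeta>]] by blast
  then have "\<Theta> \<zeta> g i = \<Theta> \<zeta> (f ?\<tau>) i"
    using f \<tau> i \<Theta>(3)[OF \<zeta> gB, of "f ?\<tau>"] by (auto simp: family_def)
  then show ?thesis by (simp add: germ_coord_def g_def)
qed

text \<open>A germ at a point of any chart is compared in the smallest chart of that point, where
  compatibility of the families replaces \<open>f \<sigma>\<close> and \<open>g \<sigma>\<close> by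
  the members whose coordinates are known to agree.\<close>

lemma germ_coord_inj:
  assumes f: "family f" and g: "family g"
    and eq: "\<And>\<zeta> i. \<zeta> \<in> Pts \<Longrightarrow> i < multiplicity_at \<rho> I \<zeta> \<Longrightarrow>
      germ_coord (section_of f) \<zeta> i = germ_coord (section_of g) \<zeta> i"
  shows "section_of f = section_of g"
proof -
  have "f \<sigma> - g \<sigma> \<in> J \<sigma>" if \<sigma>: "\<sigma> \<in> \<Sigma>" for \<sigma>
  proof (rule in_J_if_germs[OF \<sigma>])
    have fB: "f \<sigma> \<in> B \<sigma>" "g \<sigma> \<in> B \<sigma>" using f g \<sigma> by (auto simp: family_def)
    then show diffB: "f \<sigma> - g \<sigma> \<in> B \<sigma>" by (rule chart.diff_B)
    fix \<gamma> assume \<gamma>: "\<gamma> \<in> scheme_points \<sigma>"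
    let ?\<zeta> = "glue \<Sigma> `` {(\<sigma>, \<gamma>)}"
    let ?\<tau> = "bcone ?\<zeta>"
    note \<zeta> = class_in_Pts[OF \<sigma> \<gamma>]
    note b = base[OF \<zeta>(1)]
    have sub: "?\<tau> \<subseteq> \<sigma>" "\<gamma> = restrict (bpoint ?\<zeta>) (dual_monoid \<sigma>)" using b(5)[OF \<zeta>(2)] by blast+
    have fg\<tau>: "f ?\<tau> \<in> B ?\<tau>" "g ?\<tau> \<in> B ?\<tau>" using f g b(2) by (auto simp: family_def)
    have "f ?\<tau> - g ?\<tau> \<in> K ?\<tau> (bpoint ?\<zeta>)"
      unfolding \<Theta>(3)[OF \<zeta>(1) fg\<tau>, symmetric]
      using eq[OF \<zeta>(1)] germ_coord_section[OF f \<zeta>(1)] germ_coord_section[OF g \<zeta>(1)] by metis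
    moreover have "f \<sigma> - f ?\<tau> \<in> J ?\<tau>" "g \<sigma> - g ?\<tau> \<in> J ?\<tau>"
    proof -
      have "\<sigma> \<inter> ?\<tau> = ?\<tau>" using sub(1) by blast
      then show "f \<sigma> - f ?\<tau> \<in> J ?\<tau>" "g \<sigma> - g ?\<tau> \<in> J ?\<tau>"
        using f g \<sigma> b(2) unfolding family_def by metis+
    qed
    then have "(f \<sigma> - f ?\<tau>) - (g \<sigma> - g ?\<tau>) \<in> K ?\<tau> (bpoint ?\<zeta>)"
      using subsetD[OF J_subset_K[OF b(2,3)]]
      by (rule_tac chart.alg_ideal_diff[OF K_ideal[OF b(2,3)]]) blast+
    ultimately have "((f \<sigma> - f ?\<tau>) - (g \<sigma> - g ?\<tau>)) + (f ?\<tau> - g ?\<tau>) \<in> K ?\<tau> (bpoint ?\<zeta>)"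
      by (rule_tac chart.alg_idealD(3)[OF K_ideal[OF b(2,3)]])
    then have "f \<sigma> - g \<sigma> \<in> K ?\<tau> (bpoint ?\<zeta>)" by simp
    then show "f \<sigma> - g \<sigma> \<in> K \<sigma> \<gamma>" using K_restrict[OF \<sigma> b(2) sub(1) b(4) diffB] sub(2) by simp
  qed
  then show ?thesis
    unfolding section_of_def by (intro restrict_ext) (simp add: chart.cls_eq_iff)
qed

text \<open>The prescribed germs are realized in each chart by the Chinese remainder theorem. On an
  overlap the difference of two solutions has zero germ at every point, hence lies in the ideal:
  separate choices glue automatically.\<close>

lemma germ_coord_surj:
  "\<exists>f. family f \<and> (\<forall>\<zeta>\<in>Pts. \<forall>i<multiplicity_at \<rho> I \<zeta>. germ_coord (section_of f) \<zeta> i = c \<zeta> i)"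
proof -
  have "\<exists>g\<in>B (bcone \<zeta>). \<forall>i<multiplicity_at \<rho> I \<zeta>. \<Theta> \<zeta> g i = c \<zeta> i" if "\<zeta> \<in> Pts" for \<zeta>
    by (rule \<Theta>(4)[OF that])
  then obtain g where g: "\<And>\<zeta>. \<zeta> \<in> Pts \<Longrightarrow> g \<zeta> \<in> B (bcone \<zeta>)"
    "\<And>\<zeta> i. \<zeta> \<in> Pts \<Longrightarrow> i < multiplicity_at \<rho> I \<zeta> \<Longrightarrow> \<Theta> \<zeta> (g \<zeta>) i = c \<zeta> i"
    by metis
  have ex: "\<exists>f\<in>B \<sigma>. \<forall>\<zeta>\<in>Pts. bcone \<zeta> \<subseteq> \<sigma> \<longrightarrow> f - g \<zeta> \<in> K (bcone \<zeta>) (bpoint \<zeta>)" if \<sigma>: "\<sigma> \<in> \<Sigma>" for \<sigma>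
  proof -
    define cl where "cl \<gamma> = glue \<Sigma> `` {(\<sigma>, \<gamma>)}" for \<gamma>
    have "\<exists>b\<in>B \<sigma>. g (cl \<gamma>) - b \<in> K (bcone (cl \<gamma>)) (bpoint (cl \<gamma>))" if \<gamma>: "\<gamma> \<in> scheme_points \<sigma>" for \<gamma>
    proof -
      note \<zeta> = class_in_Pts[OF \<sigma> \<gamma>, folded cl_def]
      note b = base[OF \<zeta>(1)]
      show ?thesis by (rule B_mod_K[OF \<sigma> b(2) conjunct1[OF b(5)[OF \<zeta>(2)]] b(3) g(1)[OF \<zeta>(1)]])
    qed
    \<comment> \<open>A germ given in the smallest chart has a representative in the larger ring
      \<open>B \<sigma>\<close>, where the remainder theorem is applied.\<close>
    then obtain b where b: "\<And>\<gamma>. \<gamma> \<in> scheme_points \<sigma> \<Longrightarrow> b \<gamma> \<in> B \<sigma>"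
      "\<And>\<gamma>. \<gamma> \<in> scheme_points \<sigma> \<Longrightarrow> g (cl \<gamma>) - b \<gamma> \<in> K (bcone (cl \<gamma>)) (bpoint (cl \<gamma>))"
      by metis
    obtain f where f: "f \<in> B \<sigma>" "\<And>\<gamma>. \<gamma> \<in> scheme_points \<sigma> \<Longrightarrow> f - b \<gamma> \<in> K \<sigma> \<gamma>"
      using germs_realized_chart[OF \<sigma> finite_scheme_points[OF \<sigma>] order_refl, of b] b(1) by blast
    have "f - g \<zeta> \<in> K (bcone \<zeta>) (bpoint \<zeta>)" if \<zeta>: "\<zeta> \<in> Pts" "bcone \<zeta> \<subseteq> \<sigma>" for \<zeta>
    proof -
      let ?\<gamma> = "restrict (bpoint \<zeta>) (dual_monoid \<sigma>)"
      note bs = base[OF \<zeta>(1)]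
      have m: "(\<sigma>, ?\<gamma>) \<in> \<zeta>" by (rule chart_member[OF \<zeta>(1) \<sigma> \<zeta>(2)])
      have \<gamma>: "?\<gamma> \<in> scheme_points \<sigma>" by (rule Pts_member(2)[OF \<zeta>(1) m])
      have cl: "cl ?\<gamma> = \<zeta>"
        using class_member_glue[OF _ m] \<zeta>(1) by (simp add: cl_def subscheme_points_def)
      have "f - b ?\<gamma> \<in> K (bcone \<zeta>) (bpoint \<zeta>)"
        using f(2)[OF \<gamma>] K_restrict[OF \<sigma> bs(2) \<zeta>(2) bs(4) chart.diff_B[OF f(1) b(1)[OF \<gamma>]]] by simp
      moreover have "g \<zeta> - b ?\<gamma> \<in> K (bcone \<zeta>) (bpoint \<zeta>)" using b(2)[OF \<gamma>] cl by simp
      ultimately have "(f - b ?\<gamma>) - (g \<zeta> - b ?\<gamma>) \<in> K (bcone \<zeta>) (bpoint \<zeta>)"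
        by (rule chart.alg_ideal_diff[OF K_ideal[OF bs(2,3)]])
      then show ?thesis by simp
    qed
    then show ?thesis using f(1) by blast
  qed
  then obtain f where f: "\<And>\<sigma>. \<sigma> \<in> \<Sigma> \<Longrightarrow> f \<sigma> \<in> B \<sigma>"
    "\<And>\<sigma> \<zeta>. \<sigma> \<in> \<Sigma> \<Longrightarrow> \<zeta> \<in> Pts \<Longrightarrow> bcone \<zeta> \<subseteq> \<sigma> \<Longrightarrow> f \<sigma> - g \<zeta> \<in> K (bcone \<zeta>) (bpoint \<zeta>)"
    by metis
  have "f \<sigma> - f \<tau> \<in> J (\<sigma> \<inter> \<tau>)" if \<sigma>\<tau>: "\<sigma> \<in> \<Sigma>" "\<tau> \<in> \<Sigma>" for \<sigma> \<tau>
  proof (rule in_J_if_germs)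
    show \<omega>: "\<sigma> \<inter> \<tau> \<in> \<Sigma>" by (rule fan_Int[OF \<sigma>\<tau>])
    show diffB: "f \<sigma> - f \<tau> \<in> B (\<sigma> \<inter> \<tau>)"
      using f(1) \<sigma>\<tau> B_antimono[of "\<sigma> \<inter> \<tau>" \<sigma>] B_antimono[of "\<sigma> \<inter> \<tau>" \<tau>] by (intro chart.diff_B) auto
    fix \<gamma> assume \<gamma>: "\<gamma> \<in> scheme_points (\<sigma> \<inter> \<tau>)"
    let ?\<zeta> = "glue \<Sigma> `` {(\<sigma> \<inter> \<tau>, \<gamma>)}"
    note \<zeta> = class_in_Pts[OF \<omega> \<gamma>]
    note bs = base[OF \<zeta>(1)]
    have sub: "bcone ?\<zeta> \<subseteq> \<sigma> \<inter> \<tau>" "\<gamma> = restrict (bpoint ?\<zeta>) (dual_monoid (\<sigma> \<inter> \<tau>))"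
      using bs(5)[OF \<zeta>(2)] by blast+
    have "f \<sigma> - g ?\<zeta> \<in> K (bcone ?\<zeta>) (bpoint ?\<zeta>)" "f \<tau> - g ?\<zeta> \<in> K (bcone ?\<zeta>) (bpoint ?\<zeta>)"
      using f(2)[OF \<sigma>\<tau>(1) \<zeta>(1)] f(2)[OF \<sigma>\<tau>(2) \<zeta>(1)] sub(1) by blast+
    then have "(f \<sigma> - g ?\<zeta>) - (f \<tau> - g ?\<zeta>) \<in> K (bcone ?\<zeta>) (bpoint ?\<zeta>)"
      by (rule chart.alg_ideal_diff[OF K_ideal[OF bs(2,3)]])
    then have "f \<sigma> - f \<tau> \<in> K (bcone ?\<zeta>) (bpoint ?\<zeta>)" by simp
    then show "f \<sigma> - f \<tau> \<in> K (\<sigma> \<inter> \<tau>) \<gamma>"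
      using K_restrict[OF \<omega> bs(2) sub(1) bs(4) diffB] sub(2) by simp
  qed
  then have fam: "family f" using f(1) by (simp add: family_def)
  have "germ_coord (section_of f) \<zeta> i = c \<zeta> i" if "\<zeta> \<in> Pts" "i < multiplicity_at \<rho> I \<zeta>" for \<zeta> i
  proof -
    note bs = base[OF that(1)]
    have "f (bcone \<zeta>) - g \<zeta> \<in> K (bcone \<zeta>) (bpoint \<zeta>)" by (rule f(2)[OF bs(2) that(1) order_refl])
    then have "\<Theta> \<zeta> (f (bcone \<zeta>)) i = \<Theta> \<zeta> (g \<zeta>) i"
      using \<Theta>(3)[OF that(1) f(1)[OF bs(2)] g(1)[OF that(1)]] that(2) by blast
    then show ?thesis using germ_coord_section[OF fam that] g(2)[OF that] by simp
  qed
  then show ?thesis using fam by blast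
qed

lemma vspace_iso_global_sections:
  assumes V: "has_vdim V (scheme_degree \<Sigma> \<rho> I)"
  shows "vspace_iso V G"
proof -
  let ?N = "scheme_degree \<Sigma> \<rho> I"
  \<comment> \<open>One index for each coordinate at each point; there are exactly as many as the
    degree.\<close>
  let ?Ix = "SIGMA \<zeta>:Pts. {..<multiplicity_at \<rho> I \<zeta>}"
  have "card ?Ix = ?N" using finite_Pts by (simp add: scheme_degree_def)
  moreover have "finite ?Ix" using finite_Pts by simp
  ultimately obtain h where h: "bij_betw h {..<?N} ?Ix"
    using ex_bij_betw_nat_finite[of ?Ix] by (auto simp: atLeast0LessThan)
  have hI: "fst (h n) \<in> Pts" "snd (h n) < multiplicity_at \<rho> I (fst (h n))" if "n < ?N" for n
  proof -
    have "h n \<in> ?Ix" using h that by (auto simp: bij_betw_def)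
    then show "fst (h n) \<in> Pts" "snd (h n) < multiplicity_at \<rho> I (fst (h n))" by auto
  qed
  define \<psi> where "\<psi> s n = germ_coord s (fst (h n)) (snd (h n))" for s n
  have \<psi>: "\<psi> (section_of f) n = \<Theta> (fst (h n)) (f (bcone (fst (h n)))) (snd (h n))"
    if "family f" "n < ?N" for f n
    unfolding \<psi>_def by (rule germ_coord_section[OF that(1) hI[OF that(2)]])
  have famB: "f (bcone (fst (h n))) \<in> B (bcone (fst (h n)))" if "family f" "n < ?N" for f n
    using that(1) base(2)[OF hI(1)[OF that(2)]] by (simp add: family_def)
  have GE: "\<exists>f. family f \<and> s = section_of f" if "s \<in> carrier G" for s
    using that unfolding carrier_G by blast
  have GI: "section_of f \<in> carrier G" if "family f" for f
    using that unfolding carrier_G by blast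
  have "linear_coordinates G ?N \<psi>"
    unfolding linear_coordinates_def
  proof (intro conjI allI ballI impI)
    fix s t n assume "s \<in> carrier G" "t \<in> carrier G" and n: "n < ?N"
    then obtain f g where fg: "family f" "s = section_of f" "family g" "t = section_of g" using GE by blast
    show "\<psi> (s \<oplus>\<^bsub>G\<^esub> t) n = \<psi> s n + \<psi> t n"
      unfolding fg(2,4) G_add \<psi>[OF family_add[OF fg(1,3)] n] \<psi>[OF fg(1) n] \<psi>[OF fg(3) n]
      by (rule \<Theta>(1)[OF hI(1)[OF n] famB[OF fg(1) n] famB[OF fg(3) n] hI(2)[OF n]])
  next
    fix c s n assume "s \<in> carrier G" and n: "n < ?N"
    then obtain f where f: "family f" "s = section_of f" using GE by blast
    show "\<psi> (c \<odot>\<^bsub>G\<^esub> s) n = c * \<psi> s n"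
      unfolding f(2) G_smult[OF f(1)] \<psi>[OF family_scale[OF f(1)] n] \<psi>[OF f(1) n]
      by (rule \<Theta>(2)[OF hI(1)[OF n] famB[OF f(1) n] hI(2)[OF n]])
  next
    fix s t assume "s \<in> carrier G" "t \<in> carrier G" and eq: "\<forall>n<?N. \<psi> s n = \<psi> t n"
    then obtain f g where fg: "family f" "s = section_of f" "family g" "t = section_of g" using GE by blast
    show "s = t"
      unfolding fg(2,4)
    proof (rule germ_coord_inj[OF fg(1,3)])
      fix \<zeta> i assume "\<zeta> \<in> Pts" "i < multiplicity_at \<rho> I \<zeta>"
      then have "(\<zeta>, i) \<in> h ` {..<?N}" using h by (simp add: bij_betw_def)
      then obtain n where "n < ?N" "h n = (\<zeta>, i)" by force
      then show "germ_coord (section_of f) \<zeta> i = germ_coord (section_of g) \<zeta> i"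
        using eq by (simp add: \<psi>_def fg(2,4)) (metis fst_conv snd_conv)
    qed
  next
    fix c :: "nat \<Rightarrow> complex"
    obtain f where f: "family f"
      "\<forall>\<zeta>\<in>Pts. \<forall>i<multiplicity_at \<rho> I \<zeta>. germ_coord (section_of f) \<zeta> i =
        c (the_inv_into {..<?N} h (\<zeta>, i))"
      using germ_coord_surj[of "\<lambda>\<zeta> i. c (the_inv_into {..<?N} h (\<zeta>, i))"] by blast
    have "\<psi> (section_of f) n = c n" if "n < ?N" for n
      using f(2) hI[OF that] h that by (simp add: \<psi>_def the_inv_into_f_f bij_betw_def)
    then show "\<exists>s\<in>carrier G. \<forall>n<?N. \<psi> s n = c n" using GI[OF f(1)] by blast
  qed
  then show ?thesis
  proof (rule vspace_iso_if_coordinates[OF V])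
    show "s \<oplus>\<^bsub>G\<^esub> t \<in> carrier G" if "s \<in> carrier G" "t \<in> carrier G" for s t
      using GE[OF that(1)] GE[OF that(2)] GI family_add by (auto simp: G_add)
    show "c \<odot>\<^bsub>G\<^esub> s \<in> carrier G" if "s \<in> carrier G" for c s
      using GE[OF that] GI family_scale by (auto simp: G_smult)
    show "\<zero>\<^bsub>G\<^esub> \<in> carrier G" unfolding G_zero by (rule GI[OF family_zero])
    show "\<psi> \<zero>\<^bsub>G\<^esub> n = 0" if n: "n < ?N" for n
    proof -
      \<comment> \<open>Homogeneity with the scalar 0 shows that the zero germ has zero
        coordinates.\<close>
      have "\<Theta> (fst (h n)) (chart.C 0 * 0) (snd (h n)) = 0 * \<Theta> (fst (h n)) 0 (snd (h n))"
        by (rule \<Theta>(2)[OF hI(1)[OF n] chart.zero_B hI(2)[OF n]])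
      then show ?thesis unfolding G_zero \<psi>[OF family_zero n] by simp
    qed
  qed
qed

end

theorem theorem4p1:
  fixes \<Sigma> :: "(real ^ 'n) set set"
    and \<rho> :: "'k::finite \<Rightarrow> (real ^ 'n) set"
    and I :: "'k cox set"
    and \<beta> :: "(int ^ 'k) set"
  assumes "complete_fan \<Sigma>"
    and "enumerates_rays \<Sigma> \<rho>"
    and "homogeneous_ideal \<rho> I"
    and "scheme_dim \<Sigma> \<rho> I = 0"
    and "\<beta> \<in> regularity \<Sigma> \<rho> I"
  shows "vspace_iso (quot_piece \<rho> I \<beta>) (global_sections \<Sigma> \<rho> I)"
proof -
  have "krull_dim (chart_alg \<rho> I \<sigma>) \<le> scheme_dim \<Sigma> \<rho> I" if "\<sigma> \<in> \<Sigma>" for \<sigma>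
    unfolding scheme_dim_def using that by (rule SUP_upper)
  then have "krull_dim (chart_alg \<rho> I \<sigma>) \<le> 0" if "\<sigma> \<in> \<Sigma>" for \<sigma>
    using that by (simp add: assms(4))
  moreover have "ideal I cox_ring" using assms(3) by (simp add: homogeneous_ideal_def)
  ultimately interpret zero_dim_toric_subscheme \<Sigma> \<rho> I
    using assms(1,2)
    by (intro zero_dim_toric_subscheme.intro toric_subscheme.intro ray_fan.intro
        toric_subscheme_axioms.intro zero_dim_toric_subscheme_axioms.intro)
  show ?thesis
    using assms(5) by (intro vspace_iso_global_sections) (simp add: regularity_def)
qed

end
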